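(* For positive integers $d$, $r$, $s$, let $\mathrm{Hom}_{\mathrm{U}(d)}(r,s)$ be the complex vector space of functions on $\mathrm{U}(d)$ given by polynomials that are homogeneous of degree $r$ in the matrix entries of $U\in\mathrm{U}(d)$ and homogeneous of degree $s$ in the matrix entries of $U^*$. Then \[ \dim \mathrm{Hom}_{\mathrm{U}(d)}(r,s) = \sum_{\substack{|\mu| = r-s \\ |\mu_+| \leq r}} d_\mu^{\,2}, \] where the sum runs over all nonincreasing integer sequences $\mu=(\mu_1,\ldots,\mu_d)$ of length $d$ satisfying the two indicated conditions, and \[ d_\mu = \prod_{1 \leq i < j \leq d} \frac{\mu_i - \mu_j + j-i}{j-i}. \]
   Context: $\mathrm{U}(d)$ is the group of $d\times d$ complex unitary matrices. For a nonincreasing integer sequence $\mu=(\mu_1\ge\mu_2\ge\cdots\ge\mu_d)$, $\mu_i\in\mathbb{Z}$, $|\mu|:=\sum_i\mu_i$ denotes the sum of its entries and $\mu_+$ denotes the subsequence of its positive entries (so $|\mu_+|$ is the sum of the positive entries of $\mu$). *)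

theory Defs
  imports
    "Jordan_Normal_Form.Schur_Decomposition"
    "HOL-Library.Function_Algebras"
    "HOL-Library.Poly_Mapping"
begin

definition unitary_group :: "nat \<Rightarrow> complex mat set" where
  "unitary_group d =
     {U \<in> carrier_mat d d. U * mat_adjoint U = 1\<^sub>m d \<and> mat_adjoint U * U = 1\<^sub>m d}"

(* Formal variables: Entry i j stands for the (i,j) entry of U, Adj_Entry i j for the
   (i,j) entry of U^*.  Indices are 0-based, as in Jordan_Normal_Form. *)
datatype entry_var = Entry nat nat | Adj_Entry nat nat

type_synonym monomial = "entry_var \<Rightarrow>\<^sub>0 nat"
type_synonym entry_poly = "monomial \<Rightarrow>\<^sub>0 complex"

definition entry_vars :: "nat \<Rightarrow> entry_var set" where
  "entry_vars d = {Entry i j | i j. i < d \<and> j < d}"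

definition adj_entry_vars :: "nat \<Rightarrow> entry_var set" where
  "adj_entry_vars d = {Adj_Entry i j | i j. i < d \<and> j < d}"

definition bihomogeneous :: "nat \<Rightarrow> nat \<Rightarrow> nat \<Rightarrow> entry_poly \<Rightarrow> bool" where
  "bihomogeneous d r s p \<longleftrightarrow>
     (\<forall>m \<in> Poly_Mapping.keys p.
        Poly_Mapping.keys m \<subseteq> entry_vars d \<union> adj_entry_vars d \<and>
        (\<Sum>v \<in> entry_vars d. Poly_Mapping.lookup m v) = r \<and>
        (\<Sum>v \<in> adj_entry_vars d. Poly_Mapping.lookup m v) = s)"

fun var_val :: "complex mat \<Rightarrow> entry_var \<Rightarrow> complex" where
  "var_val U (Entry i j) = U $$ (i, j)"
| "var_val U (Adj_Entry i j) = mat_adjoint U $$ (i, j)"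

definition eval_poly_at :: "entry_poly \<Rightarrow> complex mat \<Rightarrow> complex" where
  "eval_poly_at p U =
     (\<Sum>m \<in> Poly_Mapping.keys p. Poly_Mapping.lookup p m *
        (\<Prod>v \<in> Poly_Mapping.keys m. var_val U v ^ Poly_Mapping.lookup m v))"

(* A function on U(d) is represented by its extension by 0 to all matrices, so that two
   polynomials give the same element exactly when they agree on U(d). *)
definition Hom_U :: "nat \<Rightarrow> nat \<Rightarrow> nat \<Rightarrow> (complex mat \<Rightarrow> complex) set" where
  "Hom_U d r s =
     {(\<lambda>U. if U \<in> unitary_group d then eval_poly_at p U else 0) | p. bihomogeneous d r s p}"

definition fun_scale :: "complex \<Rightarrow> (complex mat \<Rightarrow> complex) \<Rightarrow> complex mat \<Rightarrow> complex" where
  "fun_scale c f = (\<lambda>U. c * f U)"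

global_interpretation fun_vs: vector_space fun_scale
  by unfold_locales (auto simp: fun_scale_def fun_eq_iff algebra_simps)

lemma eval_poly_at_superset:
  assumes "finite K" "Poly_Mapping.keys p \<subseteq> K"
  shows "eval_poly_at p U =
     (\<Sum>m \<in> K. Poly_Mapping.lookup p m *
        (\<Prod>v \<in> Poly_Mapping.keys m. var_val U v ^ Poly_Mapping.lookup m v))"
  unfolding eval_poly_at_def using assms
  by (intro sum.mono_neutral_left) (auto simp: in_keys_iff)

lemma eval_poly_at_add: "eval_poly_at (p + q) U = eval_poly_at p U + eval_poly_at q U"
proof -
  let ?K = "Poly_Mapping.keys p \<union> Poly_Mapping.keys q"
  have "finite ?K" by simp
  moreover have "Poly_Mapping.keys (p + q) \<subseteq> ?K" by (rule Poly_Mapping.keys_add)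
  ultimately show ?thesis
    by (simp add: eval_poly_at_superset[of ?K] lookup_add algebra_simps sum.distrib)
qed

lemma eval_poly_at_scale:
  "eval_poly_at (Poly_Mapping.map ((*) c) p) U = c * eval_poly_at p U"
proof -
  have "Poly_Mapping.keys (Poly_Mapping.map ((*) c) p) \<subseteq> Poly_Mapping.keys p"
    by (auto simp: in_keys_iff Poly_Mapping.map.rep_eq when_def)
  then show ?thesis
    by (simp add: eval_poly_at_superset[of "Poly_Mapping.keys p"] Poly_Mapping.map.rep_eq
        when_def sum_distrib_left in_keys_iff mult.assoc)
qed

lemma subspace_Hom_U: "fun_vs.subspace (Hom_U d r s)"
proof (rule fun_vs.subspaceI)
  show "0 \<in> Hom_U d r s"
    unfolding Hom_U_def
    by (auto intro!: exI[of _ 0] simp: bihomogeneous_def eval_poly_at_def fun_eq_iff)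
next
  fix f g assume "f \<in> Hom_U d r s" "g \<in> Hom_U d r s"
  then obtain p q where pq: "bihomogeneous d r s p" "bihomogeneous d r s q"
    and fg: "f = (\<lambda>U. if U \<in> unitary_group d then eval_poly_at p U else 0)"
      "g = (\<lambda>U. if U \<in> unitary_group d then eval_poly_at q U else 0)"
    unfolding Hom_U_def by auto
  have "bihomogeneous d r s (p + q)"
    using pq Poly_Mapping.keys_add[of p q] unfolding bihomogeneous_def by blast
  moreover have "f + g = (\<lambda>U. if U \<in> unitary_group d then eval_poly_at (p + q) U else 0)"
    by (auto simp: fg eval_poly_at_add fun_eq_iff)
  ultimately show "f + g \<in> Hom_U d r s"
    unfolding Hom_U_def by blast
next
  fix c f assume "f \<in> Hom_U d r s"
  then obtain p where p: "bihomogeneous d r s p"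
    and f: "f = (\<lambda>U. if U \<in> unitary_group d then eval_poly_at p U else 0)"
    unfolding Hom_U_def by auto
  let ?q = "Poly_Mapping.map ((*) c) p"
  have "Poly_Mapping.keys ?q \<subseteq> Poly_Mapping.keys p"
    by (auto simp: in_keys_iff Poly_Mapping.map.rep_eq when_def)
  then have "bihomogeneous d r s ?q"
    using p unfolding bihomogeneous_def by blast
  moreover have "fun_scale c f = (\<lambda>U. if U \<in> unitary_group d then eval_poly_at ?q U else 0)"
    by (auto simp: f fun_scale_def eval_poly_at_scale fun_eq_iff)
  ultimately show "fun_scale c f \<in> Hom_U d r s"
    unfolding Hom_U_def by blast
qed

definition d_mu :: "int list \<Rightarrow> real" where
  "d_mu \<mu> =
     (\<Prod>(i, j) \<in> {(i, j). i < j \<and> j < length \<mu>}.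
        (of_int (\<mu> ! i) - of_int (\<mu> ! j) + real j - real i) / (real j - real i))"

definition weights :: "nat \<Rightarrow> nat \<Rightarrow> nat \<Rightarrow> int list set" where
  "weights d r s =
     {\<mu>. length \<mu> = d \<and> sorted_wrt (\<ge>) \<mu> \<and>
          sum_list \<mu> = int r - int s \<and> sum_list (filter (\<lambda>k. k > 0) \<mu>) \<le> int r}"

lemma finite_weights: "finite (weights d r s)"
proof (rule finite_subset)
  show "finite {\<mu>. set \<mu> \<subseteq> {- int s..int r} \<and> length \<mu> = d}"
    by (rule finite_lists_length_eq) simp
  have up: "k \<le> sum_list (filter (\<lambda>k. k > 0) \<mu>)" if "k \<in> set \<mu>" for k and \<mu> :: "int list"
  proof -
    have "0 \<le> sum_list (filter (\<lambda>k. k > 0) \<nu>)" for \<nu> :: "int list"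
      by (intro sum_list_nonneg) auto
    note nn = this
    show ?thesis using that
    proof (induction \<mu>)
      case (Cons a \<mu>)
      then show ?case using nn[of \<mu>] by (auto split: if_splits)
    qed simp
  qed
  have low: "sum_list \<mu> - sum_list (filter (\<lambda>k. k > 0) \<mu>) \<le> k"
    if "k \<in> set \<mu>" for k and \<mu> :: "int list"
  proof -
    have "sum_list \<nu> \<le> sum_list (filter (\<lambda>k. k > 0) \<nu>)" for \<nu> :: "int list"
      by (induction \<nu>) auto
    note le = this
    show ?thesis using that
    proof (induction \<mu>)
      case (Cons a \<mu>)
      then show ?case using le[of \<mu>] by (auto split: if_splits)
    qed simp
  qed
  show "weights d r s \<subseteq> {\<mu>. set \<mu> \<subseteq> {- int s..int r} \<and> length \<mu> = d}"
  proof (intro subsetI CollectI conjI)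
    fix \<mu> k assume "\<mu> \<in> weights d r s" "k \<in> set \<mu>"
    then show "k \<in> {- int s..int r}"
      using up[of k \<mu>] low[of k \<mu>] unfolding weights_def by auto
  qed (auto simp: weights_def)
qed

end

(* Consider the d x 2d matrices [U | 1] and [1 | U^*] = U^{-1} [U | 1].  The entries of U and of U^* are
   maximal minors of these matrices, and by Jacobi every maximal minor of the second is det U^{-1}
   times the one of the first.  So Hom(r,s) is det U^{-s} times a span of products of r + s maximal
   minors of [U | 1], that is, of tableaux with r + s columns of length d and entries below 2d.
   Straightening by Garnir relations shows that the standard tableaux with r + s(d - 1) entries below
   d, at least s(d - 1) of them in the first s columns, span.  They are independent for a generic
   d x 2d matrix because their diagonal leading monomials are distinct, hence on U(d) by Zariski
   density.  A standard tableau is a chain of interlacing partitions from 0 to the full rectangle;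
   if mu + s is its middle term, its two halves are Gelfand-Tsetlin patterns with top row mu + s and
   with top row the complementary partition, and there are d_mu of each. *)
theory Submission
  imports Defs
begin

section \<open>Minors and the Garnir relation\<close>

text \<open>No Peter-Weyl or Schur-Weyl theory enters: the dimension is the size of an explicit
  basis. The delicate point is the bidegree. When the first \<open>s\<close> columns of a tableau
  are read in [1 | U^*] and the others in [U | 1], the number of entries below \<open>d\<close>
  fixes only the difference r - s of the two degrees. The inequality on the first \<open>s\<close>
  columns says that the degree in U is at most r; the deficit is filled with factors sum_k U_0k
  U^*_k0 = 1, which is how lower bidegrees sit inside Hom(r,s). On the middle shape mu + s the
  inequality reads |mu_+| <= r. So straightening has to preserve a one-sided condition, and it does
  because a Garnir exchange never lowers the number of small entries in the left column of a pair.
  Independence can be tested on arbitrary d x 2d arrays, where a monomial curve is available,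
  because vanishing on U(d) propagates to them by the Cayley transform. The squares arise because
  the two halves of a chain can be filled in equally many ways: the product formula is unchanged by
  complementing and reversing.\<close>

lemma sum_fun_apply: "(\<Sum>x\<in>S. F x) y = (\<Sum>x\<in>S. F x y)"
  by (induction S rule: infinite_finite_induct) auto

lemma permutes_bound:
  fixes \<pi> :: "nat \<Rightarrow> nat"
  assumes "\<pi> permutes {0..<n}" "k < n"
  shows "\<pi> k < n"
  using permutes_in_image[OF assms(1), of k] assms(2) by simp

text \<open>\<open>Y\<close> is an array with \<open>d\<close> relevant rows and columns indexed by
  all of \<open>nat\<close>, and \<open>c\<close> selects \<open>d\<close> of its columns; the
  matrix is written transposed, so that the selected columns are its rows. An array instead of a
  matrix lets [U | 1], [1 | U^*] and the monomial curve be treated alike.\<close>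

definition minor :: "nat \<Rightarrow> (nat \<Rightarrow> nat \<Rightarrow> complex) \<Rightarrow> (nat \<Rightarrow> nat) \<Rightarrow> complex" where
  "minor d Y c = det (mat d d (\<lambda>(k, j). Y j (c k)))"

lemma minor_leibniz:
  "minor d Y c = (\<Sum>\<pi> | \<pi> permutes {0..<d}. of_int (sign \<pi>) * (\<Prod>k = 0..<d. Y (\<pi> k) (c k)))"
  unfolding minor_def
proof (subst det_def'[of _ d], simp, intro sum.cong refl)
  fix \<pi> assume "\<pi> \<in> {p. p permutes {0..<d}}"
  then have "\<pi> k < d" if "k < d" for k using that by (simp add: permutes_bound)
  then show "of_int (sign \<pi>) * (\<Prod>i = 0..<d. mat d d (\<lambda>(k, j). Y j (c k)) $$ (i, \<pi> i)) =
     of_int (sign \<pi>) * (\<Prod>k = 0..<d. Y (\<pi> k) (c k))"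
    by simp
qed

lemma minor_cong:
  assumes "\<And>k j. k < d \<Longrightarrow> j < d \<Longrightarrow> Y j (c k) = Z j (e k)"
  shows "minor d Y c = minor d Z e"
proof -
  have "mat d d (\<lambda>(k, j). Y j (c k)) = mat d d (\<lambda>(k, j). Z j (e k))"
    using assms by (intro eq_matI) auto
  then show ?thesis unfolding minor_def by simp
qed

lemma minor_permute:
  assumes "\<sigma> permutes {0..<d}"
  shows "minor d Y (\<lambda>k. c (\<sigma> k)) = of_int (sign \<sigma>) * minor d Y c"
proof -
  have "mat d d (\<lambda>(k, j). Y j (c (\<sigma> k))) =
      mat d d (\<lambda>(k, j). mat d d (\<lambda>(k, j). Y j (c k)) $$ (\<sigma> k, j))"
    using permutes_bound[OF assms] by (intro eq_matI) auto
  then show ?thesis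
    unfolding minor_def using det_permute_rows[OF _ assms, of "mat d d (\<lambda>(k, j). Y j (c k))"] by simp
qed

lemma minor_repeated:
  assumes "k < d" "l < d" "k \<noteq> l" "c k = c l"
  shows "minor d Y c = 0"
  unfolding minor_def
  by (rule det_identical_rows[of _ d k l]) (use assms in \<open>auto intro!: eq_vecI\<close>)

lemma minor_mult_left:
  assumes G: "G \<in> carrier_mat d d"
    and Y: "\<And>k j. k < d \<Longrightarrow> j < d \<Longrightarrow> Y' j (c k) = (\<Sum>l = 0..<d. G $$ (j, l) * Y l (c k))"
  shows "minor d Y' c = det G * minor d Y c"
proof -
  have "mat d d (\<lambda>(k, j). Y' j (c k)) = mat d d (\<lambda>(k, j). Y j (c k)) * G\<^sup>T" (is "?A = ?B * _")
    using G by (intro eq_matI) (auto simp: scalar_prod_def Y mult.commute)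
  then show ?thesis
    unfolding minor_def using G det_transpose[OF G]
    by (simp add: det_mult[of _ d] transpose_carrier_mat)
qed

text \<open>The sum over all permutations is alternating in \<^term>\<open>d + 1\<close> vectors of a \<^term>\<open>d\<close>-dimensional
  space: after expanding both minors it is a combination of determinants of order \<^term>\<open>d + 1\<close> with two
  equal rows.\<close>
lemma garnir_relation:
  assumes i: "i < d"
  shows "(\<Sum>\<sigma> | \<sigma> permutes {0..<Suc d}. of_int (sign \<sigma>) *
     (minor d Y (\<lambda>k. if k < i then a k else y (\<sigma> (Suc k))) *
      minor d Y (\<lambda>k. if k \<le> i then y (\<sigma> k) else b k))) = 0"
proof -
  let ?P = "{\<pi>. \<pi> permutes {0..<d}}"
  let ?S = "{\<sigma>. \<sigma> permutes {0..<Suc d}}"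
  define A where "A \<pi> = (\<Prod>k = 0..<i. Y (\<pi> k) (a k))" for \<pi>
  define B where "B \<rho> = (\<Prod>k = Suc i..<d. Y (\<rho> k) (b k))" for \<rho>
  \<comment> \<open>The vector \<open>y (\<sigma> l)\<close> sits at position \<open>l\<close> of
    the second minor if \<open>l \<le> i\<close>, and at position \<open>l - 1\<close> of the first
    otherwise; \<open>row\<close> is the coordinate that the two Leibniz terms take from it. It maps
    \<open>d + 1\<close> positions into \<open>d\<close> coordinates, hence repeats a value.\<close>
  define row where "row \<pi> \<rho> l = (if l \<le> i then \<rho> l else \<pi> (l - 1))" for \<pi> \<rho> :: "nat \<Rightarrow> nat" and l
  have expand: "(\<Prod>k = 0..<d. Y (\<pi> k) (if k < i then a k else y (\<sigma> (Suc k)))) *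
      (\<Prod>k = 0..<d. Y (\<rho> k) (if k \<le> i then y (\<sigma> k) else b k)) =
      A \<pi> * B \<rho> * (\<Prod>l = 0..<Suc d. Y (row \<pi> \<rho> l) (y (\<sigma> l)))" for \<pi> \<rho> \<sigma>
  proof -
    have 1: "(\<Prod>k = 0..<d. Y (\<pi> k) (if k < i then a k else y (\<sigma> (Suc k)))) =
        A \<pi> * (\<Prod>k = i..<d. Y (\<pi> k) (y (\<sigma> (Suc k))))"
      unfolding A_def using i by (subst prod.atLeastLessThan_concat[of 0 i d, symmetric]) auto
    have 2: "(\<Prod>k = i..<d. Y (\<pi> k) (y (\<sigma> (Suc k)))) =
        (\<Prod>l = Suc i..<Suc d. Y (row \<pi> \<rho> l) (y (\<sigma> l)))"
      by (subst prod.shift_bounds_Suc_ivl) (auto simp: row_def)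
    have 3: "(\<Prod>k = 0..<d. Y (\<rho> k) (if k \<le> i then y (\<sigma> k) else b k)) =
        (\<Prod>l = 0..<Suc i. Y (row \<pi> \<rho> l) (y (\<sigma> l))) * B \<rho>"
      unfolding B_def using i
      by (subst prod.atLeastLessThan_concat[of 0 "Suc i" d, symmetric]) (auto simp: row_def)
    show ?thesis
      unfolding 1 2 3 using i
      by (subst prod.atLeastLessThan_concat[of 0 "Suc i" "Suc d", symmetric]) (auto simp: mult_ac)
  qed
  have zero: "(\<Sum>\<sigma> \<in> ?S. of_int (sign \<sigma>) * (\<Prod>l = 0..<Suc d. Y (row \<pi> \<rho> l) (y (\<sigma> l)))) = 0"
    if "\<pi> \<in> ?P" "\<rho> \<in> ?P" for \<pi> \<rho>
  proof -
    let ?M = "mat (Suc d) (Suc d) (\<lambda>(l, l'). Y (row \<pi> \<rho> l) (y l'))"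
    have "row \<pi> \<rho> ` {0..<Suc d} \<subseteq> {0..<d}"
    proof
      fix x assume "x \<in> row \<pi> \<rho> ` {0..<Suc d}"
      then show "x \<in> {0..<d}"
        using i that unfolding row_def by (auto simp: permutes_bound split: if_splits)
    qed
    then have "card (row \<pi> \<rho> ` {0..<Suc d}) \<le> d"
      using card_mono[of "{0..<d}"] by fastforce
    then have "\<not> inj_on (row \<pi> \<rho>) {0..<Suc d}"
      by (intro pigeonhole) simp
    then obtain l l' where l: "l < Suc d" "l' < Suc d" "l \<noteq> l'" "row \<pi> \<rho> l = row \<pi> \<rho> l'"
      unfolding inj_on_def by auto
    have "det ?M = 0"
      by (rule det_identical_rows[of _ "Suc d" l l']) (use l in \<open>auto intro!: eq_vecI\<close>)
    moreover have "det ?M = (\<Sum>\<sigma> \<in> ?S. of_int (sign \<sigma>) * (\<Prod>l = 0..<Suc d. Y (row \<pi> \<rho> l) (y (\<sigma> l))))"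
      by (subst det_def'[of _ "Suc d"], simp, intro sum.cong refl arg_cong2[of _ _ _ _ "(*)"] prod.cong)
         (use permutes_bound in \<open>fastforce\<close>)
    ultimately show ?thesis by simp
  qed
  have "(\<Sum>\<sigma> \<in> ?S. of_int (sign \<sigma>) *
     (minor d Y (\<lambda>k. if k < i then a k else y (\<sigma> (Suc k))) *
      minor d Y (\<lambda>k. if k \<le> i then y (\<sigma> k) else b k))) =
    (\<Sum>\<sigma> \<in> ?S. \<Sum>\<pi> \<in> ?P. \<Sum>\<rho> \<in> ?P. of_int (sign \<pi>) * of_int (sign \<rho>) * A \<pi> * B \<rho> *
      (of_int (sign \<sigma>) * (\<Prod>l = 0..<Suc d. Y (row \<pi> \<rho> l) (y (\<sigma> l)))))"
  proof (intro sum.cong refl, goal_cases)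
    case (1 \<sigma>)
    have *: "minor d Y (\<lambda>k. if k < i then a k else y (\<sigma> (Suc k))) *
      minor d Y (\<lambda>k. if k \<le> i then y (\<sigma> k) else b k) =
      (\<Sum>\<pi> \<in> ?P. \<Sum>\<rho> \<in> ?P. (of_int (sign \<pi>) * of_int (sign \<rho>)) *
       ((\<Prod>k = 0..<d. Y (\<pi> k) (if k < i then a k else y (\<sigma> (Suc k)))) *
      (\<Prod>k = 0..<d. Y (\<rho> k) (if k \<le> i then y (\<sigma> k) else b k))))"
      unfolding minor_leibniz sum_product by (simp only: mult_ac)
    show ?case
      unfolding * expand sum_distrib_left by (intro sum.cong refl) (simp only: mult_ac)
  qed
  also have "\<dots> = (\<Sum>\<pi> \<in> ?P. \<Sum>\<rho> \<in> ?P. \<Sum>\<sigma> \<in> ?S. of_int (sign \<pi>) * of_int (sign \<rho>) * A \<pi> * B \<rho> *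
      (of_int (sign \<sigma>) * (\<Prod>l = 0..<Suc d. Y (row \<pi> \<rho> l) (y (\<sigma> l)))))"
    by (subst sum.swap, intro sum.cong refl sum.swap)
  also have "\<dots> = 0"
    by (rule sum.neutral, rule ballI, rule sum.neutral, rule ballI)
      (simp only: sum_distrib_left[symmetric] zero mem_Collect_eq mult_zero_right)
  finally show ?thesis .
qed

text \<open>Such a permutation only reorders the vectors within each minor, and the signs from the
  two minors multiply to \<open>sign \<sigma>\<close>, which cancels. Hence all stabilizer terms of
  the Garnir sum coincide with the original product.\<close>

lemma garnir_stabilizer:
  assumes i: "i < d" and \<sigma>: "\<sigma> permutes {0..<Suc d}" and inv: "\<sigma> ` {0..i} = {0..i}"
    and y: "\<And>k. y k = (if k \<le> i then b k else a (k - 1))"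
  shows "of_int (sign \<sigma>) *
     (minor d Y (\<lambda>k. if k < i then a k else y (\<sigma> (Suc k))) *
      minor d Y (\<lambda>k. if k \<le> i then y (\<sigma> k) else b k)) = minor d Y a * minor d Y b"
proof -
  define \<sigma>1 where "\<sigma>1 k = (if k \<le> i then \<sigma> k else k)" for k
  define \<sigma>2 where "\<sigma>2 k = (if k \<le> i then k else \<sigma> k)" for k
  have inj: "inj \<sigma>" using \<sigma> by (rule permutes_inj)
  have lo: "\<sigma> k \<le> i" if "k \<le> i" for k using inv that by auto
  have hi: "i < \<sigma> k" if "i < k" for k
  proof (rule ccontr)
    assume "\<not> i < \<sigma> k"
    then have "\<sigma> k \<in> \<sigma> ` {0..i}" using inv by auto
    then obtain x where "x \<le> i" "\<sigma> k = \<sigma> x" by auto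
    then show False using injD[OF inj, of k x] that by simp
  qed
  have hid: "\<sigma> k \<le> d" if "k \<le> d" for k using permutes_bound[OF \<sigma>, of k] that by simp
  have s1: "\<sigma>1 permutes {0..i}"
  proof (rule bij_imp_permutes)
    have "inj_on \<sigma>1 {0..i}" using inj by (auto simp: inj_on_def \<sigma>1_def inj_def)
    moreover have "\<sigma>1 ` {0..i} = {0..i}" using inv by (auto simp: \<sigma>1_def image_def)
    ultimately show "bij_betw \<sigma>1 {0..i} {0..i}" by (simp add: bij_betw_def)
  qed (auto simp: \<sigma>1_def)
  have s2: "\<sigma>2 permutes {Suc i..d}"
  proof (rule bij_imp_permutes)
    have "inj_on \<sigma>2 {Suc i..d}" using inj by (auto simp: inj_on_def \<sigma>2_def inj_def)
    moreover have "\<sigma>2 ` {Suc i..d} \<subseteq> {Suc i..d}" using hi hid by (auto simp: \<sigma>2_def Suc_le_eq)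
    ultimately show "bij_betw \<sigma>2 {Suc i..d} {Suc i..d}"
      by (simp add: bij_betw_def endo_inj_surj)
  next
    fix x assume "x \<notin> {Suc i..d}"
    then show "\<sigma>2 x = x" using \<sigma> by (auto simp: \<sigma>2_def permutes_def)
  qed
  have "\<sigma> = \<sigma>1 \<circ> \<sigma>2" using hi by (force simp: fun_eq_iff \<sigma>1_def \<sigma>2_def not_le)
  then have sgn: "sign \<sigma> = sign \<sigma>1 * sign \<sigma>2"
    using sign_compose s1 s2 permutes_imp_permutation by (metis finite_atLeastAtMost)
  \<comment> \<open>The vector \<open>y (Suc k)\<close> belongs to position \<open>k\<close> of the
    first minor, so the permutation of \<open>{Suc i..d}\<close> has to be transported to
    \<open>{i..<d}\<close>; this keeps its sign.\<close>
  define \<tau> where "\<tau> = map_permutation {Suc i..d} (\<lambda>k. k - 1) \<sigma>2"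
  have injs: "inj_on (\<lambda>k. k - 1) {Suc i..d}" by (auto simp: inj_on_def)
  have im: "(\<lambda>k. k - 1) ` {Suc i..d} = {i..<d}"
    by (auto simp: image_iff intro!: bexI[of _ "Suc _"])
  have t: "\<tau> permutes {i..<d}"
    using map_permutation_permutes[OF bij_betw_imageI[OF injs im] s2] by (simp add: \<tau>_def)
  have sgt: "sign \<tau> = sign \<sigma>2" unfolding \<tau>_def using injs s2 by (rule sign_map_permutation) simp
  have teq: "\<tau> k = \<sigma> (Suc k) - 1" if "i \<le> k" "k < d" for k
    unfolding \<tau>_def using map_permutation_apply[OF injs, of "Suc k" \<sigma>2] that by (simp add: \<sigma>2_def)
  have tlo: "\<tau> k = k" if "k < i" for k using permutes_not_in[OF t] that by auto
  have "minor d Y (\<lambda>k. if k < i then a k else y (\<sigma> (Suc k))) = minor d Y (\<lambda>k. a (\<tau> k))"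
  proof (rule minor_cong)
    fix k j assume "k < d"
    then show "Y j (if k < i then a k else y (\<sigma> (Suc k))) = Y j (a (\<tau> k))"
      using hi[of "Suc k"] by (auto simp: tlo teq y)
  qed
  also have "\<dots> = of_int (sign \<sigma>2) * minor d Y a"
    using minor_permute[of \<tau> d Y a] permutes_subset[OF t, of "{0..<d}"] sgt by auto
  finally have A: "minor d Y (\<lambda>k. if k < i then a k else y (\<sigma> (Suc k))) = of_int (sign \<sigma>2) * minor d Y a" .
  have "minor d Y (\<lambda>k. if k \<le> i then y (\<sigma> k) else b k) = minor d Y (\<lambda>k. b (\<sigma>1 k))"
    by (rule minor_cong) (auto simp: \<sigma>1_def y lo)
  also have "\<dots> = of_int (sign \<sigma>1) * minor d Y b"
    by (rule minor_permute, rule permutes_subset[OF s1]) (use i in auto)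
  finally have B: "minor d Y (\<lambda>k. if k \<le> i then y (\<sigma> k) else b k) = of_int (sign \<sigma>1) * minor d Y b" .
  have "(of_int (sign \<sigma>1) * of_int (sign \<sigma>1) :: complex) = 1" "(of_int (sign \<sigma>2) * of_int (sign \<sigma>2) :: complex) = 1"
    by (simp_all flip: of_int_mult)
  then show ?thesis unfolding A B sgn of_int_mult
    by (metis (no_types, lifting) mult.assoc mult.commute mult.left_commute mult_1)
qed

section \<open>Straightening\<close>

text \<open>Match \<open>I - J\<close> with \<open>J - I\<close> by any bijection: no replacement
  lowers \<open>f\<close>. It will be applied to index blocks of an increasing sequence with
  \<open>f\<close> a threshold indicator, and the strict variant with \<open>f\<close> the entry
  itself.\<close>

lemma sum_exchange_le:
  fixes f :: "'a \<Rightarrow> nat"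
  assumes "finite I" "finite J" "card I = card J" "\<And>k l. k \<in> I \<Longrightarrow> l \<in> J - I \<Longrightarrow> f k \<le> f l"
  shows "sum f I \<le> sum f J"
proof -
  have "card (I - J) = card (J - I)"
    using assms(1-3) by (simp add: card_Diff_subset_Int Int_commute)
  then obtain h where h: "bij_betw h (I - J) (J - I)"
    using finite_same_card_bij[of "I - J" "J - I"] assms by auto
  have "sum f (I - J) \<le> (\<Sum>x \<in> I - J. f (h x))"
    by (intro sum_mono assms(4)) (use h in \<open>auto dest: bij_betwE\<close>)
  also have "\<dots> = sum f (J - I)" by (rule sum.reindex_bij_betw[OF h])
  finally show ?thesis
    using sum.Int_Diff[of I f J] sum.Int_Diff[of J f I] assms(1,2) by (simp add: Int_commute)
qed

lemma sum_exchange_less: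
  fixes f :: "'a \<Rightarrow> nat"
  assumes "finite I" "finite J" "card I = card J" "I \<noteq> J" "\<And>k l. k \<in> I \<Longrightarrow> l \<in> J - I \<Longrightarrow> f k < f l"
  shows "sum f I < sum f J"
proof -
  have "card (I - J) = card (J - I)"
    using assms(1-3) by (simp add: card_Diff_subset_Int Int_commute)
  then obtain h where h: "bij_betw h (I - J) (J - I)"
    using finite_same_card_bij[of "I - J" "J - I"] assms by auto
  have ne: "I - J \<noteq> {}"
    using assms(1-4) card_subset_eq[of J I] by auto
  have "sum f (I - J) < (\<Sum>x \<in> I - J. f (h x))"
    by (intro sum_strict_mono ne assms(5)) (use assms h in \<open>auto dest: bij_betwE\<close>)
  also have "\<dots> = sum f (J - I)" by (rule sum.reindex_bij_betw[OF h])
  finally show ?thesis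
    using sum.Int_Diff[of I f J] sum.Int_Diff[of J f I] assms(1,2) by (simp add: Int_commute)
qed

lemma not_sorted_wrt_adjacent:
  assumes "transp R" "\<not> sorted_wrt R T"
  obtains xs a b ys where "T = xs @ a # b # ys" "\<not> R a b"
proof -
  have "\<exists>xs a b ys. T = xs @ a # b # ys \<and> \<not> R a b"
    using assms(2)
  proof (induction T)
    case (Cons a T)
    show ?case
    proof (cases "sorted_wrt R T")
      case False
      then show ?thesis using Cons.IH by (metis append_Cons)
    next
      case True
      then obtain x where x: "x \<in> set T" "\<not> R a x" using Cons.prems by auto
      obtain b ys where T: "T = b # ys" using x by (cases T) auto
      have "\<not> R a b"
      proof
        assume "R a b"
        moreover have "x = b \<or> R b x" using x True T by auto
        ultimately show False using x \<open>transp R\<close> by (auto dest: transpD)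
      qed
      then show ?thesis using T by (metis append_Nil)
    qed
  qed simp
  then show thesis using that by blast
qed

lemma sum_list_mset: "mset xs = mset ys \<Longrightarrow> sum_list xs = (sum_list ys :: nat)"
  by (metis sum_mset_sum_list)

lemma length_filter_mset: "mset xs = mset ys \<Longrightarrow> length (filter P xs) = length (filter P ys)"
  by (metis mset_filter size_mset)

text \<open>The sum over all columns of the column number, counted from 0, times the entry sum of
  the column. It grows when large entries move to the right.\<close>

fun pos_weight :: "nat list list \<Rightarrow> nat" where
  "pos_weight [] = 0"
| "pos_weight (c # T) = sum_list (concat T) + pos_weight T"

lemma pos_weight_bound: "pos_weight T \<le> length T * sum_list (concat T)"
proof (induction T)
  case (Cons c T)
  have "pos_weight (c # T) \<le> sum_list (concat T) + length T * sum_list (concat T)"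
    using Cons.IH by simp
  also have "\<dots> = length (c # T) * sum_list (concat T)" by simp
  also have "\<dots> \<le> length (c # T) * sum_list (concat (c # T))" by (intro mult_left_mono) auto
  finally show ?case .
qed simp

lemma pos_weight_adjacent_less:
  assumes "sum_list a + sum_list b = sum_list a' + sum_list b'" "sum_list b < sum_list b'"
  shows "pos_weight (xs @ a # b # ys) < pos_weight (xs @ a' # b' # ys)"
proof (induction xs)
  case (Cons x xs)
  have "sum_list (concat (xs @ a # b # ys)) = sum_list (concat (xs @ a' # b' # ys))"
    using assms(1) by simp
  then show ?case using Cons.IH by simp
qed (use assms in simp)

definition low :: "nat \<Rightarrow> nat list list \<Rightarrow> nat" where
  "low n T = length (filter (\<lambda>v. v < n) (concat T))"

lemma low_simps [simp]:
  "low n [] = 0" "low n (c # T) = length (filter (\<lambda>v. v < n) c) + low n T"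
  "low n (S @ T) = low n S + low n T"
  by (simp_all add: low_def)

text \<open>Only a cut between \<open>a\<close> and \<open>b\<close> can change the count; any other
  cut keeps both columns or neither, and the pair as a whole keeps its entries.\<close>

lemma low_take_adjacent:
  assumes "mset a + mset b = mset a' + mset b'"
    and "length (filter (\<lambda>v. v < n) a) \<le> length (filter (\<lambda>v. v < n) a')"
  shows "low n (take s (xs @ a # b # ys)) \<le> low n (take s (xs @ a' # b' # ys))"
proof -
  have "length (filter (\<lambda>v. v < n) (a @ b)) = length (filter (\<lambda>v. v < n) (a' @ b'))"
    using assms(1) by (intro length_filter_mset) simp
  then show ?thesis
    using assms(2) by (cases "s - length xs"; cases "s - length xs - 1") (auto simp: take_Cons' )
qed

lemma mset_concat_map_sort: "mset (concat (map sort T)) = mset (concat T)"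
  by (induction T) auto

lemma pos_weight_map_sort: "pos_weight (map sort T) = pos_weight T"
  by (induction T) (auto intro: sum_list_mset simp: mset_concat_map_sort)

lemma low_map_sort: "low n (map sort T) = low n T"
  unfolding low_def by (rule length_filter_mset) (rule mset_concat_map_sort)

text \<open>The factor is the sign of the sorting permutation. It is chosen before \<open>Y\<close>,
  since the relation is used between functions of a varying matrix.\<close>

lemma minor_sort:
  assumes "length c = d"
  shows "\<exists>e. \<forall>Y. minor d Y (nth c) = e * minor d Y (nth (sort c))"
proof -
  obtain p where p: "p permutes {..<length (sort c)}" "permute_list p (sort c) = c"
    using mset_eq_permutation[of c "sort c"] by auto
  have "minor d Y (nth c) = of_int (sign p) * minor d Y (nth (sort c))" for Y
  proof -
    have "minor d Y (nth c) = minor d Y (\<lambda>k. sort c ! p k)"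
      by (rule minor_cong) (use assms permute_list_nth[OF p(1)] p(2) in auto)
    also have "\<dots> = of_int (sign p) * minor d Y (nth (sort c))"
      by (rule minor_permute) (use p(1) assms in \<open>simp add: atLeast0LessThan\<close>)
    finally show ?thesis .
  qed
  then show ?thesis by blast
qed

text \<open>At a violation \<open>b ! i < a ! i\<close> the sequence b_0 < ... < b_i < a_i < ... <
  a_(d-1) consists of \<open>d + 1\<close> increasing values. In its Garnir sum every permutation
  that does not stabilize the first block moves a later, hence larger, value into the right column.
  This gives both the strict growth of \<open>sum_list\<close> and, threshold by threshold, the
  estimate for the left column. The new columns may be unsorted or contain repetitions.\<close>

lemma straighten_pair:
  assumes len: "length a = d" "length b = d"
    and inc: "sorted_wrt (<) a" "sorted_wrt (<) b"
    and bad: "\<not> list_all2 (\<le>) a b"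
  obtains I :: "(nat \<Rightarrow> nat) set" and q A B where
    "finite I"
    "\<And>Y. minor d Y (nth a) * minor d Y (nth b) =
        (\<Sum>\<sigma>\<in>I. q \<sigma> * (minor d Y (nth (A \<sigma>)) * minor d Y (nth (B \<sigma>))))"
    "\<And>\<sigma>. \<sigma> \<in> I \<Longrightarrow> length (A \<sigma>) = d \<and> length (B \<sigma>) = d"
    "\<And>\<sigma>. \<sigma> \<in> I \<Longrightarrow> mset a + mset b = mset (A \<sigma>) + mset (B \<sigma>)"
    "\<And>\<sigma>. \<sigma> \<in> I \<Longrightarrow> sum_list b < sum_list (B \<sigma>)"
    "\<And>\<sigma> n. \<sigma> \<in> I \<Longrightarrow> length (filter (\<lambda>v. v < n) a) \<le> length (filter (\<lambda>v. v < n) (A \<sigma>))"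
proof -
  obtain i where i: "i < d" "b ! i < a ! i"
    using bad len by (auto simp: list_all2_conv_all_nth not_le)
  define y where "y k = (if k \<le> i then b ! k else a ! (k - 1))" for k
  have ymono: "y k < y l" if "k < l" "l \<le> d" for k l
  proof -
    consider "l \<le> i" | "i < k" | "k \<le> i" "i < l" using that by linarith
    then show ?thesis
    proof cases
      case 1
      then show ?thesis using that i len inc unfolding y_def by (simp add: sorted_wrt_iff_nth_less)
    next
      case 2
      then show ?thesis using that i len inc unfolding y_def by (simp add: sorted_wrt_iff_nth_less)
    next
      case 3
      have "b ! k \<le> b ! i" using 3 i len inc(2) by (cases "k = i") (auto simp: sorted_wrt_iff_nth_less less_imp_le)
      also have "\<dots> < a ! i" by (rule i)
      also have "\<dots> \<le> a ! (l - 1)" using 3 that i len inc(1)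
        by (cases "l - 1 = i") (auto simp: sorted_wrt_iff_nth_less less_imp_le)
      finally show ?thesis using 3 by (simp add: y_def)
    qed
  qed
  define S where "S = {\<sigma>. \<sigma> permutes {0..<Suc d}}"
  define S1 where "S1 = {\<sigma> \<in> S. \<sigma> ` {0..i} = {0..i}}"
  define I where "I = S - S1"
  define A where "A \<sigma> = map (\<lambda>k. if k < i then a ! k else y (\<sigma> (Suc k))) [0..<d]" for \<sigma>
  define B where "B \<sigma> = map (\<lambda>k. if k \<le> i then y (\<sigma> k) else b ! k) [0..<d]" for \<sigma>
  \<comment> \<open>Solving the Garnir relation for the \<open>card S1\<close> equal stabilizer
    terms: the remaining terms change sign and are divided by that number.\<close>
  define q :: "(nat \<Rightarrow> nat) \<Rightarrow> complex" where "q \<sigma> = - of_int (sign \<sigma>) / of_nat (card S1)" for \<sigma>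
  have finS: "finite S" unfolding S_def by (rule finite_permutations) simp
  have S1S: "S1 \<subseteq> S" by (auto simp: S1_def)
  then have finS1: "finite S1" using finS by (rule finite_subset)
  have "id \<in> S1" by (auto simp: S1_def S_def permutes_id)
  then have card1: "card S1 \<noteq> 0" using finS1 by auto
  have aA: "minor d Y (nth (A \<sigma>)) = minor d Y (\<lambda>k. if k < i then a ! k else y (\<sigma> (Suc k)))" for Y \<sigma>
    by (rule minor_cong) (simp add: A_def)
  have bB: "minor d Y (nth (B \<sigma>)) = minor d Y (\<lambda>k. if k \<le> i then y (\<sigma> k) else b ! k)" for Y \<sigma>
    by (rule minor_cong) (simp add: B_def)
  have rel: "minor d Y (nth a) * minor d Y (nth b) =
        (\<Sum>\<sigma>\<in>I. q \<sigma> * (minor d Y (nth (A \<sigma>)) * minor d Y (nth (B \<sigma>))))" for Y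
  proof -
    let ?t = "\<lambda>\<sigma>. of_int (sign \<sigma>) * (minor d Y (nth (A \<sigma>)) * minor d Y (nth (B \<sigma>)))"
    let ?ab = "minor d Y (nth a) * minor d Y (nth b)"
    have "0 = sum ?t S"
      using garnir_relation[OF i(1), of Y "nth a" y "nth b"] by (simp add: aA bB S_def)
    also have "\<dots> = sum ?t I + sum ?t S1"
      unfolding I_def by (rule sum.subset_diff[OF S1S finS])
    also have "sum ?t S1 = (\<Sum>\<sigma>\<in>S1. ?ab)"
    proof (intro sum.cong refl)
      fix \<sigma> assume "\<sigma> \<in> S1"
      then show "?t \<sigma> = ?ab" unfolding aA bB
        by (intro garnir_stabilizer[OF i(1)]) (auto simp: S1_def S_def y_def)
    qed
    also have "\<dots> = of_nat (card S1) * ?ab" by simp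
    finally have "of_nat (card S1) * ?ab = - sum ?t I" by (simp add: eq_neg_iff_add_eq_0 add.commute)
    then have "?ab = - sum ?t I / of_nat (card S1)" using card1 by (simp add: field_simps)
    also have "\<dots> = (\<Sum>\<sigma>\<in>I. q \<sigma> * (minor d Y (nth (A \<sigma>)) * minor d Y (nth (B \<sigma>))))"
      by (simp add: q_def sum_negf[symmetric] sum_divide_distrib sum_distrib_right)
    finally show ?thesis .
  qed
  have mset_AB: "mset a + mset b = mset (A \<sigma>) + mset (B \<sigma>)" if "\<sigma> \<in> I" for \<sigma>
  proof -
    have \<sigma>: "\<sigma> permutes {0..<Suc d}" using that by (simp add: I_def S_def)
    have split: "mset_set {0..<d} = mset_set {0..<k} + mset_set {k..<d}" if "k \<le> d" for k
      using that by (subst mset_set_Union[symmetric]) (auto simp: ivl_disj_un)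
    have full: "image_mset f (mset_set {0..<Suc i}) + image_mset (\<lambda>k. f (Suc k)) (mset_set {i..<d}) =
        image_mset f (mset_set {0..<Suc d})" for f :: "nat \<Rightarrow> nat"
    proof -
      have "mset_set {Suc i..<Suc d} = image_mset Suc (mset_set {i..<d})"
        by (subst image_mset_mset_set) (auto simp: image_Suc_atLeastLessThan)
      moreover have "mset_set {0..<Suc d} = mset_set {0..<Suc i} + mset_set {Suc i..<Suc d}"
        using i by (subst mset_set_Union[symmetric]) (auto simp: ivl_disj_un)
      ultimately show ?thesis by (simp add: image_mset.compositionality o_def)
    qed
    have mA: "mset (A \<sigma>) = image_mset (nth a) (mset_set {0..<i}) +
        image_mset (\<lambda>k. y (\<sigma> (Suc k))) (mset_set {i..<d})" for \<sigma>
      unfolding A_def mset_map mset_upt using i split[of i]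
      by (auto intro!: arg_cong2[of _ _ _ _ "(+)"] image_mset_cong)
    have mB: "mset (B \<sigma>) = image_mset (\<lambda>k. y (\<sigma> k)) (mset_set {0..<Suc i}) +
        image_mset (nth b) (mset_set {Suc i..<d})" for \<sigma>
      unfolding B_def mset_map mset_upt using i split[of "Suc i"]
      by (auto intro!: arg_cong2[of _ _ _ _ "(+)"] image_mset_cong)
    have mAB: "mset (A \<sigma>) + mset (B \<sigma>) = image_mset (nth a) (mset_set {0..<i}) +
        image_mset (nth b) (mset_set {Suc i..<d}) + image_mset (\<lambda>k. y (\<sigma> k)) (mset_set {0..<Suc d})" for \<sigma>
      unfolding mA mB using full[of "\<lambda>k. y (\<sigma> k)"] by (simp add: add_ac)
    have "image_mset \<sigma> (mset_set {0..<Suc d}) = mset_set {0..<Suc d}"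
      using permutes_inj_on[OF \<sigma>] permutes_image[OF \<sigma>] by (subst image_mset_mset_set) auto
    then have "image_mset (\<lambda>k. y (\<sigma> k)) (mset_set {0..<Suc d}) = image_mset (\<lambda>k. y (id k)) (mset_set {0..<Suc d})"
      by (metis (no_types, lifting) image_mset.compositionality image_mset_cong comp_apply id_apply)
    then have "mset (A \<sigma>) + mset (B \<sigma>) = mset (A id) + mset (B id)" unfolding mAB by simp
    moreover have "A id = a" using i len by (intro nth_equalityI) (auto simp: A_def y_def)
    moreover have "B id = b" using i len by (intro nth_equalityI) (auto simp: B_def y_def)
    ultimately show ?thesis by simp
  qed
  have sumB: "sum_list (map f (B \<sigma>)) = sum (\<lambda>k. f (y k)) (\<sigma> ` {0..i}) + (\<Sum>k = Suc i..<d. f (b ! k))"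
    if "\<sigma> \<in> S" for \<sigma> and f :: "nat \<Rightarrow> nat"
  proof -
    have "sum_list (map f (B \<sigma>)) = (\<Sum>k = 0..<d. f (if k \<le> i then y (\<sigma> k) else b ! k))"
      unfolding B_def by (simp add: sum_list_sum_nth)
    also have "\<dots> = (\<Sum>k = 0..<Suc i. f (if k \<le> i then y (\<sigma> k) else b ! k)) +
        (\<Sum>k = Suc i..<d. f (if k \<le> i then y (\<sigma> k) else b ! k))"
      using i by (subst sum.atLeastLessThan_concat) auto
    also have "(\<Sum>k = 0..<Suc i. f (if k \<le> i then y (\<sigma> k) else b ! k)) = (\<Sum>k\<in>{0..i}. f (y (\<sigma> k)))"
      by (intro sum.cong) auto
    also have "\<dots> = sum (\<lambda>k. f (y k)) (\<sigma> ` {0..i})"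
      using that unfolding S_def by (subst sum.reindex) (auto intro: permutes_inj_on)
    finally show ?thesis by simp
  qed
  have sumb: "sum_list (map f b) = sum (\<lambda>k. f (y k)) {0..i} + (\<Sum>k = Suc i..<d. f (b ! k))"
    for f :: "nat \<Rightarrow> nat"
  proof -
    have "B id = b" using i len by (intro nth_equalityI) (auto simp: B_def y_def)
    then show ?thesis using sumB[of id f] \<open>id \<in> S1\<close> S1S by auto
  qed
  have J: "finite (\<sigma> ` {0..i})" "card {0..i} = card (\<sigma> ` {0..i})" "{0..i} \<noteq> \<sigma> ` {0..i}"
    "\<And>k l. k \<in> {0..i} \<Longrightarrow> l \<in> \<sigma> ` {0..i} - {0..i} \<Longrightarrow> y k < y l" if "\<sigma> \<in> I" for \<sigma>
  proof -
    have \<sigma>: "\<sigma> permutes {0..<Suc d}" using that by (simp add: I_def S_def)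
    show "finite (\<sigma> ` {0..i})" by simp
    show "card {0..i} = card (\<sigma> ` {0..i})" by (subst card_image) (auto intro: permutes_inj_on[OF \<sigma>])
    show "{0..i} \<noteq> \<sigma> ` {0..i}" using that by (auto simp: I_def S1_def)
    fix k l assume kl: "k \<in> {0..i}" "l \<in> \<sigma> ` {0..i} - {0..i}"
    then obtain m where m: "m \<le> i" "l = \<sigma> m" by auto
    have "\<sigma> m < Suc d" using permutes_bound[OF \<sigma>, of m] m(1) i(1) by simp
    then show "y k < y l" using kl m by (intro ymono) auto
  qed
  show thesis
  proof (rule that[of I q A B])
    show "finite I" using finS by (simp add: I_def)
    show "minor d Y (nth a) * minor d Y (nth b) =
        (\<Sum>\<sigma>\<in>I. q \<sigma> * (minor d Y (nth (A \<sigma>)) * minor d Y (nth (B \<sigma>))))" for Y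
      by (rule rel)
    show "length (A \<sigma>) = d \<and> length (B \<sigma>) = d" for \<sigma> by (simp add: A_def B_def)
    fix \<sigma> assume \<sigma>: "\<sigma> \<in> I"
    then have \<sigma>S: "\<sigma> \<in> S" by (simp add: I_def)
    show mAB: "mset a + mset b = mset (A \<sigma>) + mset (B \<sigma>)" by (rule mset_AB[OF \<sigma>])
    show "sum_list b < sum_list (B \<sigma>)"
      using sum_exchange_less[of "{0..i}", OF finite_atLeastAtMost J[OF \<sigma>]] sumB[OF \<sigma>S, of "\<lambda>x. x"] sumb[of "\<lambda>x. x"] by simp
    show "length (filter (\<lambda>v. v < n) a) \<le> length (filter (\<lambda>v. v < n) (A \<sigma>))" for n
    proof -
      \<comment> \<open>The exchange argument for the indicator of \<open>n \<le> v\<close> says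
        that the right column gets at least as many large entries as before; counting within the
        pair, the left column gets at least as many small ones.\<close>
      have "sum_list (map (\<lambda>v. of_bool (n \<le> v)) b) \<le> (sum_list (map (\<lambda>v. of_bool (n \<le> v)) (B \<sigma>)) :: nat)"
        unfolding sumB[OF \<sigma>S] sumb
        by (intro add_mono sum_exchange_le J(1,2)[OF \<sigma>]) (use J(4)[OF \<sigma>] in \<open>force+\<close>)
      moreover have "sum_list (map (\<lambda>v. of_bool (n \<le> v)) c) + length (filter (\<lambda>v. v < n) c) = length c"
        for c :: "nat list"
        by (induction c) auto
      from this[of b] this[of "B \<sigma>"]
      have "sum_list (map (\<lambda>v. of_bool (n \<le> v)) b) + length (filter (\<lambda>v. v < n) b) = d"
        "sum_list (map (\<lambda>v. of_bool (n \<le> v)) (B \<sigma>)) + length (filter (\<lambda>v. v < n) (B \<sigma>)) = d"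
        using len by (simp_all add: B_def)
      moreover have "length (filter (\<lambda>v. v < n) (a @ b)) = length (filter (\<lambda>v. v < n) (A \<sigma> @ B \<sigma>))"
        using mAB by (intro length_filter_mset) simp
      ultimately show ?thesis by simp
    qed
  qed
qed

text \<open>A tableau is the list of its columns, all of full length \<open>d\<close>, so its shape
  is always a rectangle.\<close>

definition tableau :: "nat \<Rightarrow> nat list list \<Rightarrow> bool" where
  "tableau d T \<longleftrightarrow> (\<forall>c \<in> set T. length c = d)"

definition standard :: "nat \<Rightarrow> nat list list \<Rightarrow> bool" where
  "standard d T \<longleftrightarrow> tableau d T \<and> (\<forall>c \<in> set T. sorted_wrt (<) c) \<and> sorted_wrt (list_all2 (\<le>)) T"

lemma standard_rows_sorted:
  assumes "standard d T" "k < d"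
  shows "sorted (map (\<lambda>c. c ! k) T)"
proof -
  have "sorted_wrt (\<lambda>c c'. c ! k \<le> c' ! k) T"
  proof (rule sorted_wrt_mono_rel[of T "list_all2 (\<le>)"])
    show "sorted_wrt (list_all2 (\<le>)) T" using assms(1) by (simp add: standard_def)
    fix x y assume "x \<in> set T" "list_all2 (\<le>) x y"
    then show "x ! k \<le> y ! k" using assms by (auto simp: standard_def tableau_def intro: list_all2_nthD)
  qed
  then show ?thesis by (simp add: sorted_wrt_map)
qed

definition standard_tableaux :: "nat \<Rightarrow> nat \<Rightarrow> nat list list set" where
  "standard_tableaux d m = {T. standard d T \<and> length T = m \<and> set (concat T) \<subseteq> {..<2 * d}}"

lemma finite_standard_tableaux: "finite (standard_tableaux d m)"
proof (rule finite_subset)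
  show "standard_tableaux d m \<subseteq> {T. set T \<subseteq> {c. set c \<subseteq> {..<2 * d} \<and> length c = d} \<and> length T = m}"
    by (auto simp: standard_tableaux_def standard_def tableau_def)
  show "finite {T. set T \<subseteq> {c. set c \<subseteq> {..<2 * d} \<and> length c = d} \<and> length T = m}"
    by (intro finite_lists_length_eq) simp
qed

lemma column_entry_bound:
  assumes "tableau d (c # T)" "set (concat (c # T)) \<subseteq> {..<2 * d}" "k < d"
  shows "c ! k < 2 * d"
proof -
  have "c ! k \<in> set c" using assms by (simp add: tableau_def)
  then show ?thesis using assms(2) by auto
qed

definition minor_prod :: "nat \<Rightarrow> (nat \<Rightarrow> nat \<Rightarrow> complex) \<Rightarrow> nat list list \<Rightarrow> complex" where
  "minor_prod d Y T = prod_list (map (\<lambda>c. minor d Y (nth c)) T)"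

lemma minor_prod_simps [simp]:
  "minor_prod d Y [] = 1"
  "minor_prod d Y (c # T) = minor d Y (nth c) * minor_prod d Y T"
  "minor_prod d Y (S @ T) = minor_prod d Y S * minor_prod d Y T"
  by (simp_all add: minor_prod_def)

lemma minor_prod_map_sort:
  "tableau d T \<Longrightarrow> \<exists>e. \<forall>Y. minor_prod d Y T = e * minor_prod d Y (map sort T)"
proof (induction T)
  case (Cons c T)
  then obtain e where e: "\<forall>Y. minor_prod d Y T = e * minor_prod d Y (map sort T)"
    by (auto simp: tableau_def)
  obtain e' where "\<forall>Y. minor d Y (nth c) = e' * minor d Y (nth (sort c))"
    using minor_sort[of c d] Cons.prems by (auto simp: tableau_def)
  with e have "\<forall>Y. minor_prod d Y (c # T) = (e' * e) * minor_prod d Y (map sort (c # T))"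
    by simp
  then show ?case by blast
qed (auto intro: exI[of _ 1])

lemma minor_prod_repeated:
  assumes "tableau d T" "c \<in> set T" "\<not> distinct c"
  shows "minor_prod d Y T = 0"
proof -
  obtain k l where "k < length c" "l < length c" "k \<noteq> l" "c ! k = c ! l"
    using assms(3) by (auto simp: distinct_conv_nth)
  then have "minor d Y (nth c) = 0"
    using assms by (intro minor_repeated[of k _ l]) (auto simp: tableau_def)
  then show ?thesis using assms(2) unfolding minor_prod_def
    by (auto simp: prod_list_zero_iff image_iff)
qed

text \<open>Exchanging a violating pair of neighbouring columns moves larger entries to the right, so
  \<^const>\<open>pos_weight\<close> grows, while the number of small entries in every initial segment of
  columns does not decrease.\<close>
lemma straightening:
  fixes h :: "complex mat \<Rightarrow> complex" and Y :: "complex mat \<Rightarrow> nat \<Rightarrow> nat \<Rightarrow> complex"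
  assumes "tableau d T"
  shows "(\<lambda>U. h U * minor_prod d (Y U) T) \<in> fun_vs.span ((\<lambda>T' U. h U * minor_prod d (Y U) T') `
     {T'. standard d T' \<and> length T' = length T \<and> mset (concat T') = mset (concat T) \<and>
          low n (take s T) \<le> low n (take s T')})"
  using assms
\<comment> \<open>Length and entry sum are kept by every exchange and bound
  \<open>pos_weight\<close> through \<open>pos_weight_bound\<close>, so the gap is a decreasing
  measure.\<close>
proof (induction "length T * sum_list (concat T) - pos_weight T" arbitrary: T rule: less_induct)
  case less
  define G where "G T = (\<lambda>U. h U * minor_prod d (Y U) T)" for T
  define W where "W T = {T'. standard d T' \<and> length T' = length T \<and> mset (concat T') = mset (concat T) \<and>
          low n (take s T) \<le> low n (take s T')}" for T
  have IH: "G T' \<in> fun_vs.span (G ` W T)"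
    if "tableau d T'" "length T' = length T" "mset (concat T') = mset (concat T)"
      "pos_weight T < pos_weight T'" "low n (take s T) \<le> low n (take s T')" for T'
  proof -
    have sm: "sum_list (concat T') = sum_list (concat T)" by (rule sum_list_mset) (rule that(3))
    have "length T' * sum_list (concat T') - pos_weight T' < length T * sum_list (concat T) - pos_weight T"
      using pos_weight_bound[of T'] that(2,4) sm by simp
    then have "G T' \<in> fun_vs.span (G ` W T')"
      using less.hyps[of T'] that(1) unfolding G_def W_def by blast
    moreover have "W T' \<subseteq> W T" using that by (auto simp: W_def)
    ultimately show ?thesis by (meson fun_vs.span_mono image_mono subsetD)
  qed
  show ?case
  proof (cases "\<forall>c \<in> set T. distinct c")
    case False
    then have "(\<lambda>U. h U * minor_prod d (Y U) T) = 0"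
      using minor_prod_repeated[OF less.prems] by (auto simp: fun_eq_iff)
    then show ?thesis by (metis fun_vs.span_zero)
  next
    case True
    \<comment> \<open>Sorting the columns costs only a constant and leaves the measure and the
      counts of small entries unchanged; distinctness makes the sorted columns strictly
      increasing.\<close>
    define T0 where "T0 = map sort T"
    have tab: "tableau d T0" using less.prems by (auto simp: T0_def tableau_def)
    have inc: "\<forall>c \<in> set T0. sorted_wrt (<) c"
      using True by (auto simp: T0_def strict_sorted_iff)
    have T0: "mset (concat T0) = mset (concat T)" "pos_weight T0 = pos_weight T" "length T0 = length T"
      "low n (take s T0) = low n (take s T)"
      unfolding T0_def by (simp_all add: mset_concat_map_sort pos_weight_map_sort low_map_sort take_map)
    have "G T0 \<in> fun_vs.span (G ` W T)"
    proof (cases "sorted_wrt (list_all2 (\<le>)) T0")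
      case True
      then have "T0 \<in> W T" using tab inc T0 by (simp add: W_def standard_def)
      then show ?thesis by (intro fun_vs.span_base imageI)
    next
      case False
      have "transp (list_all2 ((\<le>) :: nat \<Rightarrow> nat \<Rightarrow> bool))"
        unfolding transp_def list_all2_conv_all_nth by (metis le_trans)
      then obtain xs a b ys where split: "T0 = xs @ a # b # ys" and bad: "\<not> list_all2 (\<le>) a b"
        using False by (rule not_sorted_wrt_adjacent)
      have ab: "length a = d" "length b = d" "sorted_wrt (<) a" "sorted_wrt (<) b"
        using tab inc by (auto simp: split tableau_def)
      obtain I :: "(nat \<Rightarrow> nat) set" and q A B where I: "finite I"
        "\<And>Y. minor d Y (nth a) * minor d Y (nth b) =
            (\<Sum>\<sigma>\<in>I. q \<sigma> * (minor d Y (nth (A \<sigma>)) * minor d Y (nth (B \<sigma>))))"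
        "\<And>\<sigma>. \<sigma> \<in> I \<Longrightarrow> length (A \<sigma>) = d \<and> length (B \<sigma>) = d"
        "\<And>\<sigma>. \<sigma> \<in> I \<Longrightarrow> mset a + mset b = mset (A \<sigma>) + mset (B \<sigma>)"
        "\<And>\<sigma>. \<sigma> \<in> I \<Longrightarrow> sum_list b < sum_list (B \<sigma>)"
        "\<And>\<sigma> n. \<sigma> \<in> I \<Longrightarrow> length (filter (\<lambda>v. v < n) a) \<le> length (filter (\<lambda>v. v < n) (A \<sigma>))"
        using straighten_pair[OF ab bad] by blast
      have "G T0 = (\<Sum>\<sigma>\<in>I. fun_scale (q \<sigma>) (G (xs @ A \<sigma> # B \<sigma> # ys)))"
      proof
        fix U
        have "G T0 U = h U * minor_prod d (Y U) xs * minor_prod d (Y U) ys *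
            (minor d (Y U) (nth a) * minor d (Y U) (nth b))"
          by (simp add: G_def split)
        also have "\<dots> = (\<Sum>\<sigma>\<in>I. q \<sigma> * G (xs @ A \<sigma> # B \<sigma> # ys) U)"
          unfolding I(2) sum_distrib_left by (intro sum.cong refl) (simp add: G_def)
        also have "\<dots> = (\<Sum>\<sigma>\<in>I. fun_scale (q \<sigma>) (G (xs @ A \<sigma> # B \<sigma> # ys))) U"
          by (simp add: fun_scale_def sum_fun_apply)
        finally show "G T0 U = (\<Sum>\<sigma>\<in>I. fun_scale (q \<sigma>) (G (xs @ A \<sigma> # B \<sigma> # ys))) U" .
      qed
      moreover have "G (xs @ A \<sigma> # B \<sigma> # ys) \<in> fun_vs.span (G ` W T)" if \<sigma>: "\<sigma> \<in> I" for \<sigma>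
      proof (rule IH)
        show "tableau d (xs @ A \<sigma> # B \<sigma> # ys)" using tab I(3)[OF \<sigma>] by (auto simp: split tableau_def)
        show "length (xs @ A \<sigma> # B \<sigma> # ys) = length T" using T0(3) by (simp add: split)
        show "mset (concat (xs @ A \<sigma> # B \<sigma> # ys)) = mset (concat T)"
          unfolding T0(1)[symmetric] using I(4)[OF \<sigma>] by (simp add: split add_ac)
        have "sum_list (a @ b) = sum_list (A \<sigma> @ B \<sigma>)"
          by (rule sum_list_mset) (use I(4)[OF \<sigma>] in simp)
        then show "pos_weight T < pos_weight (xs @ A \<sigma> # B \<sigma> # ys)"
          unfolding T0(2)[symmetric] split
          by (intro pos_weight_adjacent_less I(5)[OF \<sigma>]) simp
        show "low n (take s T) \<le> low n (take s (xs @ A \<sigma> # B \<sigma> # ys))"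
          unfolding T0(4)[symmetric] split
          by (rule low_take_adjacent[OF I(4)[OF \<sigma>] I(6)[OF \<sigma>]])
      qed
      ultimately show ?thesis by (auto intro!: fun_vs.span_sum fun_vs.span_scale)
    qed
    moreover obtain e where "\<forall>Y. minor_prod d Y T = e * minor_prod d Y T0"
      using minor_prod_map_sort[OF less.prems] by (auto simp: T0_def)
    then have "G T = fun_scale e (G T0)" by (auto simp: G_def fun_scale_def fun_eq_iff)
    ultimately show ?thesis unfolding G_def W_def by (metis (no_types, lifting) fun_vs.span_scale)
  qed
qed

section \<open>The function space and products of minors\<close>

lemma mat_adjoint_index:
  assumes "A \<in> carrier_mat d d" "i < d" "j < d"
  shows "mat_adjoint A $$ (i, j) = cnj (A $$ (j, i))"
  using assms by (simp add: mat_adjoint_def mat_of_rows_index)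

lemma mat_adjoint_carrier: "A \<in> carrier_mat d d \<Longrightarrow> mat_adjoint A \<in> carrier_mat d d"
  by (auto simp: mat_adjoint_def)

lemma prod_list_of_exponents:
  assumes "finite S"
  shows "\<exists>xs. set xs \<subseteq> S \<and> length xs = sum g S \<and>
    (\<forall>f :: 'a \<Rightarrow> complex. prod_list (map f xs) = (\<Prod>x\<in>S. f x ^ g x))"
  using assms
proof (induction S)
  case (insert x S)
  then obtain xs where "set xs \<subseteq> S" "length xs = sum g S"
    "\<forall>f :: 'a \<Rightarrow> complex. prod_list (map f xs) = (\<Prod>x\<in>S. f x ^ g x)" by blast
  then have "set (replicate (g x) x @ xs) \<subseteq> insert x S \<and> length (replicate (g x) x @ xs) = sum g (insert x S) \<and>
    (\<forall>f :: 'a \<Rightarrow> complex. prod_list (map f (replicate (g x) x @ xs)) = (\<Prod>x\<in>insert x S. f x ^ g x))"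
    using insert.hyps by (auto simp: prod_list_replicate)
  then show ?case by blast
qed simp

definition exponents :: "entry_var list \<Rightarrow> monomial" where
  "exponents vs = sum_list (map (\<lambda>v. Poly_Mapping.single v 1) vs)"

lemma lookup_exponents_Cons:
  "Poly_Mapping.lookup (exponents (v # vs)) u = of_bool (u = v) + Poly_Mapping.lookup (exponents vs) u"
  by (simp add: exponents_def lookup_add lookup_single when_def)

lemma lookup_exponents_Nil: "Poly_Mapping.lookup (exponents []) u = 0"
  by (simp add: exponents_def)

lemma keys_exponents: "Poly_Mapping.keys (exponents vs) \<subseteq> set vs"
proof (induction vs)
  case (Cons v vs)
  then show ?case by (auto simp: in_keys_iff lookup_exponents_Cons subset_iff)
qed (simp add: exponents_def)

lemma sum_lookup_exponents:
  assumes "finite V"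
  shows "(\<Sum>u\<in>V. Poly_Mapping.lookup (exponents vs) u) = length (filter (\<lambda>v. v \<in> V) vs)"
proof (induction vs)
  case (Cons v vs)
  have "(\<Sum>u\<in>V. (of_bool (u = v) :: nat)) = of_bool (v \<in> V)"
    using assms by (simp add: of_bool_def sum.delta')
  then show ?case using Cons by (simp add: lookup_exponents_Cons sum.distrib)
qed (simp add: lookup_exponents_Nil)

lemma prod_lookup_exponents:
  fixes f :: "entry_var \<Rightarrow> complex"
  assumes "finite K" "set vs \<subseteq> K"
  shows "(\<Prod>u\<in>K. f u ^ Poly_Mapping.lookup (exponents vs) u) = prod_list (map f vs)"
  using assms(2)
proof (induction vs)
  case (Cons v vs)
  have "(\<Prod>u\<in>K. f u ^ of_bool (u = v)) = (\<Prod>u\<in>K. if u = v then f v else 1)"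
    by (intro prod.cong) auto
  also have "\<dots> = f v"
    using assms(1) Cons.prems by (simp add: prod.delta')
  finally show ?case using Cons by (simp add: lookup_exponents_Cons power_add prod.distrib)
qed (simp add: lookup_exponents_Nil)

definition on_unitary :: "nat \<Rightarrow> (complex mat \<Rightarrow> complex) \<Rightarrow> complex mat \<Rightarrow> complex" where
  "on_unitary d f = (\<lambda>U. if U \<in> unitary_group d then f U else 0)"

definition entry_prod :: "complex mat \<Rightarrow> (nat \<times> nat) list \<Rightarrow> complex" where
  "entry_prod A es = prod_list (map (\<lambda>e. A $$ e) es)"

definition entry_monomials :: "nat \<Rightarrow> nat \<Rightarrow> nat \<Rightarrow> (complex mat \<Rightarrow> complex) set" where
  "entry_monomials d r s = {on_unitary d (\<lambda>U. entry_prod U es * entry_prod (mat_adjoint U) as) | es as.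
     set es \<subseteq> {..<d} \<times> {..<d} \<and> length es = r \<and> set as \<subseteq> {..<d} \<times> {..<d} \<and> length as = s}"

lemma entry_vars_image: "entry_vars d = case_prod Entry ` ({..<d} \<times> {..<d})"
  by (auto simp: entry_vars_def)

lemma adj_entry_vars_image: "adj_entry_vars d = case_prod Adj_Entry ` ({..<d} \<times> {..<d})"
  by (auto simp: adj_entry_vars_def)

text \<open>An exponent vector unrolls to a list of index pairs with repetitions, and such lists
  pack back into one monomial. Formal polynomials thereby give way to products of entries, which
  multiply by concatenation.\<close>

lemma Hom_U_eq_span: "Hom_U d r s = fun_vs.span (entry_monomials d r s)"
proof
  have fin: "finite (entry_vars d)" "finite (adj_entry_vars d)"
    by (auto simp: entry_vars_image adj_entry_vars_image)
  have disj: "entry_vars d \<inter> adj_entry_vars d = {}"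
    by (auto simp: entry_vars_def adj_entry_vars_def)
  have inj: "inj_on (case_prod Entry) A" "inj_on (case_prod Adj_Entry) A" for A
    by (auto simp: inj_on_def)
  have val: "var_val U (case_prod Entry e) = U $$ e" "var_val U (case_prod Adj_Entry e) = mat_adjoint U $$ e"
    for U e by (cases e; simp)+
  show "Hom_U d r s \<subseteq> fun_vs.span (entry_monomials d r s)"
  proof
    fix f assume "f \<in> Hom_U d r s"
    then obtain p where p: "bihomogeneous d r s p" "f = on_unitary d (eval_poly_at p)"
      by (auto simp: Hom_U_def on_unitary_def)
    define g where "g m = on_unitary d (\<lambda>U. \<Prod>v \<in> Poly_Mapping.keys m. var_val U v ^ Poly_Mapping.lookup m v)" for m
    have "f = (\<Sum>m\<in>Poly_Mapping.keys p. fun_scale (Poly_Mapping.lookup p m) (g m))"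
    proof
      fix U
      show "f U = (\<Sum>m\<in>Poly_Mapping.keys p. fun_scale (Poly_Mapping.lookup p m) (g m)) U"
        by (simp add: p(2) on_unitary_def eval_poly_at_def g_def sum_fun_apply fun_scale_def)
    qed
    moreover have "g m \<in> entry_monomials d r s" if m: "m \<in> Poly_Mapping.keys p" for m
    proof -
      let ?L = "Poly_Mapping.lookup m"
      have k: "Poly_Mapping.keys m \<subseteq> entry_vars d \<union> adj_entry_vars d" "sum ?L (entry_vars d) = r"
        "sum ?L (adj_entry_vars d) = s" using p(1) m unfolding bihomogeneous_def by blast+
      obtain es where es: "set es \<subseteq> {..<d} \<times> {..<d}" "length es = sum (?L \<circ> case_prod Entry) ({..<d} \<times> {..<d})"
        "\<And>f :: nat \<times> nat \<Rightarrow> complex. prod_list (map f es) = (\<Prod>x\<in>{..<d} \<times> {..<d}. f x ^ (?L \<circ> case_prod Entry) x)"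
        using prod_list_of_exponents[of "{..<d} \<times> {..<d}"] by blast
      obtain as where as: "set as \<subseteq> {..<d} \<times> {..<d}" "length as = sum (?L \<circ> case_prod Adj_Entry) ({..<d} \<times> {..<d})"
        "\<And>f :: nat \<times> nat \<Rightarrow> complex. prod_list (map f as) = (\<Prod>x\<in>{..<d} \<times> {..<d}. f x ^ (?L \<circ> case_prod Adj_Entry) x)"
        using prod_list_of_exponents[of "{..<d} \<times> {..<d}"] by blast
      have len: "length es = r" "length as = s"
        using k(2,3) unfolding es(2) as(2) entry_vars_image adj_entry_vars_image
        by (simp_all add: sum.reindex[OF inj(1)] sum.reindex[OF inj(2)])
      have "(\<Prod>v \<in> Poly_Mapping.keys m. var_val U v ^ ?L v) = entry_prod U es * entry_prod (mat_adjoint U) as" for U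
      proof -
        have "(\<Prod>v \<in> Poly_Mapping.keys m. var_val U v ^ ?L v) = (\<Prod>v \<in> entry_vars d \<union> adj_entry_vars d. var_val U v ^ ?L v)"
          using k(1) fin by (intro prod.mono_neutral_left) (auto simp: in_keys_iff)
        also have "\<dots> = (\<Prod>v \<in> entry_vars d. var_val U v ^ ?L v) * (\<Prod>v \<in> adj_entry_vars d. var_val U v ^ ?L v)"
          using fin disj by (intro prod.union_disjoint)
        also have "(\<Prod>v \<in> entry_vars d. var_val U v ^ ?L v) = entry_prod U es"
          unfolding entry_vars_image prod.reindex[OF inj(1)] entry_prod_def es(3) by (simp add: val o_def)
        also have "(\<Prod>v \<in> adj_entry_vars d. var_val U v ^ ?L v) = entry_prod (mat_adjoint U) as"
          unfolding adj_entry_vars_image prod.reindex[OF inj(2)] entry_prod_def as(3) by (simp add: val o_def)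
        finally show ?thesis .
      qed
      then have "g m = on_unitary d (\<lambda>U. entry_prod U es * entry_prod (mat_adjoint U) as)"
        by (simp add: g_def)
      then show ?thesis unfolding entry_monomials_def using es(1) as(1) len by blast
    qed
    ultimately show "f \<in> fun_vs.span (entry_monomials d r s)"
      by (simp only:) (rule fun_vs.span_sum, rule fun_vs.span_scale, rule fun_vs.span_base)
  qed
  show "fun_vs.span (entry_monomials d r s) \<subseteq> Hom_U d r s"
  proof (rule fun_vs.span_minimal[OF _ subspace_Hom_U], rule subsetI)
    fix f assume "f \<in> entry_monomials d r s"
    then obtain es as where es: "set es \<subseteq> {..<d} \<times> {..<d}" "length es = r"
      and as: "set as \<subseteq> {..<d} \<times> {..<d}" "length as = s"
      and f: "f = on_unitary d (\<lambda>U. entry_prod U es * entry_prod (mat_adjoint U) as)"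
      unfolding entry_monomials_def by blast
    define vs where "vs = map (case_prod Entry) es @ map (case_prod Adj_Entry) as"
    define m where "m = exponents vs"
    have vs: "set vs \<subseteq> entry_vars d \<union> adj_entry_vars d"
      using es as by (auto simp: vs_def entry_vars_image adj_entry_vars_image)
    have "filter (\<lambda>v. v \<in> entry_vars d) (map (case_prod Entry) es) = map (case_prod Entry) es"
      "filter (\<lambda>v. v \<in> adj_entry_vars d) (map (case_prod Adj_Entry) as) = map (case_prod Adj_Entry) as"
      by (rule filter_True, use es as in \<open>force simp: entry_vars_def adj_entry_vars_def\<close>)+
    moreover have "filter (\<lambda>v. v \<in> entry_vars d) (map (case_prod Adj_Entry) as) = []"
      "filter (\<lambda>v. v \<in> adj_entry_vars d) (map (case_prod Entry) es) = []"
      by (auto simp: filter_empty_conv entry_vars_def adj_entry_vars_def)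
    ultimately have "filter (\<lambda>v. v \<in> entry_vars d) vs = map (case_prod Entry) es"
      "filter (\<lambda>v. v \<in> adj_entry_vars d) vs = map (case_prod Adj_Entry) as"
      by (simp_all add: vs_def)
    then have "bihomogeneous d r s (Poly_Mapping.single m 1)"
      using keys_exponents[of vs] vs es(2) as(2) unfolding bihomogeneous_def m_def
      by (auto simp: sum_lookup_exponents fin)
    moreover have "eval_poly_at (Poly_Mapping.single m 1) U = entry_prod U es * entry_prod (mat_adjoint U) as" for U
    proof -
      have "eval_poly_at (Poly_Mapping.single m 1) U = (\<Prod>v \<in> Poly_Mapping.keys m. var_val U v ^ Poly_Mapping.lookup m v)"
        by (simp add: eval_poly_at_def)
      also have "\<dots> = (\<Prod>v \<in> set vs. var_val U v ^ Poly_Mapping.lookup m v)"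
        unfolding m_def by (intro prod.mono_neutral_left keys_exponents) (auto simp: in_keys_iff)
      also have "\<dots> = prod_list (map (var_val U) vs)"
        unfolding m_def by (rule prod_lookup_exponents) auto
      also have "\<dots> = entry_prod U es * entry_prod (mat_adjoint U) as"
        by (simp add: vs_def entry_prod_def o_def val)
      finally show ?thesis .
    qed
    ultimately show "f \<in> Hom_U d r s"
      unfolding Hom_U_def f on_unitary_def by (intro CollectI exI[of _ "Poly_Mapping.single m 1"]) auto
  qed
qed

text \<open>For monomials the index lists are concatenated; induction over each span in turn extends
  this by bilinearity.\<close>

lemma Hom_U_mult:
  assumes "on_unitary d f \<in> Hom_U d a b" "on_unitary d g \<in> Hom_U d a' b'"
  shows "on_unitary d (\<lambda>U. f U * g U) \<in> Hom_U d (a + a') (b + b')"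
proof -
  let ?S = "Hom_U d (a + a') (b + b')"
  note sub = subspace_Hom_U[of d "a + a'" "b + b'"]
  have mono: "(\<lambda>U. F U * G U) \<in> ?S"
    if FG: "F \<in> entry_monomials d a b" "G \<in> entry_monomials d a' b'" for F G
  proof -
    obtain es as where F: "set es \<subseteq> {..<d} \<times> {..<d}" "length es = a" "set as \<subseteq> {..<d} \<times> {..<d}" "length as = b"
      "F = on_unitary d (\<lambda>U. entry_prod U es * entry_prod (mat_adjoint U) as)"
      using FG(1) unfolding entry_monomials_def by blast
    obtain es' as' where G: "set es' \<subseteq> {..<d} \<times> {..<d}" "length es' = a'" "set as' \<subseteq> {..<d} \<times> {..<d}" "length as' = b'"
      "G = on_unitary d (\<lambda>U. entry_prod U es' * entry_prod (mat_adjoint U) as')"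
      using FG(2) unfolding entry_monomials_def by blast
    have "(\<lambda>U. F U * G U) = on_unitary d (\<lambda>U. entry_prod U (es @ es') * entry_prod (mat_adjoint U) (as @ as'))"
      by (auto simp: F(5) G(5) on_unitary_def entry_prod_def fun_eq_iff)
    moreover have "\<dots> \<in> entry_monomials d (a + a') (b + b')"
      unfolding entry_monomials_def using F(1-4) G(1-4)
      by (intro CollectI exI[of _ "es @ es'"] exI[of _ "as @ as'"]) auto
    ultimately show ?thesis unfolding Hom_U_eq_span by (metis fun_vs.span_base)
  qed
  have "(\<lambda>U. F U * G U) \<in> ?S" if F: "F \<in> Hom_U d a b" and G: "G \<in> Hom_U d a' b'" for F G
  proof -
    have step: "(\<lambda>U. F U * G U) \<in> ?S" if "F \<in> entry_monomials d a b" for F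
      using G unfolding Hom_U_eq_span[of d a' b']
    proof (induction rule: fun_vs.span_induct_alt)
      case base
      have "(\<lambda>U. F U * 0 U) = 0" by auto
      then show ?case using fun_vs.subspace_0[OF sub] by simp
    next
      case (step c x y)
      have "(\<lambda>U. F U * (fun_scale c x + y) U) = fun_scale c (\<lambda>U. F U * x U) + (\<lambda>U. F U * y U)"
        by (auto simp: fun_scale_def algebra_simps)
      then show ?case using step mono[OF that step(1)] fun_vs.subspace_add[OF sub] fun_vs.subspace_scale[OF sub]
        by simp
    qed
    show ?thesis using F unfolding Hom_U_eq_span[of d a b]
    proof (induction rule: fun_vs.span_induct_alt)
      case base
      have "(\<lambda>U. 0 U * G U) = 0" by auto
      then show ?case using fun_vs.subspace_0[OF sub] by simp
    next
      case (step c x y)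
      have "(\<lambda>U. (fun_scale c x + y) U * G U) = fun_scale c (\<lambda>U. x U * G U) + (\<lambda>U. y U * G U)"
        by (auto simp: fun_scale_def algebra_simps)
      then show ?case using step \<open>\<And>F. F \<in> entry_monomials d a b \<Longrightarrow> _\<close> fun_vs.subspace_add[OF sub] fun_vs.subspace_scale[OF sub]
        by simp
    qed
  qed
  from this[OF assms] show ?thesis by (simp add: on_unitary_def if_distrib cong: if_cong)
qed

lemma on_unitary_one: "on_unitary d (\<lambda>_. 1) \<in> Hom_U d 0 0"
proof -
  have "on_unitary d (\<lambda>_. 1) \<in> entry_monomials d 0 0"
    unfolding entry_monomials_def by (auto simp: entry_prod_def)
  then show ?thesis unfolding Hom_U_eq_span by (rule fun_vs.span_base)
qed

lemma on_unitary_scale: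
  "on_unitary d f \<in> Hom_U d a b \<Longrightarrow> on_unitary d (\<lambda>U. c * f U) \<in> Hom_U d a b"
  using fun_vs.subspace_scale[OF subspace_Hom_U, of "on_unitary d f" d a b c]
  by (simp add: on_unitary_def fun_scale_def if_distrib cong: if_cong)

lemma on_unitary_sum:
  assumes "\<And>x. x \<in> S \<Longrightarrow> on_unitary d (f x) \<in> Hom_U d a b"
  shows "on_unitary d (\<lambda>U. \<Sum>x\<in>S. f x U) \<in> Hom_U d a b"
proof -
  have "on_unitary d (\<lambda>U. \<Sum>x\<in>S. f x U) = (\<Sum>x\<in>S. on_unitary d (f x))"
    by (auto simp: on_unitary_def fun_eq_iff sum_fun_apply)
  then show ?thesis using fun_vs.subspace_sum[OF subspace_Hom_U] assms by metis
qed

lemma on_unitary_prod: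
  assumes "finite S" "\<And>x. x \<in> S \<Longrightarrow> on_unitary d (f x) \<in> Hom_U d (a x) (b x)"
  shows "on_unitary d (\<lambda>U. \<Prod>x\<in>S. f x U) \<in> Hom_U d (sum a S) (sum b S)"
  using assms
proof (induction S)
  case empty
  then show ?case by (simp add: on_unitary_one)
next
  case (insert x S)
  then show ?case using Hom_U_mult[of d "f x" "a x" "b x"] by simp
qed

lemma on_unitary_entry:
  assumes "i < d" "j < d"
  shows "on_unitary d (\<lambda>U. U $$ (i, j)) \<in> Hom_U d 1 0"
    and "on_unitary d (\<lambda>U. mat_adjoint U $$ (i, j)) \<in> Hom_U d 0 1"
proof -
  have "on_unitary d (\<lambda>U. U $$ (i, j)) \<in> entry_monomials d 1 0"
    unfolding entry_monomials_def using assms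
    by (intro CollectI exI[of _ "[(i, j)]"] exI[of _ "[]"]) (auto simp: entry_prod_def)
  then show "on_unitary d (\<lambda>U. U $$ (i, j)) \<in> Hom_U d 1 0"
    unfolding Hom_U_eq_span by (rule fun_vs.span_base)
  have "on_unitary d (\<lambda>U. mat_adjoint U $$ (i, j)) \<in> entry_monomials d 0 1"
    unfolding entry_monomials_def using assms
    by (intro CollectI exI[of _ "[(i, j)]"] exI[of _ "[]"]) (auto simp: entry_prod_def)
  then show "on_unitary d (\<lambda>U. mat_adjoint U $$ (i, j)) \<in> Hom_U d 0 1"
    unfolding Hom_U_eq_span by (rule fun_vs.span_base)
qed

section \<open>Unitarity relations and the maximal minors of [U | 1] and [1 | U^*]\<close>

lemma unitary_sum:
  assumes "U \<in> unitary_group d" "i < d" "j < d"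
  shows "(\<Sum>k = 0..<d. U $$ (i, k) * mat_adjoint U $$ (k, j)) = of_bool (i = j)"
proof -
  have c: "U \<in> carrier_mat d d" "mat_adjoint U \<in> carrier_mat d d"
    using assms mat_adjoint_carrier by (auto simp: unitary_group_def)
  have "(U * mat_adjoint U) $$ (i, j) = 1\<^sub>m d $$ (i, j)" using assms by (simp add: unitary_group_def)
  then show ?thesis using c assms(2,3) by (simp add: scalar_prod_def)
qed

text \<open>Multiplying by \<open>1 = (U U\<^sup>*)\<^bsub>00\<^esub>\<close> raises both degrees.\<close>
lemma Hom_U_raise:
  assumes "d > 0" "on_unitary d f \<in> Hom_U d a b"
  shows "on_unitary d f \<in> Hom_U d (a + n) (b + n)"
proof (induction n)
  case (Suc n)
  have "on_unitary d (\<lambda>U. \<Sum>k = 0..<d. U $$ (0, k) * mat_adjoint U $$ (k, 0)) \<in> Hom_U d 1 1"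
    using assms(1) Hom_U_mult[OF on_unitary_entry(1) on_unitary_entry(2)]
    by (intro on_unitary_sum) auto
  from Hom_U_mult[OF Suc this] show ?case
    using assms(1) by (simp add: on_unitary_def unitary_sum cong: if_cong)
qed (use assms in simp)

text \<open>The \<open>d \<times> 2d\<close> matrices \<open>[U | 1]\<close> and \<open>[1 | U\<^sup>*]\<close>.\<close>
definition stack_id :: "nat \<Rightarrow> complex mat \<Rightarrow> nat \<Rightarrow> nat \<Rightarrow> complex" where
  "stack_id d U i k = (if k < d then U $$ (i, k) else of_bool (k = d + i))"

definition id_stack :: "nat \<Rightarrow> complex mat \<Rightarrow> nat \<Rightarrow> nat \<Rightarrow> complex" where
  "id_stack d U i k = (if k < d then of_bool (k = i) else mat_adjoint U $$ (i, k - d))"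

lemma length_filter_eq_sum_nth: "length (filter P xs) = (\<Sum>k = 0..<length xs. of_bool (P (xs ! k)))"
proof -
  have "length (filter P xs) = sum_list (map (\<lambda>x. of_bool (P x)) xs)" by (induction xs) auto
  then show ?thesis by (simp add: sum_list_sum_nth)
qed

text \<open>In a Leibniz term each index below \<open>d\<close> contributes one entry of U, and each
  other index a constant 0 or 1 from the identity block.\<close>

lemma on_unitary_minor_stack_id:
  assumes "length c = d"
  shows "on_unitary d (\<lambda>U. minor d (stack_id d U) (nth c)) \<in> Hom_U d (length (filter (\<lambda>v. v < d) c)) 0"
  unfolding minor_leibniz
proof (intro on_unitary_sum on_unitary_scale)
  fix \<pi> assume "\<pi> \<in> {\<pi>. \<pi> permutes {0..<d}}"
  then have \<pi>: "\<pi> k < d" if "k < d" for k using permutes_bound that by auto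
  have "on_unitary d (\<lambda>U. \<Prod>k = 0..<d. stack_id d U (\<pi> k) (c ! k)) \<in>
      Hom_U d (\<Sum>k = 0..<d. of_bool (c ! k < d)) (\<Sum>k = 0..<d. 0)"
  proof (rule on_unitary_prod)
    fix k assume "k \<in> {0..<d}"
    then show "on_unitary d (\<lambda>U. stack_id d U (\<pi> k) (c ! k)) \<in> Hom_U d (of_bool (c ! k < d)) 0"
      using on_unitary_entry(1)[of "\<pi> k" d "c ! k"] \<pi>
        on_unitary_scale[OF on_unitary_one, of d "of_bool (c ! k = d + \<pi> k)"]
      by (cases "c ! k < d") (auto simp: stack_id_def simp del: of_bool_eq)
  qed simp
  then show "on_unitary d (\<lambda>U. \<Prod>k = 0..<d. stack_id d U (\<pi> k) (c ! k)) \<in>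
      Hom_U d (length (filter (\<lambda>v. v < d) c)) 0"
    using assms by (simp add: length_filter_eq_sum_nth)
qed

text \<open>As for [U | 1], with the blocks in opposite roles. The bound on the entries makes
  \<open>c ! k - d\<close> a valid index into U^*, whereas a large index in [U | 1] simply gives a
  zero column.\<close>

lemma on_unitary_minor_id_stack:
  assumes "length c = d" "set c \<subseteq> {..<2 * d}"
  shows "on_unitary d (\<lambda>U. minor d (id_stack d U) (nth c)) \<in> Hom_U d 0 (length (filter (\<lambda>v. \<not> v < d) c))"
  unfolding minor_leibniz
proof (intro on_unitary_sum on_unitary_scale)
  fix \<pi> assume "\<pi> \<in> {\<pi>. \<pi> permutes {0..<d}}"
  then have \<pi>: "\<pi> k < d" if "k < d" for k using permutes_bound that by auto
  have "on_unitary d (\<lambda>U. \<Prod>k = 0..<d. id_stack d U (\<pi> k) (c ! k)) \<in>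
      Hom_U d (\<Sum>k = 0..<d. 0) (\<Sum>k = 0..<d. of_bool (\<not> c ! k < d))"
  proof (rule on_unitary_prod)
    fix k assume k: "k \<in> {0..<d}"
    then have "c ! k < 2 * d" using assms by (metis atLeastLessThan_iff lessThan_iff nth_mem subsetD)
    then show "on_unitary d (\<lambda>U. id_stack d U (\<pi> k) (c ! k)) \<in> Hom_U d 0 (of_bool (\<not> c ! k < d))"
      using on_unitary_entry(2)[of "\<pi> k" d "c ! k - d"] \<pi> k
        on_unitary_scale[OF on_unitary_one, of d "of_bool (c ! k = \<pi> k)"]
      by (cases "c ! k < d") (auto simp: id_stack_def simp del: of_bool_eq)
  qed simp
  then show "on_unitary d (\<lambda>U. \<Prod>k = 0..<d. id_stack d U (\<pi> k) (c ! k)) \<in>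
      Hom_U d 0 (length (filter (\<lambda>v. \<not> v < d) c))"
    using assms by (simp add: length_filter_eq_sum_nth)
qed

text \<open>Jacobi's complementary minor theorem, in the form \<open>[U | 1] = U [1 | U\<^sup>*]\<close>.\<close>
lemma minor_stack_id:
  assumes U: "U \<in> unitary_group d" and c: "length c = d" "set c \<subseteq> {..<2 * d}"
  shows "minor d (stack_id d U) (nth c) = det U * minor d (id_stack d U) (nth c)"
proof (rule minor_mult_left)
  show "U \<in> carrier_mat d d" using U by (simp add: unitary_group_def)
  fix k j assume kj: "k < d" "j < d"
  have "c ! k < 2 * d" using column_entry_bound[of d c "[]" k] c kj by (simp add: tableau_def)
  show "stack_id d U j (c ! k) = (\<Sum>l = 0..<d. U $$ (j, l) * id_stack d U l (c ! k))"
  proof (cases "c ! k < d")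
    case True
    have "(\<Sum>l = 0..<d. U $$ (j, l) * id_stack d U l (c ! k)) = (\<Sum>l = 0..<d. if l = c ! k then U $$ (j, c ! k) else 0)"
      by (intro sum.cong) (auto simp: id_stack_def True)
    then show ?thesis using True by (simp add: stack_id_def)
  next
    case False
    have "(\<Sum>l = 0..<d. U $$ (j, l) * id_stack d U l (c ! k)) = of_bool (j = c ! k - d)"
      using unitary_sum[OF U kj(2), of "c ! k - d"] False \<open>c ! k < 2 * d\<close> by (simp add: id_stack_def)
    then show ?thesis using False by (auto simp: stack_id_def)
  qed
qed

text \<open>A permutation other than the identity moves some index besides \<open>i\<close>, and the
  unit vector there kills its Leibniz term. This exhibits single entries of U and U^* as maximal
  minors.\<close>

lemma minor_unit_rows:
  assumes i: "i < d" and Y: "\<And>k l. k < d \<Longrightarrow> k \<noteq> i \<Longrightarrow> l < d \<Longrightarrow> Y l (c k) = of_bool (l = k)"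
  shows "minor d Y c = Y i (c i)"
proof -
  have "minor d Y c = (\<Sum>\<pi> \<in> {id}. of_int (sign \<pi>) * (\<Prod>k = 0..<d. Y (\<pi> k) (c k)))"
    unfolding minor_leibniz
  proof (intro sum.mono_neutral_right ballI)
    fix \<pi> assume "\<pi> \<in> {\<pi>. \<pi> permutes {0..<d}} - {id}"
    then have \<pi>: "\<pi> permutes {0..<d}" "\<pi> \<noteq> id" by auto
    have "\<exists>k<d. k \<noteq> i \<and> \<pi> k \<noteq> k"
    proof (rule ccontr)
      assume *: "\<not> ?thesis"
      have "\<pi> k = k" if "k \<noteq> i" for k
        using * that permutes_not_in[OF \<pi>(1), of k] by (cases "k < d") auto
      moreover from this have "\<pi> i = i" using permutes_inj[OF \<pi>(1)] by (metis injD)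
      ultimately have "\<pi> = id" by (metis eq_id_iff)
      then show False using \<pi>(2) by simp
    qed
    then obtain k where k: "k < d" "k \<noteq> i" "\<pi> k \<noteq> k" by auto
    then have "Y (\<pi> k) (c k) = 0" using Y permutes_bound[OF \<pi>(1)] by auto
    then show "of_int (sign \<pi>) * (\<Prod>k = 0..<d. Y (\<pi> k) (c k)) = 0" using k by (auto intro!: prod_zero)
  qed (auto simp: permutes_id finite_permutations)
  also have "\<dots> = (\<Prod>k = 0..<d. Y k (c k))" by simp
  also have "\<dots> = Y i (c i) * (\<Prod>k \<in> {0..<d} - {i}. Y k (c k))" using i by (subst prod.remove[of _ i]) auto
  also have "(\<Prod>k \<in> {0..<d} - {i}. Y k (c k)) = 1" using Y by (intro prod.neutral) auto
  finally show ?thesis by simp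
qed

text \<open>A column encoding an entry of U has one value below \<open>d\<close>, a column encoding
  an entry of U^* has \<open>d - 1\<close>. Taking \<open>s\<close> columns of the second kind
  followed by \<open>r\<close> of the first gives the two constants. The last condition is an
  inequality because straightening may raise the count in the first \<open>s\<close>
  columns.\<close>

definition good_tableaux :: "nat \<Rightarrow> nat \<Rightarrow> nat \<Rightarrow> nat list list set" where
  "good_tableaux d r s = {T. standard d T \<and> length T = r + s \<and> set (concat T) \<subseteq> {..<2 * d} \<and>
     low d T = r + s * (d - 1) \<and> s * (d - 1) \<le> low d (take s T)}"

text \<open>The extension by zero is put into the scalar factor, so that the function has the form
  treated by \<open>straightening\<close>.\<close>

definition tableau_fun :: "nat \<Rightarrow> nat \<Rightarrow> nat list list \<Rightarrow> complex mat \<Rightarrow> complex" where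
  "tableau_fun d s T = (\<lambda>U. (if U \<in> unitary_group d then 1 / det U ^ s else 0) * minor_prod d (stack_id d U) T)"

lemma unitary_det_nonzero:
  assumes "U \<in> unitary_group d"
  shows "det U \<noteq> 0"
proof -
  have "U \<in> carrier_mat d d" "mat_adjoint U \<in> carrier_mat d d" "U * mat_adjoint U = 1\<^sub>m d"
    using assms mat_adjoint_carrier by (auto simp: unitary_group_def)
  then have "det U * det (mat_adjoint U) = 1" by (metis det_mult det_one)
  then show ?thesis by auto
qed

lemma minor_prod_stack_id:
  assumes U: "U \<in> unitary_group d" and "tableau d T" "set (concat T) \<subseteq> {..<2 * d}"
  shows "minor_prod d (stack_id d U) T = det U ^ length T * minor_prod d (id_stack d U) T"
  using assms(2,3)
proof (induction T)
  case (Cons c T)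
  then have "length c = d" "set c \<subseteq> {..<2 * d}" "tableau d T" "set (concat T) \<subseteq> {..<2 * d}"
    by (auto simp: tableau_def)
  then show ?case using Cons.IH minor_stack_id[OF U, of c] by simp
qed simp

lemma tableau_fun_eq:
  assumes "tableau d T" "set (concat T) \<subseteq> {..<2 * d}" "s \<le> length T"
  shows "tableau_fun d s T = on_unitary d (\<lambda>U. minor_prod d (stack_id d U) (drop s T) * minor_prod d (id_stack d U) (take s T))"
proof
  fix U
  show "tableau_fun d s T U = on_unitary d (\<lambda>U. minor_prod d (stack_id d U) (drop s T) * minor_prod d (id_stack d U) (take s T)) U"
  proof (cases "U \<in> unitary_group d")
    case True
    have "minor_prod d (stack_id d U) T = minor_prod d (stack_id d U) (take s T) * minor_prod d (stack_id d U) (drop s T)"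
      by (metis append_take_drop_id minor_prod_simps(3))
    also have "minor_prod d (stack_id d U) (take s T) = det U ^ s * minor_prod d (id_stack d U) (take s T)"
    proof -
      have "tableau d (take s T)" using assms(1) by (auto simp: tableau_def dest: in_set_takeD)
      moreover have "set (concat (take s T)) \<subseteq> {..<2 * d}" using assms(2) by (auto dest: in_set_takeD)
      ultimately show ?thesis using minor_prod_stack_id[OF True, of "take s T"] assms(3) by simp
    qed
    finally show ?thesis using True unitary_det_nonzero[OF True] by (simp add: tableau_fun_def on_unitary_def)
  qed (simp add: tableau_fun_def on_unitary_def)
qed

lemma on_unitary_minor_prod_stack_id:
  "tableau d T \<Longrightarrow> on_unitary d (\<lambda>U. minor_prod d (stack_id d U) T) \<in> Hom_U d (low d T) 0"
proof (induction T)
  case (Cons c T)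
  then show ?case using Hom_U_mult[OF on_unitary_minor_stack_id[of c d] Cons.IH] by (simp add: tableau_def)
qed (simp add: on_unitary_one)

lemma on_unitary_minor_prod_id_stack:
  "tableau d T \<Longrightarrow> set (concat T) \<subseteq> {..<2 * d} \<Longrightarrow>
    on_unitary d (\<lambda>U. minor_prod d (id_stack d U) T) \<in> Hom_U d 0 (d * length T - low d T)"
proof (induction T)
  case (Cons c T)
  have "length (filter (\<lambda>v. \<not> v < d) c) + length (filter (\<lambda>v. v < d) c) = d"
    using sum_length_filter_compl[of "\<lambda>v. v < d" c] Cons.prems by (simp add: tableau_def)
  moreover have "low d T \<le> d * length T"
  proof -
    have "low d T \<le> length (concat T)" by (simp add: low_def)
    also have "\<dots> = d * length T" using Cons.prems(1) by (induction T) (auto simp: tableau_def)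
    finally show ?thesis .
  qed
  ultimately have "length (filter (\<lambda>v. \<not> v < d) c) + (d * length T - low d T) = d * length (c # T) - low d (c # T)"
    by simp
  then show ?case
    using Hom_U_mult[OF on_unitary_minor_id_stack[of c d] Cons.IH] Cons.prems by (auto simp: tableau_def)
qed (simp add: on_unitary_one)

text \<open>Let \<open>a\<close> count the entries below \<open>d\<close> outside the first
  \<open>s\<close> columns, and \<open>b\<close> the entries not below \<open>d\<close> inside them.
  The product has bidegree \<open>(a, b)\<close>, where a - b = r - s by the total count and a <= r
  by the inequality; raising both degrees by \<open>r - a\<close> gives
  \<open>(r, s)\<close>.\<close>

lemma tableau_fun_in_Hom_U:
  assumes "d > 0" "T \<in> good_tableaux d r s"
  shows "tableau_fun d s T \<in> Hom_U d r s"
proof -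
  have T: "tableau d T" "length T = r + s" "set (concat T) \<subseteq> {..<2 * d}" "low d T = r + s * (d - 1)"
    "s * (d - 1) \<le> low d (take s T)"
    using assms(2) by (auto simp: good_tableaux_def standard_def)
  have tab: "tableau d (drop s T)" "tableau d (take s T)" "set (concat (take s T)) \<subseteq> {..<2 * d}"
    using T(1,3) by (auto simp: tableau_def dest: in_set_takeD in_set_dropD)
  define a where "a = low d (drop s T)"
  define b where "b = d * s - low d (take s T)"
  have "on_unitary d (\<lambda>U. minor_prod d (stack_id d U) (drop s T) * minor_prod d (id_stack d U) (take s T)) \<in> Hom_U d a b"
    using Hom_U_mult[OF on_unitary_minor_prod_stack_id[OF tab(1)] on_unitary_minor_prod_id_stack[OF tab(2,3)]] T(2)
    by (simp add: a_def b_def)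
  then have "tableau_fun d s T \<in> Hom_U d (a + n) (b + n)" for n
    using Hom_U_raise[OF assms(1)] T tableau_fun_eq[of d T s] by simp
  moreover have "a + (r - a) = r" "b + (r - a) = s"
  proof -
    have 1: "low d (take s T) + a = r + s * (d - 1)"
      unfolding a_def T(4)[symmetric] by (metis append_take_drop_id low_simps(3))
    have "low d (take s T) \<le> length (concat (take s T))" by (simp add: low_def)
    also have "\<dots> = d * length (take s T)" using tab(2) by (induction "take s T" arbitrary: T s) (auto simp: tableau_def length_concat sum_list_triv cong: map_cong)
    finally have 2: "low d (take s T) \<le> d * s" using T(2) by simp
    have 3: "d * s = s * (d - 1) + s" using assms(1) by (cases d) auto
    show "a + (r - a) = r" "b + (r - a) = s" using 1 2 3 T(5) unfolding b_def by linarith+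
  qed
  ultimately show ?thesis by metis
qed

lemma Hom_U_eq_span_tableaux:
  assumes "d > 0"
  shows "Hom_U d r s = fun_vs.span (tableau_fun d s ` good_tableaux d r s)"
proof
  show "fun_vs.span (tableau_fun d s ` good_tableaux d r s) \<subseteq> Hom_U d r s"
    using tableau_fun_in_Hom_U[OF assms] by (intro fun_vs.span_minimal subspace_Hom_U) auto
  show "Hom_U d r s \<subseteq> fun_vs.span (tableau_fun d s ` good_tableaux d r s)"
    unfolding Hom_U_eq_span
  proof (rule fun_vs.span_minimal, rule subsetI)
    fix f assume "f \<in> entry_monomials d r s"
    then obtain es as where es: "set es \<subseteq> {..<d} \<times> {..<d}" "length es = r"
      and as: "set as \<subseteq> {..<d} \<times> {..<d}" "length as = s"
      and f: "f = on_unitary d (\<lambda>U. entry_prod U es * entry_prod (mat_adjoint U) as)"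
      unfolding entry_monomials_def by blast
    \<comment> \<open>\<open>ce (i, j)\<close> replaces the \<open>i\<close>-th unit column of
      [U | 1] by column \<open>j\<close> of U, so its minor is U_ij; \<open>ca\<close> does the same
      in [1 | U^*]. In \<open>T\<close> the columns from U^* come first, since the first
      \<open>s\<close> columns are the ones read in [1 | U^*].\<close>
    define ce where "ce = (\<lambda>(i, j). map (\<lambda>k. if k = i then j else d + k) [0..<d])"
    define ca where "ca = (\<lambda>(i, j). map (\<lambda>k. if k = i then d + j else k) [0..<d])"
    define T where "T = map ca as @ map ce es"
    have tab: "tableau d T" by (auto simp: T_def tableau_def ce_def ca_def)
    have entries: "set (concat T) \<subseteq> {..<2 * d}"
      using es(1) as(1) by (fastforce simp: T_def ce_def ca_def split: if_splits)
    have fce: "length (filter (\<lambda>v. v < d) (ce e)) = 1" if e0: "e \<in> {..<d} \<times> {..<d}" for e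
    proof -
      obtain i j where e: "e = (i, j)" "i < d" "j < d" using e0 by auto
      have "length (filter (\<lambda>v. v < d) (ce e)) = (\<Sum>k = 0..<d. if k = i then 1 else 0)"
        unfolding length_filter_eq_sum_nth by (auto simp: ce_def e intro!: sum.cong)
      then show ?thesis using e by simp
    qed
    have fca: "length (filter (\<lambda>v. v < d) (ca e)) = d - 1" if e0: "e \<in> {..<d} \<times> {..<d}" for e
    proof -
      obtain i j where e: "e = (i, j)" "i < d" "j < d" using e0 by auto
      have "length (filter (\<lambda>v. v < d) (ca e)) = (\<Sum>k = 0..<d. if k = i then 0 else 1)"
        unfolding length_filter_eq_sum_nth by (rule sum.cong) (auto simp: ca_def e)
      then have "length (filter (\<lambda>v. v < d) (ca e)) + 1 = (\<Sum>k = 0..<d. if k = i then 0 else 1) + (\<Sum>k = 0..<d. if k = i then 1 else 0)"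
        using e by simp
      also have "\<dots> = (\<Sum>k = 0..<d. 1)" unfolding sum.distrib[symmetric] by (intro sum.cong) auto
      finally show ?thesis by simp
    qed
    have low_ce: "low d (map ce es) = r"
      unfolding es(2)[symmetric] using es(1) by (induction es) (auto simp: fce)
    have low_ca: "low d (map ca as) = s * (d - 1)"
      unfolding as(2)[symmetric] using as(1) by (induction as) (auto simp: fca)
    have mce: "minor d (stack_id d U) (nth (ce e)) = U $$ e" if e0: "e \<in> {..<d} \<times> {..<d}" for U e
    proof -
      obtain i j where e: "e = (i, j)" "i < d" "j < d" using e0 by auto
      show ?thesis using e by (subst minor_unit_rows[of i]) (auto simp: ce_def stack_id_def)
    qed
    have mca: "minor d (id_stack d U) (nth (ca e)) = mat_adjoint U $$ e" if e0: "e \<in> {..<d} \<times> {..<d}" for U e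
    proof -
      obtain i j where e: "e = (i, j)" "i < d" "j < d" using e0 by auto
      show ?thesis using e by (subst minor_unit_rows[of i]) (auto simp: ca_def id_stack_def)
    qed
    have "tableau_fun d s T = f"
    proof -
      have "minor_prod d (stack_id d U) (map ce es) = entry_prod U es" for U
        using es(1) unfolding minor_prod_def entry_prod_def map_map
        by (intro arg_cong[of _ _ prod_list] map_cong) (auto intro!: mce)
      moreover have "minor_prod d (id_stack d U) (map ca as) = entry_prod (mat_adjoint U) as" for U
        using as(1) unfolding minor_prod_def entry_prod_def map_map
        by (intro arg_cong[of _ _ prod_list] map_cong) (auto intro!: mca)
      ultimately show ?thesis
        unfolding f using tableau_fun_eq[OF tab entries, of s] as(2) by (simp add: T_def)
    qed
    moreover have "tableau_fun d s T \<in> fun_vs.span (tableau_fun d s ` good_tableaux d r s)"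
    proof -
      let ?W = "{T'. standard d T' \<and> length T' = length T \<and> mset (concat T') = mset (concat T) \<and>
          low d (take s T) \<le> low d (take s T')}"
      \<comment> \<open>Straightening preserves the entries as a multiset, which settles the total
        count; the inequality comes from its estimate for the first \<open>s\<close>
        columns.\<close>
      have "?W \<subseteq> good_tableaux d r s"
      proof
        fix T' assume "T' \<in> ?W"
        then have T': "standard d T'" "length T' = length T" "mset (concat T') = mset (concat T)"
          "low d (take s T) \<le> low d (take s T')" by auto
        have "low d T' = low d T" unfolding low_def by (rule length_filter_mset[OF T'(3)])
        moreover have "set (concat T') = set (concat T)" by (rule mset_eq_setD[OF T'(3)])
        ultimately show "T' \<in> good_tableaux d r s"
          using T' entries low_ce low_ca es(2) as(2) unfolding good_tableaux_def T_def by simp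
      qed
      then have "tableau_fun d s ` ?W \<subseteq> tableau_fun d s ` good_tableaux d r s" by blast
      moreover have "tableau_fun d s T \<in> fun_vs.span (tableau_fun d s ` ?W)"
        using straightening[OF tab, of "\<lambda>U. if U \<in> unitary_group d then 1 / det U ^ s else 0" "stack_id d" d s]
        by (simp only: tableau_fun_def[abs_def])
      ultimately show ?thesis using fun_vs.span_mono by blast
    qed
    ultimately show "f \<in> fun_vs.span (tableau_fun d s ` good_tableaux d r s)" by simp
  qed (rule fun_vs.subspace_span)
qed

section \<open>Zariski density of the unitary group\<close>

text \<open>Polynomials in the matrix entries are only ever restricted to curves, so polynomial
  functions of one complex variable suffice for the density argument.\<close>

definition poly_fun :: "(complex \<Rightarrow> complex) \<Rightarrow> bool" where
  "poly_fun f \<longleftrightarrow> (\<exists>p. f = poly p)"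

lemma poly_fun_const [intro, simp]: "poly_fun (\<lambda>_. a)"
  unfolding poly_fun_def by (intro exI[of _ "[:a:]"]) auto

lemma poly_fun_id [intro, simp]: "poly_fun (\<lambda>x. x)"
  unfolding poly_fun_def by (intro exI[of _ "[:0, 1:]"]) auto

lemma poly_fun_add [intro]:
  assumes "poly_fun f" "poly_fun g"
  shows "poly_fun (\<lambda>x. f x + g x)"
proof -
  obtain p q where "f = poly p" "g = poly q" using assms by (auto simp: poly_fun_def)
  then have "(\<lambda>x. f x + g x) = poly (p + q)" by auto
  then show ?thesis unfolding poly_fun_def by blast
qed

lemma poly_fun_diff [intro]:
  assumes "poly_fun f" "poly_fun g"
  shows "poly_fun (\<lambda>x. f x - g x)"
proof -
  obtain p q where "f = poly p" "g = poly q" using assms by (auto simp: poly_fun_def)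
  then have "(\<lambda>x. f x - g x) = poly (p - q)" by auto
  then show ?thesis unfolding poly_fun_def by blast
qed

lemma poly_fun_mult [intro]:
  assumes "poly_fun f" "poly_fun g"
  shows "poly_fun (\<lambda>x. f x * g x)"
proof -
  obtain p q where "f = poly p" "g = poly q" using assms by (auto simp: poly_fun_def)
  then have "(\<lambda>x. f x * g x) = poly (p * q)" by auto
  then show ?thesis unfolding poly_fun_def by blast
qed

lemmas poly_fun_intros = poly_fun_const poly_fun_id poly_fun_add poly_fun_diff poly_fun_mult

lemma poly_fun_sum: "(\<And>a. a \<in> S \<Longrightarrow> poly_fun (f a)) \<Longrightarrow> poly_fun (\<lambda>x. \<Sum>a\<in>S. f a x)"
  by (induction S rule: infinite_finite_induct) auto

lemma poly_fun_prod: "(\<And>a. a \<in> S \<Longrightarrow> poly_fun (f a)) \<Longrightarrow> poly_fun (\<lambda>x. \<Prod>a\<in>S. f a x)"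
  by (induction S rule: infinite_finite_induct) auto

lemma poly_fun_minor:
  assumes "\<And>j k. j < d \<Longrightarrow> k < d \<Longrightarrow> poly_fun (\<lambda>x. Y x j (c k))"
  shows "poly_fun (\<lambda>x. minor d (Y x) c)"
  unfolding minor_leibniz
  by (intro poly_fun_sum poly_fun_mult poly_fun_const poly_fun_prod assms) (auto dest: permutes_bound)

lemma poly_fun_minor_prod:
  assumes "tableau d T" "set (concat T) \<subseteq> {..<2 * d}"
    and Y: "\<And>j k. j < d \<Longrightarrow> k < 2 * d \<Longrightarrow> poly_fun (\<lambda>x. Y x j k)"
  shows "poly_fun (\<lambda>x. minor_prod d (Y x) T)"
  using assms(1,2)
proof (induction T)
  case (Cons c T)
  have "poly_fun (\<lambda>x. minor d (Y x) (nth c))"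
  proof (rule poly_fun_minor)
    fix j k assume "j < d" "k < d"
    moreover from this have "c ! k < 2 * d" by (intro column_entry_bound[OF Cons.prems])
    ultimately show "poly_fun (\<lambda>x. Y x j (c ! k))" by (intro Y)
  qed
  then show ?case using Cons by (auto simp: tableau_def)
qed simp

lemma poly_fun_det:
  assumes "\<And>i j. i < d \<Longrightarrow> j < d \<Longrightarrow> poly_fun (\<lambda>x. F x i j)"
  shows "poly_fun (\<lambda>x. det (mat d d (\<lambda>(i, j). F x i j)))"
  using poly_fun_minor[of d "\<lambda>x j k. F x k j" "\<lambda>k. k"] assms by (simp add: minor_def)

text \<open>\<open>D\<close> has finitely many roots, so infinitely many real points remain, all of
  them roots of \<open>f\<close>. Typically \<open>D\<close> is a determinant whose nonvanishing
  makes a matrix invertible.\<close>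

lemma poly_fun_vanish:
  assumes f: "poly_fun f" and D: "poly_fun D" "D x0 \<noteq> 0"
    and z: "\<And>y. y \<in> \<real> \<Longrightarrow> D y \<noteq> 0 \<Longrightarrow> f y = 0"
  shows "f x = 0"
proof -
  obtain p q where pq: "f = poly p" "D = poly q" using f D by (auto simp: poly_fun_def)
  have "q \<noteq> 0" using D pq by auto
  then have "finite {x. poly q x = 0}" by (rule poly_roots_finite)
  moreover have "infinite (\<real> :: complex set)"
  proof
    assume "finite (\<real> :: complex set)"
    then have "finite (range (of_real :: real \<Rightarrow> complex))" by (simp add: Reals_def)
    then have "finite (UNIV :: real set)" by (rule finite_imageD) (auto simp: inj_on_def)
    then show False using infinite_UNIV_char_0 by blast
  qed
  ultimately have "infinite (\<real> - {x. poly q x = 0})" by (rule Diff_infinite_finite)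
  moreover have "\<real> - {x. poly q x = 0} \<subseteq> {x. poly p x = 0}" using z pq by auto
  ultimately have "infinite {x. poly p x = 0}" using finite_subset by blast
  then have "p = 0" using poly_roots_finite by blast
  then show ?thesis by (simp add: pq)
qed

definition block :: "nat \<Rightarrow> complex mat \<Rightarrow> complex mat \<Rightarrow> nat \<Rightarrow> nat \<Rightarrow> complex" where
  "block d A B i k = (if k < d then A $$ (i, k) else B $$ (i, k - d))"

lemma minor_prod_block_mult:
  assumes G: "G \<in> carrier_mat d d" and A: "A \<in> carrier_mat d d" and B: "B \<in> carrier_mat d d"
    and "tableau d T" "set (concat T) \<subseteq> {..<2 * d}"
  shows "minor_prod d (block d (G * A) (G * B)) T = det G ^ length T * minor_prod d (block d A B) T"
  using assms(4,5)
proof (induction T)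
  case (Cons c T)
  have "minor d (block d (G * A) (G * B)) (nth c) = det G * minor d (block d A B) (nth c)"
  proof (rule minor_mult_left[OF G])
    fix k j assume kj: "k < d" "j < d"
    then have "c ! k < 2 * d" by (intro column_entry_bound[OF Cons.prems])
    then show "block d (G * A) (G * B) j (c ! k) = (\<Sum>l = 0..<d. G $$ (j, l) * block d A B l (c ! k))"
      using kj G A B by (auto simp: block_def scalar_prod_def)
  qed
  then show ?case using Cons by (simp add: tableau_def)
qed simp

lemma minor_prod_cong:
  assumes "tableau d T" "set (concat T) \<subseteq> {..<2 * d}"
    and Y: "\<And>j k. j < d \<Longrightarrow> k < 2 * d \<Longrightarrow> Y j k = Z j k"
  shows "minor_prod d Y T = minor_prod d Z T"
  using assms(1,2)
proof (induction T)
  case (Cons c T)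
  have "minor d Y (nth c) = minor d Z (nth c)"
  proof (rule minor_cong)
    fix k j assume kj: "k < d" "j < d"
    then have "c ! k < 2 * d" by (intro column_entry_bound[OF Cons.prems])
    then show "Y j (c ! k) = Z j (c ! k)" using kj by (intro Y)
  qed
  then show ?case using Cons by (simp add: tableau_def)
qed simp

lemma nonzero_det_inverse:
  fixes A :: "complex mat"
  assumes "A \<in> carrier_mat d d" "det A \<noteq> 0"
  obtains B where "B \<in> carrier_mat d d" "A * B = 1\<^sub>m d" "B * A = 1\<^sub>m d"
proof -
  have "A * ((1 / det A) \<cdot>\<^sub>m adj_mat A) = 1\<^sub>m d"
    using adj_mat[OF assms(1)] assms by (subst mult_smult_distrib[of _ d d _ d]) auto
  moreover have "((1 / det A) \<cdot>\<^sub>m adj_mat A) * A = 1\<^sub>m d"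
    using adj_mat[OF assms(1)] assms by (subst mult_smult_assoc_mat[of _ d d _ d]) auto
  ultimately show thesis using that adj_mat(1)[OF assms(1)] by (meson smult_carrier_mat)
qed

lemma mat_adjoint_mult:
  fixes A B :: "complex mat"
  assumes "A \<in> carrier_mat d d" "B \<in> carrier_mat d d"
  shows "mat_adjoint (A * B) = mat_adjoint B * mat_adjoint A"
proof (rule eq_matI)
  have c: "mat_adjoint A \<in> carrier_mat d d" "mat_adjoint B \<in> carrier_mat d d"
    using assms mat_adjoint_carrier by auto
  fix i j assume "i < dim_row (mat_adjoint B * mat_adjoint A)" "j < dim_col (mat_adjoint B * mat_adjoint A)"
  then have ij: "i < d" "j < d" using c by auto
  have "mat_adjoint (A * B) $$ (i, j) = cnj ((A * B) $$ (j, i))"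
    using ij assms by (intro mat_adjoint_index[of _ d]) auto
  also have "\<dots> = (\<Sum>k = 0..<d. mat_adjoint B $$ (i, k) * mat_adjoint A $$ (k, j))"
    using ij assms by (auto simp: scalar_prod_def mat_adjoint_index mult.commute intro!: sum.cong)
  also have "\<dots> = (mat_adjoint B * mat_adjoint A) $$ (i, j)"
    using ij c by (simp add: scalar_prod_def)
  finally show "mat_adjoint (A * B) $$ (i, j) = (mat_adjoint B * mat_adjoint A) $$ (i, j)" .
qed (use assms mat_adjoint_carrier[of A d] mat_adjoint_carrier[of B d] mat_adjoint_carrier[of "A * B" d] in auto)

text \<open>With \<open>B\<close> the adjoint of \<open>A\<close> and \<open>C\<close> the inverse
  of \<open>B\<close>, taking adjoints in C B = 1 gives A C^* = 1; then C A B C^* = C B A C^* =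
  1.\<close>

lemma cayley_unitary:
  assumes A: "A \<in> carrier_mat d d" and B: "B \<in> carrier_mat d d" and adj: "mat_adjoint A = B" "mat_adjoint B = A"
    and comm: "A * B = B * A" and C: "C \<in> carrier_mat d d" "B * C = 1\<^sub>m d" "C * B = 1\<^sub>m d"
  shows "C * A \<in> unitary_group d"
proof -
  have adjC: "mat_adjoint C \<in> carrier_mat d d" using C(1) by (rule mat_adjoint_carrier)
  have one: "mat_adjoint (1\<^sub>m d) = (1\<^sub>m d :: complex mat)"
    using mat_adjoint_carrier[of "1\<^sub>m d" d] by (intro eq_matI) (auto simp: mat_adjoint_index[of _ d])
  have "A * mat_adjoint C = 1\<^sub>m d"
    using mat_adjoint_mult[OF C(1) B] C(3) adj one by simp
  have adjCA: "mat_adjoint (C * A) = B * mat_adjoint C"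
    using mat_adjoint_mult[OF C(1) A] adj by simp
  have "C * A * (B * mat_adjoint C) = C * (A * B) * mat_adjoint C"
    using A B C(1) adjC by (simp add: assoc_mult_mat[of _ d d _ d _ d] mult_carrier_mat[of _ d d _ d])
  also have "\<dots> = C * B * (A * mat_adjoint C)"
    unfolding comm using A B C(1) adjC by (simp add: assoc_mult_mat[of _ d d _ d _ d] mult_carrier_mat[of _ d d _ d])
  also have "\<dots> = 1\<^sub>m d" using \<open>A * mat_adjoint C = 1\<^sub>m d\<close> C(3) by simp
  finally have U: "(C * A) * mat_adjoint (C * A) = 1\<^sub>m d" unfolding adjCA .
  have cU: "C * A \<in> carrier_mat d d" using C(1) A by simp
  have "mat_adjoint (C * A) * (C * A) = 1\<^sub>m d"
    by (rule mat_mult_left_right_inverse[OF cU mat_adjoint_carrier[OF cU] U])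
  then show ?thesis using U cU by (simp add: unitary_group_def)
qed

text \<open>The Cayley transform gives the vanishing at \<open>[1 + \<i>H | 1 - \<i>H]\<close> for Hermitian \<open>H\<close>. Every matrix is
  \<open>H\<^sub>1 + \<i>H\<^sub>2\<close> with Hermitian \<open>H\<^sub>1\<close>, \<open>H\<^sub>2\<close>, so the polynomial \<open>x \<mapsto> H\<^sub>1 + xH\<^sub>2\<close> extends this from real \<open>x\<close>
  to arbitrary matrices in place of \<open>H\<close>; then use the covariance under left multiplication.\<close>
lemma unitary_zariski_dense:
  fixes c :: "nat list list \<Rightarrow> complex"
  assumes F: "\<And>T. T \<in> F \<Longrightarrow> tableau d T \<and> set (concat T) \<subseteq> {..<2 * d} \<and> length T = m"
    and van: "\<And>U. U \<in> unitary_group d \<Longrightarrow> (\<Sum>T\<in>F. c T * minor_prod d (stack_id d U) T) = 0"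
  shows "(\<Sum>T\<in>F. c T * minor_prod d Y T) = 0"
proof -
  define \<Phi> where "\<Phi> A B = (\<Sum>T\<in>F. c T * minor_prod d (block d A B) T)" for A B
  have poly: "poly_fun (\<lambda>x. \<Phi> (mat d d (\<lambda>(i, j). P x i j)) (mat d d (\<lambda>(i, j). Q x i j)))"
    if PQ: "\<And>i j. poly_fun (\<lambda>x. P x i j)" "\<And>i j. poly_fun (\<lambda>x. Q x i j)" for P Q
    unfolding \<Phi>_def
  proof (intro poly_fun_sum poly_fun_mult poly_fun_const poly_fun_minor_prod)
    fix j k assume "j < d" "k < 2 * d"
    then show "poly_fun (\<lambda>x. block d (mat d d (\<lambda>(i, j). P x i j)) (mat d d (\<lambda>(i, j). Q x i j)) j k)"
      using PQ by (cases "k < d") (auto simp: block_def)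
  qed (use F in auto)
  have mult: "\<Phi> (G * A) (G * B) = det G ^ m * \<Phi> A B"
    if "G \<in> carrier_mat d d" "A \<in> carrier_mat d d" "B \<in> carrier_mat d d" for G A B
    unfolding \<Phi>_def sum_distrib_left using F that
    by (intro sum.cong refl) (simp add: minor_prod_block_mult)
  define P where "P x Z = mat d d (\<lambda>(i, j). of_bool (i = j) + x * Z i j)" for x :: complex and Z
  have P_carrier: "P x Z \<in> carrier_mat d d" for x Z by (simp add: P_def)
  \<comment> \<open>Left multiplication by the inverse of 1 - iH turns [1 + iH | 1 - iH] into
    [U | 1] with U unitary.\<close>
  have step1: "\<Phi> (P \<i> H) (P (- \<i>) H) = 0"
    if H: "\<And>i j. cnj (H i j) = H j i" and dn: "det (P (- \<i>) H) \<noteq> 0" for H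
  proof -
    let ?A = "P \<i> H" and ?B = "P (- \<i>) H"
    obtain C where C: "C \<in> carrier_mat d d" "?B * C = 1\<^sub>m d" "C * ?B = 1\<^sub>m d"
      using nonzero_det_inverse[OF P_carrier dn] by blast
    have adj: "mat_adjoint (P x H) = P (cnj x) H" for x
    proof (rule eq_matI)
      fix i j assume "i < dim_row (P (cnj x) H)" "j < dim_col (P (cnj x) H)"
      then have "i < d" "j < d" by (auto simp: P_def)
      then show "mat_adjoint (P x H) $$ (i, j) = P (cnj x) H $$ (i, j)"
        by (subst mat_adjoint_index[OF P_carrier]) (auto simp: P_def H)
    qed (use mat_adjoint_carrier[OF P_carrier[of x H]] P_carrier[of "cnj x" H] in auto)
    have entry: "(P x H * P y H) $$ (i, j) = of_bool (i = j) + (x + y) * H i j + x * y * (\<Sum>k = 0..<d. H i k * H k j)"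
      if "i < d" "j < d" for i j x y
    proof -
      have "(P x H * P y H) $$ (i, j) = (\<Sum>k = 0..<d. (of_bool (i = k) + x * H i k) * (of_bool (k = j) + y * H k j))"
        using that by (simp add: P_def scalar_prod_def)
      also have "\<dots> = (\<Sum>k = 0..<d. (if k = i then of_bool (i = j) + y * H i j else 0) +
          (if k = j then x * H i j else 0) + x * y * (H i k * H k j))"
        by (intro sum.cong) (auto simp: algebra_simps)
      also have "\<dots> = of_bool (i = j) + (x + y) * H i j + x * y * (\<Sum>k = 0..<d. H i k * H k j)"
        using that by (simp add: sum.distrib sum_distrib_left algebra_simps)
      finally show ?thesis .
    qed
    have comm: "?A * ?B = ?B * ?A"
    proof (rule eq_matI)
      fix i j assume "i < dim_row (?B * ?A)" "j < dim_col (?B * ?A)"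
      then have "i < d" "j < d" by (auto simp: P_def)
      then show "(?A * ?B) $$ (i, j) = (?B * ?A) $$ (i, j)" by (simp add: entry)
    qed (auto simp: P_def)
    have U: "C * ?A \<in> unitary_group d"
      by (rule cayley_unitary[OF P_carrier P_carrier _ _ comm C]) (simp_all add: adj)
    have "\<Phi> (C * ?A) (C * ?B) = 0"
      unfolding \<Phi>_def van[OF U, symmetric]
      by (intro sum.cong refl arg_cong2[of _ _ _ _ "(*)"] minor_prod_cong)
         (use F C(3) in \<open>auto simp: block_def stack_id_def\<close>)
    moreover have "det C \<noteq> 0"
      using C det_mult[OF P_carrier C(1), of "- \<i>" H] by auto
    ultimately show ?thesis using mult[OF C(1) P_carrier P_carrier] by simp
  qed
  \<comment> \<open>Instead of a spectral argument for the invertibility of 1 - iH, the matrix H is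
    scaled by x: at x = 0 invertibility is clear, so it fails for finitely many x only, and the
    polynomial in x vanishes at x = 1 as well.\<close>
  have step2: "\<Phi> (P \<i> H) (P (- \<i>) H) = 0" if H: "\<And>i j. cnj (H i j) = H j i" for H
  proof -
    define f where "f x = \<Phi> (P \<i> (\<lambda>i j. x * H i j)) (P (- \<i>) (\<lambda>i j. x * H i j))" for x
    define D where "D x = det (P (- \<i>) (\<lambda>i j. x * H i j))" for x
    have "f 1 = 0"
    proof (rule poly_fun_vanish[of f D 0 1])
      show "poly_fun f" unfolding f_def P_def by (intro poly poly_fun_intros)
      show "poly_fun D" unfolding D_def P_def by (intro poly_fun_det poly_fun_intros)
      have "P (- \<i>) (\<lambda>i j. 0 * H i j) = 1\<^sub>m d" by (rule eq_matI) (auto simp: P_def)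
      then show "D 0 \<noteq> 0" by (simp add: D_def)
      fix y :: complex assume y: "y \<in> \<real>" "D y \<noteq> 0"
      then show "f y = 0" unfolding f_def D_def
        by (intro step1) (auto simp: H Reals_cnj_iff)
    qed
    then show ?thesis by (simp add: f_def)
  qed
  have step3: "\<Phi> (P \<i> Z) (P (- \<i>) Z) = 0" for Z
  proof -
    define H1 where "H1 i j = (Z i j + cnj (Z j i)) / 2" for i j
    define H2 where "H2 i j = (Z i j - cnj (Z j i)) / (2 * \<i>)" for i j
    define f where "f x = \<Phi> (P \<i> (\<lambda>i j. H1 i j + x * H2 i j)) (P (- \<i>) (\<lambda>i j. H1 i j + x * H2 i j))" for x
    have "f \<i> = 0"
    proof (rule poly_fun_vanish[of f "\<lambda>_. 1" 0])
      show "poly_fun f" unfolding f_def P_def by (intro poly poly_fun_intros)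
      fix y :: complex assume y: "y \<in> \<real>"
      then show "f y = 0" unfolding f_def
        by (intro step2) (auto simp: H1_def H2_def Reals_cnj_iff field_simps)
    qed auto
    moreover have "H1 i j + \<i> * H2 i j = Z i j" for i j
      by (simp add: H1_def H2_def field_simps)
    ultimately show ?thesis by (simp add: f_def)
  qed
  \<comment> \<open>Solving A = G (1 + W) and B = G (1 - W) gives G = (A + B) / 2 and W as the
    inverse of G times (A - B) / 2; and 1 + W is 1 + iZ for Z = -iW.\<close>
  have step4: "\<Phi> A B = 0" if A: "A \<in> carrier_mat d d" and B: "B \<in> carrier_mat d d" and dn: "det (A + B) \<noteq> 0" for A B
  proof -
    define G where "G = (1 / 2) \<cdot>\<^sub>m (A + B)"
    have G: "G \<in> carrier_mat d d" using A B by (simp add: G_def)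
    have "det G \<noteq> 0" using dn by (simp add: G_def)
    then obtain G' where G': "G' \<in> carrier_mat d d" "G * G' = 1\<^sub>m d" "G' * G = 1\<^sub>m d"
      using nonzero_det_inverse[OF G] by blast
    define K where "K = (1 / 2) \<cdot>\<^sub>m (A - B)"
    have K: "K \<in> carrier_mat d d" using minus_carrier_mat[OF B] by (simp add: K_def)
    define W where "W = G' * K"
    have W: "W \<in> carrier_mat d d" using G' K by (simp add: W_def mult_carrier_mat[of _ d d])
    have GW: "G * W = K"
      unfolding W_def using G G' K by (subst assoc_mult_mat[symmetric, of _ d d _ d _ d]) auto
    have PW: "P \<i> (\<lambda>i j. - \<i> * W $$ (i, j)) = 1\<^sub>m d + W" "P (- \<i>) (\<lambda>i j. - \<i> * W $$ (i, j)) = 1\<^sub>m d - W"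
      using W by (auto simp: P_def intro!: eq_matI)
    have "G * (1\<^sub>m d + W) = A"
    proof -
      have "G * (1\<^sub>m d + W) = G + K"
        using mult_add_distrib_mat[OF G one_carrier_mat W] G by (simp add: GW)
      also have "\<dots> = A" using A B by (intro eq_matI) (auto simp: G_def K_def field_simps)
      finally show ?thesis .
    qed
    moreover have "G * (1\<^sub>m d - W) = B"
    proof -
      have "G * (1\<^sub>m d - W) = G - K"
        using mult_minus_distrib_mat[OF G one_carrier_mat W] G by (simp add: GW)
      also have "\<dots> = B" using A B by (intro eq_matI) (auto simp: G_def K_def field_simps)
      finally show ?thesis .
    qed
    ultimately have "\<Phi> A B = det G ^ m * \<Phi> (1\<^sub>m d + W) (1\<^sub>m d - W)"
      using mult[OF G, of "1\<^sub>m d + W" "1\<^sub>m d - W"] W minus_carrier_mat[OF W] by simp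
    then show ?thesis using step3[of "\<lambda>i j. - \<i> * W $$ (i, j)"] unfolding PW by simp
  qed
  \<comment> \<open>A line from [1 | 0] at x = 0, where the sum of the two blocks is invertible, to
    the given array at x = 1.\<close>
  define f where "f x = \<Phi> (mat d d (\<lambda>(i, j). x * Y i j + (1 - x) * of_bool (i = j)))
      (mat d d (\<lambda>(i, j). x * Y i (d + j)))" for x
  have "f 1 = 0"
  proof (rule poly_fun_vanish[of f _ 0])
    show "poly_fun f" unfolding f_def by (intro poly poly_fun_intros)
    show "poly_fun (\<lambda>x. det (mat d d (\<lambda>(i, j). x * (Y i j + Y i (d + j)) + (1 - x) * of_bool (i = j))))"
      by (intro poly_fun_det poly_fun_intros)
    have "mat d d (\<lambda>(i, j). 0 * (Y i j + Y i (d + j)) + (1 - 0) * of_bool (i = j)) = 1\<^sub>m d"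
      by (rule eq_matI) auto
    then show "det (mat d d (\<lambda>(i, j). 0 * (Y i j + Y i (d + j)) + (1 - 0) * of_bool (i = j))) \<noteq> 0"
      by simp
    fix x assume *: "det (mat d d (\<lambda>(i, j). x * (Y i j + Y i (d + j)) + (1 - x) * of_bool (i = j))) \<noteq> 0"
    show "f x = 0" unfolding f_def
    proof (rule step4)
      have "mat d d (\<lambda>(i, j). x * Y i j + (1 - x) * of_bool (i = j)) + mat d d (\<lambda>(i, j). x * Y i (d + j)) =
          mat d d (\<lambda>(i, j). x * (Y i j + Y i (d + j)) + (1 - x) * of_bool (i = j))"
        by (rule eq_matI) (auto simp: algebra_simps)
      then show "det (mat d d (\<lambda>(i, j). x * Y i j + (1 - x) * of_bool (i = j)) + mat d d (\<lambda>(i, j). x * Y i (d + j))) \<noteq> 0"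
        using * by simp
    qed auto
  qed
  moreover have "f 1 = (\<Sum>T\<in>F. c T * minor_prod d Y T)"
    unfolding f_def \<Phi>_def
    by (intro sum.cong refl arg_cong2[of _ _ _ _ "(*)"] minor_prod_cong) (use F in \<open>auto simp: block_def\<close>)
  ultimately show ?thesis by simp
qed

section \<open>Linear independence of standard products\<close>

lemma digits_unique:
  fixes f g :: "nat \<Rightarrow> nat"
  assumes "\<And>e. e < n \<Longrightarrow> f e < N" "\<And>e. e < n \<Longrightarrow> g e < N"
    and "(\<Sum>e<n. f e * N ^ e) = (\<Sum>e<n. g e * N ^ e)" "e < n"
  shows "f e = g e"
  using assms
proof (induction n arbitrary: f g e)
  case (Suc n)
  have shift: "(\<Sum>e<Suc n. h e * N ^ e) = h 0 + N * (\<Sum>e<n. h (Suc e) * N ^ e)" for h :: "nat \<Rightarrow> nat"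
    unfolding sum.lessThan_Suc_shift by (simp add: sum_distrib_left algebra_simps)
  have eq: "f 0 + N * (\<Sum>e<n. f (Suc e) * N ^ e) = g 0 + N * (\<Sum>e<n. g (Suc e) * N ^ e)"
    using Suc.prems(3) unfolding shift .
  have lt: "f 0 < N" "g 0 < N" using Suc.prems(1,2) by auto
  have 0: "f 0 = g 0" using arg_cong[OF eq, of "\<lambda>x. x mod N"] lt by simp
  show ?case
  proof (cases e)
    case (Suc e')
    have "(\<Sum>e<n. f (Suc e) * N ^ e) = (\<Sum>e<n. g (Suc e) * N ^ e)" using eq 0 lt by simp
    then show ?thesis using Suc.IH[of "\<lambda>e. f (Suc e)" "\<lambda>e. g (Suc e)" e'] Suc.prems(1,2,4) Suc by simp
  qed (use 0 in simp)
qed simp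

text \<open>Let \<open>m\<close> be the largest index moved. Above it the exponents agree. For
  \<open>k \<le> m\<close> the exponent of \<open>N\<close> stays below the diagonal one at
  \<open>m\<close>, because either \<open>\<pi> k < m\<close>, or \<open>\<pi> k = m\<close> and
  \<open>c k < c m\<close>. At most \<open>d < N\<close> smaller powers of \<open>N\<close> cannot
  add up to the next one.\<close>

lemma diagonal_exponent_max:
  fixes c :: "nat \<Rightarrow> nat"
  assumes c: "\<And>k l. k < l \<Longrightarrow> l < d \<Longrightarrow> c k < c l" "\<And>k. k < d \<Longrightarrow> c k < 2 * d"
    and N: "d < N" and \<pi>: "\<pi> permutes {0..<d}" "\<pi> \<noteq> id"
  shows "(\<Sum>k = 0..<d. N ^ (2 * d * \<pi> k + c k)) < (\<Sum>k = 0..<d. N ^ (2 * d * k + c k))"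
proof -
  let ?M = "{k. k < d \<and> \<pi> k \<noteq> k}"
  define m where "m = Max ?M"
  have "?M \<noteq> {}"
  proof
    assume "?M = {}"
    then have "\<pi> k = k" for k using permutes_not_in[OF \<pi>(1), of k] by (cases "k < d") auto
    then show False using \<pi>(2) by auto
  qed
  then have m: "m < d" "\<pi> m \<noteq> m" and fix_above: "\<And>k. m < k \<Longrightarrow> \<pi> k = k"
  proof -
    have "m \<in> ?M" unfolding m_def by (rule Max_in) (use \<open>?M \<noteq> {}\<close> in auto)
    then show "m < d" "\<pi> m \<noteq> m" by auto
    fix k assume "m < k"
    show "\<pi> k = k"
    proof (rule ccontr)
      assume "\<pi> k \<noteq> k"
      then have "k < d" using permutes_not_in[OF \<pi>(1), of k] by fastforce
      then have "k \<le> m" unfolding m_def using \<open>\<pi> k \<noteq> k\<close> by (intro Max_ge) auto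
      then show False using \<open>m < k\<close> by simp
    qed
  qed
  have below: "\<pi> k \<le> m" if "k \<le> m" for k
  proof (rule ccontr)
    assume "\<not> \<pi> k \<le> m"
    then have "\<pi> (\<pi> k) = \<pi> k" by (intro fix_above) simp
    then have "\<pi> k = k" using permutes_inj[OF \<pi>(1)] by (simp add: inj_eq)
    then show False using that \<open>\<not> \<pi> k \<le> m\<close> by simp
  qed
  define E where "E = 2 * d * m + c m"
  have lt: "2 * d * \<pi> k + c k < E" if k: "k \<le> m" for k
  proof (cases "\<pi> k = m")
    case True
    then have "k < m" using k m(2) by (cases "k = m") auto
    then show ?thesis using c(1)[of k m] m(1) True by (simp add: E_def)
  next
    case False
    then have "Suc (\<pi> k) \<le> m" using below[OF k] by simp
    then have "2 * d * Suc (\<pi> k) \<le> 2 * d * m" by (intro mult_le_mono2)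
    then show ?thesis using c(2)[of k] k m(1) by (simp add: E_def)
  qed
  have le: "2 * d * \<pi> k + c k \<le> E - 1" if "k < Suc m" for k using lt[of k] that by linarith
  have Epos: "0 < E" using lt[of m] by simp
  have N1: "1 \<le> N" using N by simp
  have "(\<Sum>k = 0..<Suc m. N ^ (2 * d * \<pi> k + c k)) \<le> (\<Sum>k = 0..<Suc m. N ^ (E - 1))"
    by (intro sum_mono power_increasing N1) (use le in auto)
  also have "\<dots> = Suc m * N ^ (E - 1)" by simp
  also have "\<dots> < N * N ^ (E - 1)" using m(1) N by (intro mult_strict_right_mono) auto
  also have "\<dots> = N ^ E" using Epos by (metis Suc_diff_1 power_Suc)
  also have "\<dots> \<le> (\<Sum>k = 0..<Suc m. N ^ (2 * d * k + c k))" by (simp add: E_def)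
  finally have 1: "(\<Sum>k = 0..<Suc m. N ^ (2 * d * \<pi> k + c k)) < (\<Sum>k = 0..<Suc m. N ^ (2 * d * k + c k))" .
  have split: "(\<Sum>k = 0..<d. h k) = (\<Sum>k = 0..<Suc m. h k) + (\<Sum>k = Suc m..<d. h k)" for h :: "nat \<Rightarrow> nat"
    using m(1) by (intro sum.atLeastLessThan_concat[symmetric]) auto
  have 2: "(\<Sum>k = Suc m..<d. N ^ (2 * d * \<pi> k + c k)) = (\<Sum>k = Suc m..<d. N ^ (2 * d * k + c k))"
    by (intro sum.cong refl) (simp add: fix_above)
  show ?thesis unfolding split 2 using 1 by simp
qed

definition column_exponent :: "nat \<Rightarrow> nat \<Rightarrow> nat list \<Rightarrow> nat" where
  "column_exponent d N c = (\<Sum>k = 0..<d. N ^ (2 * d * k + c ! k))"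

text \<open>Substituting \<open>x^(N^(2 d j + k))\<close> for the entry \<open>(j, k)\<close> separates all leading (diagonal) monomials.\<close>
lemma minor_monomial_curve:
  assumes "length c = d" "sorted_wrt (<) c" "set c \<subseteq> {..<2 * d}" "d < N"
  obtains p where "degree p = column_exponent d N c" "lead_coeff p = 1"
    "\<And>x. minor d (\<lambda>j k. x ^ (N ^ (2 * d * j + k))) (nth c) = poly p x"
proof -
  define ex where "ex \<pi> = (\<Sum>k = 0..<d. N ^ (2 * d * \<pi> k + c ! k))" for \<pi>
  define E where "E = column_exponent d N c"
  let ?P = "{\<pi>. \<pi> permutes {0..<d}}"
  define p :: "complex poly" where "p = (\<Sum>\<pi>\<in>?P. monom (of_int (sign \<pi>)) (ex \<pi>))"
  have less: "ex \<pi> < E" if "\<pi> \<in> ?P - {id}" for \<pi>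
    unfolding ex_def E_def column_exponent_def
  proof (rule diagonal_exponent_max)
    show "c ! k < c ! l" if "k < l" "l < d" for k l using that assms by (simp add: sorted_wrt_iff_nth_less)
    show "c ! k < 2 * d" if "k < d" for k using column_entry_bound[of d c "[]" k] that assms by (simp add: tableau_def)
  qed (use assms that in auto)
  have fin: "finite ?P" by (rule finite_permutations) simp
  have id: "id \<in> ?P" by (simp add: permutes_id)
  have exid: "ex id = E" by (simp add: ex_def E_def column_exponent_def)
  have "coeff p E = (\<Sum>\<pi>\<in>?P. if \<pi> = id then 1 else 0)"
    unfolding p_def coeff_sum coeff_monom
    by (intro sum.cong refl) (use less exid in force)
  then have cE: "coeff p E = 1" using fin id by (simp add: sum.delta)
  have "degree p \<le> E" unfolding p_def
  proof (intro degree_sum_le fin)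
    fix \<pi> assume "\<pi> \<in> ?P"
    then have "ex \<pi> \<le> E" using less[of \<pi>] exid by (cases "\<pi> = id") auto
    then show "degree (monom (of_int (sign \<pi>) :: complex) (ex \<pi>)) \<le> E" by (meson degree_monom_le order_trans)
  qed
  then have deg: "degree p = E" using cE le_degree[of p E] by simp
  show thesis
  proof (rule that[of p])
    show "degree p = column_exponent d N c" using deg by (simp add: E_def)
    show "lead_coeff p = 1" using cE by (simp add: deg)
    fix x :: complex
    show "minor d (\<lambda>j k. x ^ (N ^ (2 * d * j + k))) (nth c) = poly p x"
      unfolding minor_leibniz p_def poly_sum poly_monom ex_def by (simp add: power_sum)
  qed
qed

lemma minor_prod_monomial_curve:
  assumes "tableau d T" "\<forall>c \<in> set T. sorted_wrt (<) c" "set (concat T) \<subseteq> {..<2 * d}" "d < N"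
  shows "\<exists>p. degree p = sum_list (map (column_exponent d N) T) \<and> lead_coeff p = 1 \<and>
    (\<forall>x. minor_prod d (\<lambda>j k. x ^ (N ^ (2 * d * j + k))) T = poly p x)"
  using assms(1-3)
proof (induction T)
  case Nil
  show ?case by (intro exI[of _ 1]) simp
next
  case (Cons c T)
  then obtain p where p: "degree p = sum_list (map (column_exponent d N) T)" "lead_coeff p = 1"
    "\<And>x. minor_prod d (\<lambda>j k. x ^ (N ^ (2 * d * j + k))) T = poly p x"
    by (auto simp: tableau_def)
  obtain q where q: "degree q = column_exponent d N c" "lead_coeff q = 1"
    "\<And>x. minor d (\<lambda>j k. x ^ (N ^ (2 * d * j + k))) (nth c) = poly q x"
    using minor_monomial_curve[of c d N] Cons.prems assms(4) by (auto simp: tableau_def)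
  have "p \<noteq> 0" "q \<noteq> 0" using p(2) q(2) by auto
  then have "degree (q * p) = sum_list (map (column_exponent d N) (c # T))"
    using p(1) q(1) by (simp add: degree_mult_eq)
  moreover have "lead_coeff (q * p) = 1" unfolding lead_coeff_mult p(2) q(2) by simp
  ultimately show ?case using p(3) q(3) by (intro exI[of _ "q * p"]) simp
qed

text \<open>The digit position \<open>e\<close> encodes a row \<open>e div (2 * d)\<close> and a
  value \<open>e mod (2 * d)\<close>. Summed over the columns, the digit becomes the multiplicity of
  that value in that row.\<close>

lemma column_exponent_digits:
  assumes "length c = d" "set c \<subseteq> {..<2 * d}"
  shows "column_exponent d N c = (\<Sum>e<2 * d * d. of_bool (c ! (e div (2 * d)) = e mod (2 * d)) * N ^ e)"
proof -
  let ?S = "(\<lambda>k. 2 * d * k + c ! k) ` {0..<d}"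
  have ck: "c ! k < 2 * d" if "k < d" for k using column_entry_bound[of d c "[]" k] that assms by (simp add: tableau_def)
  have q: "(2 * d * k + c ! k) div (2 * d) = k" if "k < d" for k using ck[OF that] that by simp
  have inj: "inj_on (\<lambda>k. 2 * d * k + c ! k) {0..<d}"
  proof (rule inj_onI)
    fix k l assume "k \<in> {0..<d}" "l \<in> {0..<d}" "2 * d * k + c ! k = 2 * d * l + c ! l"
    then show "k = l"
      using q by (metis atLeastLessThan_iff)
  qed
  have S: "?S = {e. e < 2 * d * d \<and> c ! (e div (2 * d)) = e mod (2 * d)}"
  proof (rule equalityI; rule subsetI)
    fix e assume "e \<in> ?S"
    then obtain k where k: "k < d" "e = 2 * d * k + c ! k" by auto
    have "2 * d * Suc k \<le> 2 * d * d" using k by (intro mult_le_mono2) simp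
    then show "e \<in> {e. e < 2 * d * d \<and> c ! (e div (2 * d)) = e mod (2 * d)}"
      using k ck[OF k(1)] by auto
  next
    fix e assume e: "e \<in> {e. e < 2 * d * d \<and> c ! (e div (2 * d)) = e mod (2 * d)}"
    then have "e div (2 * d) < d" by (simp add: less_mult_imp_div_less mult.commute)
    moreover have "e = 2 * d * (e div (2 * d)) + c ! (e div (2 * d))" using e by simp
    ultimately show "e \<in> ?S" by (metis (no_types, lifting) atLeast0LessThan image_eqI lessThan_iff)
  qed
  have "column_exponent d N c = sum (\<lambda>e. N ^ e) ?S"
    unfolding column_exponent_def by (subst sum.reindex[OF inj]) simp
  also have "\<dots> = (\<Sum>e<2 * d * d. of_bool (c ! (e div (2 * d)) = e mod (2 * d)) * N ^ e)"
    unfolding S by (rule sum.mono_neutral_cong_left) auto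
  finally show ?thesis .
qed

lemma tableau_exponent_digits:
  assumes "tableau d T" "set (concat T) \<subseteq> {..<2 * d}"
  shows "sum_list (map (column_exponent d N) T) =
    (\<Sum>e<2 * d * d. count_list (map (\<lambda>c. c ! (e div (2 * d))) T) (e mod (2 * d)) * N ^ e)"
  using assms
proof (induction T)
  case (Cons c T)
  have "count_list (map (\<lambda>c. c ! (e div (2 * d))) (c # T)) (e mod (2 * d)) =
      of_bool (c ! (e div (2 * d)) = e mod (2 * d)) + count_list (map (\<lambda>c. c ! (e div (2 * d))) T) (e mod (2 * d))" for e
    by simp
  then show ?case
    using Cons column_exponent_digits[of c d N] by (simp add: tableau_def sum.distrib add_mult_distrib del: count_list.simps)
qed simp

text \<open>Since \<open>N\<close> exceeds the number of columns there are no carries, so the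
  exponent determines the multiplicity of every value in every row; a weakly increasing row is
  determined by these.\<close>

lemma standard_determined_by_exponent:
  assumes T: "standard d T" "set (concat T) \<subseteq> {..<2 * d}" "length T < N"
    and T': "standard d T'" "set (concat T') \<subseteq> {..<2 * d}" "length T' = length T"
    and eq: "sum_list (map (column_exponent d N) T) = sum_list (map (column_exponent d N) T')"
  shows "T = T'"
proof -
  have tab: "tableau d T" "tableau d T'" using T(1) T'(1) by (auto simp: standard_def)
  have cnt: "count_list (map (\<lambda>c. c ! k) T) v = count_list (map (\<lambda>c. c ! k) T') v" if k: "k < d" and v: "v < 2 * d" for k v
  proof -
    let ?e = "2 * d * k + v"
    have le: "count_list (map f S) u < N" if "length S = length T" for f :: "nat list \<Rightarrow> nat" and S u
      using count_le_length[of "map f S" u] that T(3) by simp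
    have "2 * d * Suc k \<le> 2 * d * d" using k by (intro mult_le_mono2) simp
    then have e: "?e < 2 * d * d" using v by simp
    have "count_list (map (\<lambda>c. c ! (?e div (2 * d))) T) (?e mod (2 * d)) =
        count_list (map (\<lambda>c. c ! (?e div (2 * d))) T') (?e mod (2 * d))"
      by (rule digits_unique[where n = "2 * d * d" and N = N and e = ?e
            and f = "\<lambda>e. count_list (map (\<lambda>c. c ! (e div (2 * d))) T) (e mod (2 * d))"
            and g = "\<lambda>e. count_list (map (\<lambda>c. c ! (e div (2 * d))) T') (e mod (2 * d))", OF _ _ _ e])
         (use le T'(3) eq tableau_exponent_digits[OF tab(1) T(2)] tableau_exponent_digits[OF tab(2) T'(2)] in auto)
    then show ?thesis using v by simp
  qed
  have row: "map (\<lambda>c. c ! k) T = map (\<lambda>c. c ! k) T'" if k: "k < d" for k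
  proof -
    have bound: "x < 2 * d" if "x \<in> set (map (\<lambda>c. c ! k) S)" "tableau d S" "set (concat S) \<subseteq> {..<2 * d}" for x S
    proof -
      obtain c where "c \<in> set S" "x = c ! k" using \<open>x \<in> set (map _ S)\<close> by auto
      moreover from this have "x \<in> set c" using that(2) k by (simp add: tableau_def)
      ultimately show ?thesis using that(3) by auto
    qed
    have "count_list (map (\<lambda>c. c ! k) T) v = count_list (map (\<lambda>c. c ! k) T') v" for v
    proof (cases "v < 2 * d")
      case False
      then have "v \<notin> set (map (\<lambda>c. c ! k) T)" "v \<notin> set (map (\<lambda>c. c ! k) T')"
        using bound[OF _ tab(1) T(2)] bound[OF _ tab(2) T'(2)] by blast+
      then show ?thesis by (metis count_notin)
    qed (use cnt[OF k] in simp)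
    then have "mset (map (\<lambda>c. c ! k) T) = mset (map (\<lambda>c. c ! k) T')"
      by (metis count_mset multiset_eqI)
    then show ?thesis
      using standard_rows_sorted[OF T(1) k] standard_rows_sorted[OF T'(1) k] by (metis properties_for_sort)
  qed
  show ?thesis
  proof (rule nth_equalityI)
    fix j assume j: "j < length T"
    show "T ! j = T' ! j"
    proof (rule nth_equalityI)
      show "length (T ! j) = length (T' ! j)" using tab j T'(3) by (simp add: tableau_def)
      fix k assume "k < length (T ! j)"
      then have "k < d" using tab j by (simp add: tableau_def)
      from arg_cong[OF row[OF this], of "\<lambda>l. l ! j"] show "T ! j ! k = T' ! j ! k" using j T'(3) by simp
    qed
  qed (use T'(3) in simp)
qed

text \<open>Among the tableaux with nonzero coefficient the one with the largest exponent is unique,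
  and its monic leading term along the curve cannot cancel.\<close>

lemma minor_prods_independent:
  assumes fin: "finite F"
    and F: "\<And>T. T \<in> F \<Longrightarrow> standard d T \<and> set (concat T) \<subseteq> {..<2 * d} \<and> length T = m"
    and van: "\<And>Y. (\<Sum>T\<in>F. c T * minor_prod d Y T) = 0"
    and T0: "T0 \<in> F"
  shows "c T0 = 0"
proof (rule ccontr)
  assume "c T0 \<noteq> 0"
  \<comment> \<open>\<open>N\<close> has to exceed \<open>d\<close> for the diagonal term to
    dominate, and \<open>m\<close> for the digits not to carry.\<close>
  define N where "N = Suc (d + m)"
  define E where "E T = sum_list (map (column_exponent d N) T)" for T
  have "\<exists>p. degree p = E T \<and> lead_coeff p = 1 \<and>
    (\<forall>x. minor_prod d (\<lambda>j k. x ^ (N ^ (2 * d * j + k))) T = poly p x)" if "T \<in> F" for T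
    unfolding E_def using F[OF that] by (intro minor_prod_monomial_curve) (auto simp: standard_def N_def)
  then obtain p where p: "\<And>T. T \<in> F \<Longrightarrow> degree (p T) = E T" "\<And>T. T \<in> F \<Longrightarrow> lead_coeff (p T) = 1"
    "\<And>T x. T \<in> F \<Longrightarrow> minor_prod d (\<lambda>j k. x ^ (N ^ (2 * d * j + k))) T = poly (p T) x"
    by metis
  define F' where "F' = {T \<in> F. c T \<noteq> 0}"
  have "E ` F' \<noteq> {}" "finite (E ` F')" using T0 \<open>c T0 \<noteq> 0\<close> fin by (auto simp: F'_def)
  then obtain T1 where T1: "T1 \<in> F'" "E T1 = Max (E ` F')" using Max_in by (metis imageE)
  have max: "E T \<le> E T1" if "T \<in> F'" for T
    unfolding T1(2) using that fin by (intro Max_ge) (auto simp: F'_def)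
  have inj: "E T \<noteq> E T1" if "T \<in> F'" "T \<noteq> T1" for T
  proof
    assume "E T = E T1"
    moreover have "T \<in> F" "T1 \<in> F" using that T1 by (auto simp: F'_def)
    ultimately have "T = T1"
      using F[of T] F[of T1] by (intro standard_determined_by_exponent[of d T N T1]) (auto simp: E_def N_def)
    then show False using that by simp
  qed
  have "poly (\<Sum>T\<in>F. smult (c T) (p T)) x = 0" for x
    using van[of "\<lambda>j k. x ^ (N ^ (2 * d * j + k))"] p(3) by (simp add: poly_sum cong: sum.cong)
  then have "(\<Sum>T\<in>F. smult (c T) (p T)) = 0" by (simp add: poly_all_0_iff_0[symmetric])
  then have "0 = coeff (\<Sum>T\<in>F. smult (c T) (p T)) (E T1)" by simp
  also have "\<dots> = (\<Sum>T\<in>F. c T * coeff (p T) (E T1))" by (simp add: coeff_sum)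
  also have "\<dots> = (\<Sum>T\<in>F. if T = T1 then c T1 else 0)"
  proof (intro sum.cong refl)
    fix T assume T: "T \<in> F"
    show "c T * coeff (p T) (E T1) = (if T = T1 then c T1 else 0)"
    proof (cases "T \<in> F' \<and> T \<noteq> T1")
      case True
      then have "E T < E T1" using max[of T] inj[of T] by simp
      then show ?thesis using p(1)[OF T] True by (simp add: coeff_eq_0)
    next
      case False
      then show ?thesis using T p(1)[OF T] p(2)[OF T] by (cases "T = T1") (auto simp: F'_def)
    qed
  qed
  also have "\<dots> = c T1" using T1 fin by (simp add: F'_def)
  finally show False using T1 by (simp add: F'_def)
qed

lemma finite_good_tableaux: "finite (good_tableaux d r s)"
  by (rule finite_subset[OF _ finite_standard_tableaux[of d "r + s"]])
     (auto simp: good_tableaux_def standard_tableaux_def)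

text \<open>On U(d) the denominator \<open>det U ^ s\<close> is nonzero and can be multiplied away;
  density passes to arbitrary arrays, where the leading terms decide.\<close>

lemma tableau_fun_independent:
  assumes van: "(\<Sum>T\<in>good_tableaux d r s. fun_scale (c T) (tableau_fun d s T)) = 0"
    and T0: "T0 \<in> good_tableaux d r s"
  shows "c T0 = 0"
proof (rule minor_prods_independent[OF finite_good_tableaux _ _ T0])
  have G: "standard d T \<and> set (concat T) \<subseteq> {..<2 * d} \<and> length T = r + s" if "T \<in> good_tableaux d r s" for T
    using that by (simp add: good_tableaux_def)
  then show "standard d T \<and> set (concat T) \<subseteq> {..<2 * d} \<and> length T = r + s" if "T \<in> good_tableaux d r s" for T
    using that by blast
  fix Y
  show "(\<Sum>T\<in>good_tableaux d r s. c T * minor_prod d Y T) = 0"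
  proof (rule unitary_zariski_dense[where m = "r + s"])
    fix U assume U: "U \<in> unitary_group d"
    have "0 = (\<Sum>T\<in>good_tableaux d r s. fun_scale (c T) (tableau_fun d s T)) U" unfolding van by simp
    also have "\<dots> = (\<Sum>T\<in>good_tableaux d r s. c T * minor_prod d (stack_id d U) T) / det U ^ s"
      using U by (simp add: sum_fun_apply fun_scale_def tableau_fun_def sum_divide_distrib)
    finally show "(\<Sum>T\<in>good_tableaux d r s. c T * minor_prod d (stack_id d U) T) = 0"
      using unitary_det_nonzero[OF U] by simp
  qed (use G in \<open>auto simp: standard_def\<close>)
qed

lemma dim_Hom_U_eq_card:
  assumes "d > 0"
  shows "fun_vs.dim (Hom_U d r s) = card (good_tableaux d r s)"
proof -
  let ?S = "good_tableaux d r s" and ?f = "tableau_fun d s"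
  have inj: "inj_on ?f ?S"
  proof (rule inj_onI, rule ccontr)
    fix T T' assume T: "T \<in> ?S" "T' \<in> ?S" "?f T = ?f T'" "T \<noteq> T'"
    define c :: "nat list list \<Rightarrow> complex" where "c S = (if S = T then 1 else if S = T' then -1 else 0)" for S
    have "(\<Sum>S\<in>?S. fun_scale (c S) (?f S)) = (\<Sum>S\<in>{T, T'}. fun_scale (c S) (?f S))"
      using T finite_good_tableaux by (intro sum.mono_neutral_right) (auto simp: c_def fun_scale_def fun_eq_iff)
    also have "\<dots> = 0" using T(3,4) by (auto simp: c_def fun_scale_def fun_eq_iff)
    finally have "c T = 0" using T(1) by (rule tableau_fun_independent)
    then show False by (simp add: c_def)
  qed
  have "fun_vs.independent (?f ` ?S)"
  proof (rule fun_vs.independent_if_scalars_zero)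
    fix u g assume u: "(\<Sum>x\<in>?f ` ?S. fun_scale (u x) x) = 0" "g \<in> ?f ` ?S"
    then obtain T where T: "T \<in> ?S" "g = ?f T" by auto
    have "(\<Sum>T\<in>?S. fun_scale (u (?f T)) (?f T)) = 0"
      using u(1) by (subst (asm) sum.reindex[OF inj]) (simp add: o_def)
    then show "u g = 0" unfolding T(2) using T(1) by (rule tableau_fun_independent)
  qed (simp add: finite_good_tableaux)
  then have "fun_vs.dim (fun_vs.span (?f ` ?S)) = card (?f ` ?S)" by (rule fun_vs.dim_span_eq_card_independent)
  then show ?thesis using card_image[OF inj] by (simp add: Hom_U_eq_span_tableaux[OF assms])
qed

section \<open>Counting Gelfand--Tsetlin patterns\<close>

text \<open>This is the Vandermonde determinant in the basis of falling factorials, with the degrees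
  decreasing from left to right.\<close>

lemma falling_factorial_det:
  fixes x :: "nat \<Rightarrow> real"
  shows "det (mat n n (\<lambda>(i, j). \<Prod>t<n - 1 - j. (x i - real t))) = (\<Prod>j<n. \<Prod>i<j. (x i - x j))"
proof (induction n)
  case 0
  show ?case by simp
next
  case (Suc n)
  define ff where "ff y k = (\<Prod>t<k. (y - real t))" for y k
  define A where "A = mat (Suc n) (Suc n) (\<lambda>(i, j). ff (x i) (n - j))"
  \<comment> \<open>From column \<open>j\<close> the next one is subtracted
    \<open>x n - (n - 1 - j)\<close> times. The entry in column \<open>j\<close> is the next one
    times \<open>x i - (n - 1 - j)\<close>, so a factor \<open>x i - x n\<close> remains, and the
    last row becomes a unit vector.\<close>
  define E where "E = mat (Suc n) (Suc n) (\<lambda>(l, j). if l = j then 1 else if l = Suc j then real (n - l) - x n else 0)"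
  have AE: "A * E = mat (Suc n) (Suc n) (\<lambda>(i, j). if j < n then (x i - x n) * ff (x i) (n - 1 - j) else 1)"
    (is "_ = ?B")
  proof (rule eq_matI)
    fix i j assume "i < dim_row ?B" "j < dim_col ?B"
    then have ij: "i < Suc n" "j < Suc n" by auto
    have "(A * E) $$ (i, j) = (\<Sum>l = 0..<Suc n. ff (x i) (n - l) *
        (if l = j then 1 else if l = Suc j then real (n - l) - x n else 0))"
      using ij by (simp add: A_def E_def scalar_prod_def)
    also have "\<dots> = (\<Sum>l = 0..<Suc n. (if l = j then ff (x i) (n - j) else 0) +
        (if l = Suc j then ff (x i) (n - Suc j) * (real (n - Suc j) - x n) else 0))"
      by (intro sum.cong) auto
    also have "\<dots> = ff (x i) (n - j) + (if j < n then ff (x i) (n - Suc j) * (real (n - Suc j) - x n) else 0)"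
      using ij by (simp add: sum.distrib del: sum.op_ivl_Suc)
    also have "\<dots> = ?B $$ (i, j)"
    proof (cases "j < n")
      case True
      then have "ff (x i) (n - j) = ff (x i) (n - Suc j) * (x i - real (n - Suc j))"
        unfolding ff_def by (metis Suc_diff_Suc prod.lessThan_Suc)
      then show ?thesis using ij True by (simp add: algebra_simps)
    next
      case False
      then show ?thesis using ij by (simp add: ff_def)
    qed
    finally show "(A * E) $$ (i, j) = ?B $$ (i, j)" .
  qed (simp_all add: A_def E_def)
  have "det E = prod_list (diag_mat E)"
    by (rule det_lower_triangular[of "Suc n"]) (auto simp: E_def)
  also have "diag_mat E = replicate (Suc n) 1"
    by (rule nth_equalityI) (auto simp: diag_mat_def E_def simp del: upt_Suc replicate_Suc)
  also have "prod_list \<dots> = (1 :: real)" by simp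
  finally have "det A = det ?B" using det_mult[of A "Suc n" E] AE by (simp add: A_def E_def)
  also have "\<dots> = (\<Sum>j<Suc n. ?B $$ (n, j) * cofactor ?B n j)"
    by (rule laplace_expansion_row) auto
  also have "\<dots> = (\<Sum>j<Suc n. if j = n then cofactor ?B n n else 0)"
    by (intro sum.cong) auto
  also have "\<dots> = det (mat_delete ?B n n)" by (simp add: cofactor_def)
  also have "mat_delete ?B n n = mat n n (\<lambda>(i, j). (x i - x n) * ff (x i) (n - 1 - j))"
    by (rule eq_matI) (auto simp: mat_delete_def)
  also have "det \<dots> = (\<Sum>\<pi> | \<pi> permutes {0..<n}. of_int (sign \<pi>) * (\<Prod>i = 0..<n. (x i - x n) * ff (x i) (n - 1 - \<pi> i)))"
    by (subst det_def'[of _ n]) (auto intro!: sum.cong prod.cong dest: permutes_bound)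
  also have "\<dots> = (\<Prod>i = 0..<n. (x i - x n)) *
      (\<Sum>\<pi> | \<pi> permutes {0..<n}. of_int (sign \<pi>) * (\<Prod>i = 0..<n. ff (x i) (n - 1 - \<pi> i)))"
    by (simp add: prod.distrib sum_distrib_left mult_ac)
  also have "(\<Sum>\<pi> | \<pi> permutes {0..<n}. of_int (sign \<pi>) * (\<Prod>i = 0..<n. ff (x i) (n - 1 - \<pi> i))) =
      det (mat n n (\<lambda>(i, j). ff (x i) (n - 1 - j)))"
    by (subst det_def'[of _ n]) (auto intro!: sum.cong prod.cong dest: permutes_bound)
  also have "\<dots> = (\<Prod>j<n. \<Prod>i<j. (x i - x j))" using Suc.IH by (simp add: ff_def)
  finally show ?case by (simp add: A_def ff_def atLeast0LessThan mult.commute)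
qed

definition binomial_det :: "nat \<Rightarrow> (nat \<Rightarrow> nat) \<Rightarrow> real" where
  "binomial_det n l = det (mat n n (\<lambda>(i, j). real (l i choose (n - 1 - j))))"

lemma binomial_det_leibniz:
  "binomial_det n l = (\<Sum>\<pi> | \<pi> permutes {0..<n}. of_int (sign \<pi>) * (\<Prod>i = 0..<n. real (l i choose (n - 1 - \<pi> i))))"
  unfolding binomial_det_def
  by (subst det_def'[of _ n]) (auto intro!: sum.cong prod.cong dest: permutes_bound)

text \<open>Each binomial is a falling factorial over a factorial, and the product of the factorials
  0!, ..., (n-1)! equals that of all differences \<open>j - i\<close>.\<close>

lemma binomial_det_eq_prod:
  "binomial_det n l = (\<Prod>j<n. \<Prod>i<j. (real (l i) - real (l j)) / (real j - real i))"
proof -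
  define c where "c = (\<Prod>j = 0..<n. fact (n - 1 - j) :: real)"
  have bin: "real (a choose k) = (\<Prod>t<k. (real a - real t)) / fact k" for a k
    by (simp add: binomial_gbinomial gbinomial_prod_rev atLeast0LessThan)
  have "binomial_det n l = (\<Sum>\<pi> | \<pi> permutes {0..<n}. of_int (sign \<pi>) *
      (\<Prod>i = 0..<n. \<Prod>t<n - 1 - \<pi> i. (real (l i) - real t))) / c"
    unfolding binomial_det_leibniz sum_divide_distrib
  proof (intro sum.cong refl)
    fix \<pi> assume "\<pi> \<in> {\<pi>. \<pi> permutes {0..<n}}"
    then have "(\<Prod>i = 0..<n. fact (n - 1 - \<pi> i) :: real) = c"
      unfolding c_def by (intro prod.permute[symmetric, unfolded o_def]) auto
    then show "of_int (sign \<pi>) * (\<Prod>i = 0..<n. real (l i choose (n - 1 - \<pi> i))) =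
        of_int (sign \<pi>) * (\<Prod>i = 0..<n. \<Prod>t<n - 1 - \<pi> i. (real (l i) - real t)) / c"
      unfolding bin by (simp add: prod_dividef)
  qed
  also have "(\<Sum>\<pi> | \<pi> permutes {0..<n}. of_int (sign \<pi>) *
      (\<Prod>i = 0..<n. \<Prod>t<n - 1 - \<pi> i. (real (l i) - real t))) =
      det (mat n n (\<lambda>(i, j). \<Prod>t<n - 1 - j. (real (l i) - real t)))"
    by (subst det_def'[of _ n]) (auto intro!: sum.cong prod.cong dest: permutes_bound)
  also have "\<dots> = (\<Prod>j<n. \<Prod>i<j. (real (l i) - real (l j)))" by (rule falling_factorial_det)
  also have "c = (\<Prod>j<n. fact j)"
    unfolding c_def atLeast0LessThan using prod.nat_diff_reindex[of "\<lambda>j. fact j :: real" n] by simp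
  also have "(\<Prod>j<n. fact j :: real) = (\<Prod>j<n. \<Prod>i<j. (real j - real i))"
  proof (intro prod.cong refl)
    fix j
    have "(\<Prod>i<j. (real j - real i)) = (\<Prod>i<j. real (j - i))" by (intro prod.cong) (auto simp: of_nat_diff)
    also have "\<dots> = fact j" by (simp add: fact_prod_rev atLeast0LessThan)
    finally show "fact j = (\<Prod>i<j. (real j - real i))" by simp
  qed
  finally show ?thesis by (simp add: prod_dividef)
qed

text \<open>Subtracting from every row the next one turns the constant last column into a unit vector.\<close>
lemma binomial_det_Suc:
  "binomial_det (Suc n) l = det (mat n n (\<lambda>(i, j). real (l i choose (n - j)) - real (l (Suc i) choose (n - j))))"
proof -
  define A where "A = mat (Suc n) (Suc n) (\<lambda>(i, j). real (l i choose (n - j)))"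
  define E where "E = mat (Suc n) (Suc n) (\<lambda>(i, k). if k = i then 1 else if k = Suc i then -1 else (0 :: real))"
  have EA: "E * A = mat (Suc n) (Suc n) (\<lambda>(i, j). real (l i choose (n - j)) -
      (if i < n then real (l (Suc i) choose (n - j)) else 0))" (is "_ = ?B")
  proof (rule eq_matI)
    fix i j assume "i < dim_row ?B" "j < dim_col ?B"
    then have ij: "i < Suc n" "j < Suc n" by auto
    have "(E * A) $$ (i, j) = (\<Sum>k = 0..<Suc n. (if k = i then 1 else if k = Suc i then -1 else 0) * real (l k choose (n - j)))"
      using ij by (simp add: A_def E_def scalar_prod_def)
    also have "\<dots> = (\<Sum>k = 0..<Suc n. (if k = i then real (l i choose (n - j)) else 0) +
        (if k = Suc i then - real (l (Suc i) choose (n - j)) else 0))"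
      by (intro sum.cong) auto
    also have "\<dots> = ?B $$ (i, j)"
      using ij by (simp add: sum.distrib del: sum.op_ivl_Suc)
    finally show "(E * A) $$ (i, j) = ?B $$ (i, j)" .
  qed (simp_all add: A_def E_def)
  have "det E = prod_list (diag_mat E)"
    by (rule det_upper_triangular[of _ "Suc n"]) (auto simp: E_def)
  also have "diag_mat E = replicate (Suc n) 1"
    by (rule nth_equalityI) (auto simp: diag_mat_def E_def simp del: upt_Suc replicate_Suc)
  also have "prod_list \<dots> = (1 :: real)" by simp
  finally have "det A = det ?B" using det_mult[of E "Suc n" A] EA by (simp add: A_def E_def)
  also have "\<dots> = (\<Sum>i<Suc n. ?B $$ (i, n) * cofactor ?B i n)"
    by (rule laplace_expansion_column) auto
  also have "\<dots> = (\<Sum>i<Suc n. if i = n then cofactor ?B n n else 0)"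
    by (intro sum.cong) auto
  also have "\<dots> = det (mat_delete ?B n n)" by (simp add: cofactor_def)
  also have "mat_delete ?B n n = mat n n (\<lambda>(i, j). real (l i choose (n - j)) - real (l (Suc i) choose (n - j)))"
    by (rule eq_matI) (auto simp: mat_delete_def)
  finally show ?thesis by (simp add: A_def binomial_det_def)
qed

lemma sum_choose_interval:
  "(\<Sum>x = a..<b. real (x choose k)) = real (b choose Suc k) - real (a choose Suc k)" if "a \<le> b"
  using that by (induction b rule: dec_induct) auto

text \<open>Row \<open>i\<close> of the determinant depends on \<open>\<nu> i\<close> alone and the
  bounds on the \<open>\<nu> i\<close> are independent, so the sum can be taken row by row. By the
  hockey-stick identity each row becomes the difference of neighbouring rows of the larger
  determinant, as in \<open>binomial_det_Suc\<close>.\<close>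

lemma binomial_det_interlacing:
  assumes dec: "\<And>i. i < n \<Longrightarrow> \<mu> (Suc i) \<le> \<mu> i"
  shows "(\<Sum>\<nu> \<in> (\<Pi>\<^sub>E i\<in>{0..<n}. {\<mu> (Suc i)..\<mu> i}). binomial_det n (\<lambda>i. \<nu> i + (n - 1 - i))) =
    binomial_det (Suc n) (\<lambda>i. \<mu> i + (n - i))"
proof -
  have hockey: "(\<Sum>x = \<mu> (Suc i)..\<mu> i. real ((x + (n - 1 - i)) choose (n - 1 - j))) =
      real ((\<mu> i + (n - i)) choose (n - j)) - real ((\<mu> (Suc i) + (n - Suc i)) choose (n - j))"
    if "i < n" "j < n" for i j
  proof -
    have "(\<Sum>x = \<mu> (Suc i)..\<mu> i. real ((x + (n - 1 - i)) choose (n - 1 - j))) =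
        (\<Sum>y = \<mu> (Suc i) + (n - 1 - i)..<Suc (\<mu> i) + (n - 1 - i). real (y choose (n - 1 - j)))"
      unfolding sum.shift_bounds_nat_ivl atLeastLessThanSuc_atLeastAtMost ..
    also have "\<dots> = real ((Suc (\<mu> i) + (n - 1 - i)) choose Suc (n - 1 - j)) -
        real ((\<mu> (Suc i) + (n - 1 - i)) choose Suc (n - 1 - j))"
      using dec[OF that(1)] by (intro sum_choose_interval) simp
    also have "Suc (n - 1 - j) = n - j" using that by simp
    also have "Suc (\<mu> i) + (n - 1 - i) = \<mu> i + (n - i)" using that by simp
    finally show ?thesis by simp
  qed
  have "(\<Sum>\<nu> \<in> (\<Pi>\<^sub>E i\<in>{0..<n}. {\<mu> (Suc i)..\<mu> i}). binomial_det n (\<lambda>i. \<nu> i + (n - 1 - i))) =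
      (\<Sum>\<pi> | \<pi> permutes {0..<n}. of_int (sign \<pi>) *
        (\<Sum>\<nu> \<in> (\<Pi>\<^sub>E i\<in>{0..<n}. {\<mu> (Suc i)..\<mu> i}). \<Prod>i = 0..<n. real ((\<nu> i + (n - 1 - i)) choose (n - 1 - \<pi> i))))"
    unfolding binomial_det_leibniz sum_distrib_left by (rule sum.swap)
  also have "\<dots> = (\<Sum>\<pi> | \<pi> permutes {0..<n}. of_int (sign \<pi>) *
        (\<Prod>i = 0..<n. \<Sum>x = \<mu> (Suc i)..\<mu> i. real ((x + (n - 1 - i)) choose (n - 1 - \<pi> i))))"
    by (subst prod_sum_PiE) auto
  also have "\<dots> = (\<Sum>\<pi> | \<pi> permutes {0..<n}. of_int (sign \<pi>) *
        (\<Prod>i = 0..<n. (real ((\<mu> i + (n - i)) choose (n - \<pi> i)) - real ((\<mu> (Suc i) + (n - Suc i)) choose (n - \<pi> i)))))"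
    by (intro sum.cong prod.cong refl arg_cong2[of _ _ _ _ "(*)"] hockey) (auto dest: permutes_bound)
  also have "\<dots> = binomial_det (Suc n) (\<lambda>i. \<mu> i + (n - i))"
    unfolding binomial_det_Suc
    by (subst det_def'[of _ n]) (auto intro!: sum.cong prod.cong dest: permutes_bound)
  finally show ?thesis .
qed

text \<open>Partitions are functions on all of \<open>nat\<close>, so that no length has to be
  tracked. Interlacing says that the two diagrams differ by a horizontal strip.\<close>

definition interlace :: "(nat \<Rightarrow> nat) \<Rightarrow> (nat \<Rightarrow> nat) \<Rightarrow> bool" where
  "interlace \<nu> \<mu> \<longleftrightarrow> (\<forall>i. \<mu> (Suc i) \<le> \<nu> i \<and> \<nu> i \<le> \<mu> i)"

text \<open>The number of Gelfand--Tsetlin patterns with \<^term>\<open>n\<close> rows and top row \<^term>\<open>\<mu>\<close>.\<close>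
fun gt_count :: "nat \<Rightarrow> (nat \<Rightarrow> nat) \<Rightarrow> nat" where
  "gt_count 0 \<mu> = of_bool (\<mu> = (\<lambda>_. 0))"
| "gt_count (Suc n) \<mu> = (\<Sum>\<nu> | interlace \<nu> \<mu>. gt_count n \<nu>)"

lemma interlace_decreasing: "interlace \<nu> \<mu> \<Longrightarrow> \<nu> (Suc i) \<le> \<nu> i"
  unfolding interlace_def by (meson le_trans)

lemma finite_interlace:
  assumes "\<And>i. N \<le> i \<Longrightarrow> \<mu> i = 0"
  shows "finite {\<nu>. interlace \<nu> \<mu>}"
proof (rule finite_subset)
  show "{\<nu>. interlace \<nu> \<mu>} \<subseteq> {\<nu>. \<forall>i. (i \<in> {..<N} \<longrightarrow> \<nu> i \<in> {..Max (\<mu> ` {..<N})}) \<and> (i \<notin> {..<N} \<longrightarrow> \<nu> i = 0)}"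
  proof (intro subsetI CollectI allI conjI impI)
    fix \<nu> i assume "\<nu> \<in> {\<nu>. interlace \<nu> \<mu>}"
    then have le: "\<nu> i \<le> \<mu> i" by (simp add: interlace_def)
    show "\<nu> i \<in> {..Max (\<mu> ` {..<N})}" if "i \<in> {..<N}"
      using le that by (auto intro: order_trans Max_ge)
    show "\<nu> i = 0" if "i \<notin> {..<N}" using le that assms[of i] by simp
  qed
  show "finite {\<nu>. \<forall>i. (i \<in> {..<N} \<longrightarrow> \<nu> i \<in> {..Max (\<mu> ` {..<N})}) \<and> (i \<notin> {..<N} \<longrightarrow> \<nu> i = 0)}"
    by (rule finite_set_of_finite_funs) auto
qed

lemma decreasing_le:
  fixes \<mu> :: "nat \<Rightarrow> nat"
  assumes "\<And>i. \<mu> (Suc i) \<le> \<mu> i" "i \<le> j"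
  shows "\<mu> j \<le> \<mu> i"
  using assms lift_Suc_antimono_le by blast

text \<open>A horizontal strip adds at most one part, so \<open>n\<close> steps from the empty
  partition give at most \<open>n\<close> parts.\<close>

lemma gt_count_eq_zero:
  "(\<And>i. \<mu> (Suc i) \<le> \<mu> i) \<Longrightarrow> \<mu> n \<noteq> 0 \<Longrightarrow> gt_count n \<mu> = 0"
proof (induction n arbitrary: \<mu>)
  case (Suc n)
  have "gt_count n \<nu> = 0" if "interlace \<nu> \<mu>" for \<nu>
  proof (rule Suc.IH)
    show "\<nu> (Suc i) \<le> \<nu> i" for i by (rule interlace_decreasing[OF that])
    have "\<mu> (Suc n) \<le> \<nu> n" using that by (simp add: interlace_def)
    then show "\<nu> n \<noteq> 0" using Suc.prems(2) by simp
  qed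
  then show ?case by simp
qed auto

text \<open>Induction over the rows: only the \<open>\<nu>\<close> with \<open>\<nu> n = 0\<close>
  contribute, and they fill exactly the box of \<open>binomial_det_interlacing\<close>.\<close>

lemma gt_count_eq_binomial_det:
  assumes "\<And>i. \<mu> (Suc i) \<le> \<mu> i" "\<mu> n = 0"
  shows "real (gt_count n \<mu>) = binomial_det n (\<lambda>i. \<mu> i + (n - 1 - i))"
  using assms
proof (induction n arbitrary: \<mu>)
  case 0
  then have "\<mu> i = 0" for i using decreasing_le[of \<mu> 0 i] by simp
  then have "\<mu> = (\<lambda>_. 0)" by auto
  then show ?case by (simp add: binomial_det_def)
next
  case (Suc n)
  let ?P = "\<Pi>\<^sub>E i\<in>{0..<n}. {\<mu> (Suc i)..\<mu> i}"
  \<comment> \<open>Functions in the box are undefined outside \<open>{0..<n}\<close>, whereas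
    partitions are continued by zero.\<close>
  let ?ext = "\<lambda>\<nu> i. if i < n then \<nu> i else (0 :: nat)"
  have z: "\<mu> i = 0" if "Suc n \<le> i" for i using decreasing_le[of \<mu> "Suc n" i] Suc.prems that by simp
  have fin: "finite {\<nu>. interlace \<nu> \<mu>}" using z by (rule finite_interlace)
  have inj: "inj_on ?ext ?P"
  proof (rule inj_onI)
    fix \<nu> \<nu>' assume *: "\<nu> \<in> ?P" "\<nu>' \<in> ?P" "?ext \<nu> = ?ext \<nu>'"
    then have "\<nu> i = \<nu>' i" if "i < n" for i using that by (metis)
    then show "\<nu> = \<nu>'" using * by (intro PiE_ext[of \<nu> "{0..<n}" _ \<nu>']) auto
  qed
  have img: "?ext ` ?P = {\<nu>. interlace \<nu> \<mu> \<and> \<nu> n = 0}"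
  proof (rule equalityI; rule subsetI)
    fix \<nu> assume "\<nu> \<in> ?ext ` ?P"
    then obtain f where f: "f \<in> ?P" "\<nu> = ?ext f" by blast
    have "f i \<in> {\<mu> (Suc i)..\<mu> i}" if "i < n" for i using f(1) that by (auto simp: PiE_iff)
    then show "\<nu> \<in> {\<nu>. interlace \<nu> \<mu> \<and> \<nu> n = 0}"
      using f(2) z by (auto simp: interlace_def)
  next
    fix \<nu> assume \<nu>: "\<nu> \<in> {\<nu>. interlace \<nu> \<mu> \<and> \<nu> n = 0}"
    have "\<nu> i = 0" if "n \<le> i" for i
      using \<nu> decreasing_le[of \<nu> n i] interlace_decreasing[of \<nu> \<mu>] that by auto
    then have "\<nu> = ?ext (restrict \<nu> {0..<n})" by auto
    moreover have "restrict \<nu> {0..<n} \<in> ?P" using \<nu> by (auto simp: interlace_def)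
    ultimately show "\<nu> \<in> ?ext ` ?P" by blast
  qed
  have "real (gt_count (Suc n) \<mu>) = (\<Sum>\<nu> | interlace \<nu> \<mu>. real (gt_count n \<nu>))" by simp
  also have "\<dots> = (\<Sum>\<nu> | interlace \<nu> \<mu> \<and> \<nu> n = 0. real (gt_count n \<nu>))"
  proof (rule sum.mono_neutral_right[OF fin]; (rule ballI)?)
    fix \<nu> assume "\<nu> \<in> {\<nu>. interlace \<nu> \<mu>} - {\<nu>. interlace \<nu> \<mu> \<and> \<nu> n = 0}"
    then have "gt_count n \<nu> = 0" using interlace_decreasing[of \<nu> \<mu>] by (intro gt_count_eq_zero) auto
    then show "real (gt_count n \<nu>) = 0" by simp
  qed auto
  also have "\<dots> = (\<Sum>\<nu>\<in>?P. real (gt_count n (?ext \<nu>)))"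
    unfolding img[symmetric] by (subst sum.reindex[OF inj]) simp
  also have "\<dots> = (\<Sum>\<nu>\<in>?P. binomial_det n (\<lambda>i. \<nu> i + (n - 1 - i)))"
  proof (intro sum.cong refl)
    fix \<nu> assume "\<nu> \<in> ?P"
    then have il: "interlace (?ext \<nu>) \<mu>" using img by blast
    have "real (gt_count n (?ext \<nu>)) = binomial_det n (\<lambda>i. ?ext \<nu> i + (n - 1 - i))"
    proof (rule Suc.IH)
      show "?ext \<nu> (Suc i) \<le> ?ext \<nu> i" for i by (rule interlace_decreasing[OF il])
    qed simp
    also have "\<dots> = binomial_det n (\<lambda>i. \<nu> i + (n - 1 - i))"
      unfolding binomial_det_leibniz by (intro sum.cong prod.cong refl arg_cong2[of _ _ _ _ "(*)"]) auto
    finally show "real (gt_count n (?ext \<nu>)) = binomial_det n (\<lambda>i. \<nu> i + (n - 1 - i))" .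
  qed
  also have "\<dots> = binomial_det (Suc n) (\<lambda>i. \<mu> i + (Suc n - 1 - i))"
    using binomial_det_interlacing[of n \<mu>] Suc.prems(1) by simp
  finally show ?case .
qed

text \<open>The differences of the shifted parts \<open>\<mu> i + (n - 1 - i)\<close> are the
  numerators of Weyl's dimension formula.\<close>

lemma gt_count_eq_prod:
  assumes "\<And>i. \<mu> (Suc i) \<le> \<mu> i" "\<mu> n = 0"
  shows "real (gt_count n \<mu>) =
    (\<Prod>(i, j) \<in> {(i, j). i < j \<and> j < n}. (real (\<mu> i) - real (\<mu> j) + real j - real i) / (real j - real i))"
proof -
  have "real (gt_count n \<mu>) = (\<Prod>j<n. \<Prod>i<j. (real (\<mu> i) - real (\<mu> j) + real j - real i) / (real j - real i))"
    unfolding gt_count_eq_binomial_det[of \<mu>, OF assms] binomial_det_eq_prod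
    by (intro prod.cong refl) (auto simp: of_nat_diff)
  also have "\<dots> = (\<Prod>(j, i) \<in> (SIGMA j:{..<n}. {..<j}). (real (\<mu> i) - real (\<mu> j) + real j - real i) / (real j - real i))"
    by (rule prod.Sigma) auto
  also have "\<dots> = (\<Prod>(i, j) \<in> {(i, j). i < j \<and> j < n}. (real (\<mu> i) - real (\<mu> j) + real j - real i) / (real j - real i))"
    by (rule prod.reindex_bij_witness[of _ prod.swap prod.swap]) auto
  finally show ?thesis .
qed

section \<open>Standard tableaux as chains of interlacing partitions\<close>

text \<open>Freezing a chain at its last value makes it a function on \<open>nat\<close> that the
  finite chain determines, so chains can be counted as functions.\<close>

definition lower_chains :: "nat \<Rightarrow> (nat \<Rightarrow> nat) \<Rightarrow> (nat \<Rightarrow> nat \<Rightarrow> nat) set" where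
  "lower_chains n \<mu> = {L. L 0 = (\<lambda>_. 0) \<and> (\<forall>k<n. interlace (L k) (L (Suc k))) \<and> (\<forall>k\<ge>n. L k = \<mu>)}"

text \<open>Cutting off the last step leaves a chain to some \<open>\<nu>\<close> interlacing with
  \<open>\<mu>\<close>, which is the recursion of \<open>gt_count\<close>. Bounded support keeps the
  set of such \<open>\<nu>\<close> finite.\<close>

lemma lower_chains_card:
  "(\<And>i. N \<le> i \<Longrightarrow> \<mu> i = 0) \<Longrightarrow> finite (lower_chains n \<mu>) \<and> card (lower_chains n \<mu>) = gt_count n \<mu>"
proof (induction n arbitrary: \<mu>)
  case 0
  have "lower_chains 0 \<mu> = (if \<mu> = (\<lambda>_. 0) then {\<lambda>_ _. 0} else {})"
    by (auto simp: lower_chains_def)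
  then show ?case by simp
next
  case (Suc n)
  let ?ext = "\<lambda>L k. if k \<le> n then L k else \<mu>"
  let ?N = "{\<nu>. interlace \<nu> \<mu>}"
  have fin: "finite ?N" using Suc.prems by (rule finite_interlace)
  have IH: "finite (lower_chains n \<nu>)" "card (lower_chains n \<nu>) = gt_count n \<nu>" if "\<nu> \<in> ?N" for \<nu>
  proof -
    have "\<nu> i = 0" if "N \<le> i" for i
      using Suc.prems[OF that] \<open>\<nu> \<in> ?N\<close> by (metis interlace_def le_zero_eq mem_Collect_eq)
    then show "finite (lower_chains n \<nu>)" "card (lower_chains n \<nu>) = gt_count n \<nu>" using Suc.IH by blast+
  qed
  have eq: "lower_chains (Suc n) \<mu> = (\<Union>\<nu>\<in>?N. ?ext ` lower_chains n \<nu>)"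
  proof (rule equalityI; rule subsetI)
    fix L assume L: "L \<in> lower_chains (Suc n) \<mu>"
    define L' where "L' k = (if k \<le> n then L k else L n)" for k
    have "L' \<in> lower_chains n (L n)" using L by (auto simp: lower_chains_def L'_def)
    moreover have "L n \<in> ?N" using L by (auto simp: lower_chains_def dest: spec[of _ n])
    moreover have "L = ?ext L'"
    proof
      fix k show "L k = ?ext L' k" using L by (cases "k \<le> n") (auto simp: lower_chains_def L'_def)
    qed
    ultimately show "L \<in> (\<Union>\<nu>\<in>?N. ?ext ` lower_chains n \<nu>)" by blast
  next
    fix L assume "L \<in> (\<Union>\<nu>\<in>?N. ?ext ` lower_chains n \<nu>)"
    then obtain \<nu> L' where *: "interlace \<nu> \<mu>" "L' \<in> lower_chains n \<nu>" "L = ?ext L'" by blast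
    have "interlace (L k) (L (Suc k))" if "k < Suc n" for k
      using * that by (cases "k = n") (auto simp: lower_chains_def)
    then show "L \<in> lower_chains (Suc n) \<mu>" using * by (auto simp: lower_chains_def)
  qed
  have inj: "inj_on ?ext (lower_chains n \<nu>)" for \<nu>
  proof (rule inj_onI, rule ext)
    fix L L' k assume *: "L \<in> lower_chains n \<nu>" "L' \<in> lower_chains n \<nu>" "?ext L = ?ext L'"
    show "L k = L' k"
    proof (cases "k \<le> n")
      case True
      then show ?thesis using fun_cong[OF *(3), of k] by simp
    next
      case False
      then show ?thesis using * by (simp add: lower_chains_def)
    qed
  qed
  have disj: "?ext ` lower_chains n \<nu> \<inter> ?ext ` lower_chains n \<nu>' = {}" if "\<nu> \<noteq> \<nu>'" for \<nu> \<nu>'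
  proof (rule ccontr)
    assume "\<not> ?thesis"
    then obtain L L' where *: "L \<in> lower_chains n \<nu>" "L' \<in> lower_chains n \<nu>'" "?ext L = ?ext L'" by blast
    then have "L n = L' n" using fun_cong[OF *(3), of n] by simp
    then show False using * that by (simp add: lower_chains_def)
  qed
  have "card (lower_chains (Suc n) \<mu>) = (\<Sum>\<nu>\<in>?N. card (?ext ` lower_chains n \<nu>))"
    unfolding eq using fin IH(1) disj by (intro card_UN_disjoint) auto
  also have "\<dots> = gt_count (Suc n) \<mu>"
    using IH(2) by (simp add: card_image[OF inj])
  finally show ?case using fin IH(1) by (simp add: eq)
qed

definition rect :: "nat \<Rightarrow> nat \<Rightarrow> nat \<Rightarrow> nat" where
  "rect d m i = (if i < d then m else 0)"

text \<open>The complement of the diagram in the \<open>d\<close> by \<open>m\<close> rectangle,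
  rotated by 180 degrees.\<close>

definition compl :: "nat \<Rightarrow> nat \<Rightarrow> (nat \<Rightarrow> nat) \<Rightarrow> nat \<Rightarrow> nat" where
  "compl d m \<mu> i = (if i < d then m - \<mu> (d - 1 - i) else 0)"

definition upper_chains :: "nat \<Rightarrow> nat \<Rightarrow> nat \<Rightarrow> (nat \<Rightarrow> nat) \<Rightarrow> (nat \<Rightarrow> nat \<Rightarrow> nat) set" where
  "upper_chains d m n \<mu> = {L. L 0 = \<mu> \<and> (\<forall>k<n. interlace (L k) (L (Suc k))) \<and> (\<forall>k\<ge>n. L k = rect d m)}"

lemma compl_compl: "\<mu> \<le> rect d m \<Longrightarrow> compl d m (compl d m \<mu>) = \<mu>"
  by (auto simp: le_fun_def rect_def compl_def fun_eq_iff split: if_splits)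

lemma compl_rect: "compl d m (rect d m) = (\<lambda>_. 0)" "compl d m (\<lambda>_. 0) = rect d m"
  by (auto simp: compl_def rect_def)

lemma compl_le_rect: "compl d m \<mu> \<le> rect d m"
  by (auto simp: le_fun_def compl_def rect_def)

text \<open>Complementing reverses the inequalities, hence the pair is exchanged, and the reversed
  order of the rows keeps the index shift in the right direction.\<close>

lemma interlace_compl:
  assumes "interlace \<nu> \<mu>" "\<mu> \<le> rect d m"
  shows "interlace (compl d m \<mu>) (compl d m \<nu>)"
  unfolding interlace_def
proof
  fix i
  have *: "\<mu> (Suc k) \<le> \<nu> k" "\<nu> k \<le> \<mu> k" for k using assms(1) by (auto simp: interlace_def)
  show "compl d m \<nu> (Suc i) \<le> compl d m \<mu> i \<and> compl d m \<mu> i \<le> compl d m \<nu> i"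
  proof (cases "Suc i < d")
    case True
    then have "d - 1 - i = Suc (d - 1 - Suc i)" by simp
    then show ?thesis using True *(1)[of "d - 1 - Suc i"] *(2)[of "d - 1 - i"]
      by (auto simp: compl_def intro!: diff_le_mono2)
  next
    case False
    then show ?thesis using *(2)[of "d - 1 - i"] by (auto simp: compl_def intro!: diff_le_mono2)
  qed
qed

lemma interlace_le: "interlace \<nu> \<mu> \<Longrightarrow> \<nu> \<le> \<mu>"
  by (simp add: interlace_def le_fun_def)

lemma chain_le:
  assumes "\<forall>k<n. interlace (L k) (L (Suc k))" "k \<le> n"
  shows "L k \<le> (L n :: nat \<Rightarrow> nat)"
  using assms(2)
proof (induction k rule: inc_induct)
  case (step k)
  then show ?case using assms(1) interlace_le[of "L k" "L (Suc k)"] by (meson order_trans)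
qed simp

text \<open>Read backwards and complemented, a chain from \<open>\<mu>\<close> up to the rectangle
  starts at the empty partition and ends at the complement of \<open>\<mu>\<close>.\<close>

lemma upper_chains_card:
  assumes "\<mu> \<le> rect d m"
  shows "card (upper_chains d m n \<mu>) = gt_count n (compl d m \<mu>)"
proof -
  let ?rev = "\<lambda>L k. compl d m (L (n - k))"
  have "bij_betw ?rev (upper_chains d m n \<mu>) (lower_chains n (compl d m \<mu>))"
  proof (rule bij_betwI[where g = ?rev])
    have le: "L k \<le> rect d m" if "L \<in> upper_chains d m n \<mu>" for L k
      using that chain_le[of n L k] by (cases "k \<le> n") (auto simp: upper_chains_def)
    have le': "L k \<le> rect d m" if "L \<in> lower_chains n (compl d m \<mu>)" for L k
      using that chain_le[of n L k] compl_le_rect[of d m \<mu>] by (cases "k \<le> n") (auto simp: lower_chains_def intro: order_trans)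
    show "?rev \<in> upper_chains d m n \<mu> \<rightarrow> lower_chains n (compl d m \<mu>)"
    proof
      fix L assume L: "L \<in> upper_chains d m n \<mu>"
      have "interlace (compl d m (L (n - k))) (compl d m (L (n - Suc k)))" if "k < n" for k
      proof (rule interlace_compl[OF _ le[OF L]])
        have "interlace (L (n - Suc k)) (L (Suc (n - Suc k)))" using L that by (simp add: upper_chains_def)
        then show "interlace (L (n - Suc k)) (L (n - k))" using that by (simp add: Suc_diff_Suc)
      qed
      then show "?rev L \<in> lower_chains n (compl d m \<mu>)"
        using L by (simp add: lower_chains_def upper_chains_def compl_rect)
    qed
    show "?rev \<in> lower_chains n (compl d m \<mu>) \<rightarrow> upper_chains d m n \<mu>"
    proof
      fix L assume L: "L \<in> lower_chains n (compl d m \<mu>)"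
      have "interlace (compl d m (L (n - k))) (compl d m (L (n - Suc k)))" if "k < n" for k
      proof (rule interlace_compl[OF _ le'[OF L]])
        have "interlace (L (n - Suc k)) (L (Suc (n - Suc k)))" using L that by (simp add: lower_chains_def)
        then show "interlace (L (n - Suc k)) (L (n - k))" using that by (simp add: Suc_diff_Suc)
      qed
      then show "?rev L \<in> upper_chains d m n \<mu>"
        using L assms by (simp add: lower_chains_def upper_chains_def compl_rect compl_compl)
    qed
    show "?rev (?rev L) = L" if "L \<in> upper_chains d m n \<mu>" for L
    proof
      fix k show "?rev (?rev L) k = L k"
        using that le[OF that] by (cases "k \<le> n") (auto simp: compl_compl upper_chains_def)
    qed
    show "?rev (?rev L) = L" if "L \<in> lower_chains n (compl d m \<mu>)" for L
    proof
      fix k show "?rev (?rev L) k = L k"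
        using that le'[OF that] by (cases "k \<le> n") (auto simp: compl_compl compl_le_rect lower_chains_def)
    qed
  qed
  then have "card (upper_chains d m n \<mu>) = card (lower_chains n (compl d m \<mu>))"
    by (rule bij_betw_same_card)
  also have "\<dots> = gt_count n (compl d m \<mu>)"
    using lower_chains_card[of d "compl d m \<mu>" n] by (simp add: compl_def)
  finally show ?thesis .
qed

definition chains :: "nat \<Rightarrow> nat \<Rightarrow> (nat \<Rightarrow> nat \<Rightarrow> nat) set" where
  "chains d m = {L. L 0 = (\<lambda>_. 0) \<and> (\<forall>k<2 * d. interlace (L k) (L (Suc k))) \<and> (\<forall>k\<ge>2 * d. L k = rect d m)}"

text \<open>The chain is cut at step \<open>d\<close>. Both pieces contain the value
  \<open>\<mu>\<close> there, so they can be chosen independently and glued.\<close>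

lemma card_chains_middle:
  assumes "\<mu> \<le> rect d m"
  shows "card {L \<in> chains d m. L d = \<mu>} = gt_count d \<mu> * gt_count d (compl d m \<mu>)"
proof -
  let ?split = "\<lambda>L :: nat \<Rightarrow> nat \<Rightarrow> nat. (\<lambda>k. if k \<le> d then L k else \<mu>, \<lambda>k. L (d + k))"
  let ?join = "\<lambda>(A :: nat \<Rightarrow> nat \<Rightarrow> nat, B) k. if k \<le> d then A k else B (k - d)"
  have "bij_betw ?split {L \<in> chains d m. L d = \<mu>} (lower_chains d \<mu> \<times> upper_chains d m d \<mu>)"
  proof (rule bij_betwI[where g = ?join])
    show "?split \<in> {L \<in> chains d m. L d = \<mu>} \<rightarrow> lower_chains d \<mu> \<times> upper_chains d m d \<mu>"
      by (auto simp: chains_def lower_chains_def upper_chains_def)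
    show "?join \<in> lower_chains d \<mu> \<times> upper_chains d m d \<mu> \<rightarrow> {L \<in> chains d m. L d = \<mu>}"
    proof
      fix X assume "X \<in> lower_chains d \<mu> \<times> upper_chains d m d \<mu>"
      then obtain A B where X: "X = (A, B)" "A \<in> lower_chains d \<mu>" "B \<in> upper_chains d m d \<mu>" by blast
      have iB: "interlace (B k) (B (Suc k))" if "k < d" for k
        using X(3) that by (simp add: upper_chains_def)
      have "interlace (?join X k) (?join X (Suc k))" if k: "k < 2 * d" for k
      proof -
        consider "k < d" | "k = d" | "d < k" by linarith
        then show ?thesis
        proof cases
          case 2
          then have "interlace (B 0) (B (Suc 0))" using k by (intro iB) simp
          then show ?thesis using 2 X by (simp add: lower_chains_def upper_chains_def)
        next
          case 3
          then have "interlace (B (k - d)) (B (Suc (k - d)))" using k by (intro iB) simp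
          then show ?thesis using 3 X by (simp add: Suc_diff_le)
        qed (use X in \<open>simp add: lower_chains_def\<close>)
      qed
      moreover have "?join X k = rect d m" if "2 * d \<le> k" for k
        using X that by (cases "d = 0"; cases "k = 0") (auto simp: lower_chains_def upper_chains_def)
      ultimately show "?join X \<in> {L \<in> chains d m. L d = \<mu>}"
        using X by (auto simp: chains_def lower_chains_def)
    qed
    show "?join (?split L) = L" if "L \<in> {L \<in> chains d m. L d = \<mu>}" for L
      by (rule ext) auto
    show "?split (?join X) = X" if X: "X \<in> lower_chains d \<mu> \<times> upper_chains d m d \<mu>" for X
    proof -
      obtain A B where AB: "X = (A, B)" "A \<in> lower_chains d \<mu>" "B \<in> upper_chains d m d \<mu>" using X by blast
      have "(\<lambda>k. if k \<le> d then if k \<le> d then A k else B (k - d) else \<mu>) = A"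
        using AB by (auto simp: lower_chains_def)
      moreover have "(\<lambda>k. if d + k \<le> d then A (d + k) else B (d + k - d)) = B"
      proof
        fix k show "(if d + k \<le> d then A (d + k) else B (d + k - d)) = B k"
          using AB by (cases "k = 0") (auto simp: lower_chains_def upper_chains_def)
      qed
      ultimately show ?thesis by (simp only: AB(1) prod.case)
    qed
  qed
  then have "card {L \<in> chains d m. L d = \<mu>} = card (lower_chains d \<mu>) * card (upper_chains d m d \<mu>)"
    by (simp add: bij_betw_same_card card_cartesian_product)
  moreover have "card (lower_chains d \<mu>) = gt_count d \<mu>"
  proof -
    have "\<mu> i = 0" if "d \<le> i" for i using le_funD[OF assms, of i] that by (simp add: rect_def)
    then show ?thesis using lower_chains_card[of d \<mu> d] by blast
  qed
  ultimately show ?thesis using upper_chains_card[OF assms] by simp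
qed

text \<open>The inequality is strict, so passing from \<open>k\<close> to \<open>Suc k\<close> adds
  exactly the cells with entry \<open>k\<close>, and the chain starts at the empty
  partition.\<close>

definition shape :: "nat \<Rightarrow> nat list list \<Rightarrow> nat \<Rightarrow> nat \<Rightarrow> nat" where
  "shape d T k i = (if i < d then length (filter (\<lambda>c. c ! i < k) T) else 0)"

lemma sorted_filter_less:
  assumes "sorted xs" "j < length xs"
  shows "j < length (filter (\<lambda>x. x < k) xs) \<longleftrightarrow> xs ! j < (k :: nat)"
  using assms
proof (induction xs arbitrary: j)
  case (Cons x xs)
  show ?case
  proof (cases "x < k")
    case True
    then show ?thesis using Cons by (cases j) auto
  next
    case False
    have "x \<le> (x # xs) ! j" using Cons.prems by (cases j) auto
    moreover have "filter (\<lambda>x. x < k) (x # xs) = []"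
      using Cons.prems False by (auto simp: filter_empty_conv)
    ultimately show ?thesis using False by auto
  qed
qed simp

text \<open>Rows increase weakly, so the entries below \<open>k\<close> form an initial segment.
  Through this equivalence a tableau can be recovered from its chain.\<close>

lemma less_shape_iff:
  assumes "standard d T" "i < d" "j < length T"
  shows "j < shape d T k i \<longleftrightarrow> T ! j ! i < k"
proof -
  have "shape d T k i = length (filter (\<lambda>x. x < k) (map (\<lambda>c. c ! i) T))"
    using assms(2) by (simp add: shape_def filter_map o_def)
  then show ?thesis
    using sorted_filter_less[OF standard_rows_sorted[OF assms(1,2)], of j k] assms(3) by simp
qed

text \<open>In a strictly increasing column, an entry below \<open>Suc k\<close> in row
  \<open>Suc i\<close> forces an entry below \<open>k\<close> in row \<open>i\<close>. This is the
  interlacing condition, and the argument can be reversed.\<close>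

lemma shape_bij: "bij_betw (shape d) (standard_tableaux d m) (chains d m)"
proof (rule bij_betw_imageI)
  show "inj_on (shape d) (standard_tableaux d m)"
  proof (rule inj_onI)
    fix T T' assume *: "T \<in> standard_tableaux d m" "T' \<in> standard_tableaux d m" "shape d T = shape d T'"
    then have st: "standard d T" "standard d T'" "length T = m" "length T' = m"
      by (auto simp: standard_tableaux_def)
    show "T = T'"
    proof (rule nth_equalityI)
      fix j assume j: "j < length T"
      have len: "length (T ! j) = d" "length (T' ! j) = d"
        using st j by (auto simp: standard_def tableau_def)
      show "T ! j = T' ! j"
      proof (rule nth_equalityI)
        fix i assume "i < length (T ! j)"
        then have "T ! j ! i < k \<longleftrightarrow> T' ! j ! i < k" for k
          using less_shape_iff[OF st(1), of i j k] less_shape_iff[OF st(2), of i j k] j st(3,4) len *(3) by simp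
        then show "T ! j ! i = T' ! j ! i" by (meson linorder_neq_iff)
      qed (simp add: len)
    qed (simp add: st)
  qed
  show "shape d ` standard_tableaux d m = chains d m"
  proof (rule equalityI; rule subsetI)
    fix L assume "L \<in> shape d ` standard_tableaux d m"
    then obtain T where T: "standard d T" "length T = m" "set (concat T) \<subseteq> {..<2 * d}" "L = shape d T"
      by (auto simp: standard_tableaux_def)
    have c: "length c = d" "sorted_wrt (<) c" "set c \<subseteq> {..<2 * d}" if "c \<in> set T" for c
      using T that by (auto simp: standard_def tableau_def)
    have mono: "length (filter P T) \<le> length (filter Q T)" if "\<And>c. c \<in> set T \<Longrightarrow> P c \<Longrightarrow> Q c" for P Q
      using that by (induction T) (auto simp: le_SucI)
    have "interlace (shape d T k) (shape d T (Suc k))" for k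
      unfolding interlace_def
    proof (intro allI conjI)
      fix i
      show "shape d T k i \<le> shape d T (Suc k) i" by (auto simp: shape_def intro!: mono)
      show "shape d T (Suc k) (Suc i) \<le> shape d T k i"
      proof (cases "Suc i < d")
        case True
        have "length (filter (\<lambda>c. c ! Suc i < Suc k) T) \<le> length (filter (\<lambda>c. c ! i < k) T)"
        proof (rule mono)
          fix x assume "x \<in> set T" "x ! Suc i < Suc k"
          moreover have "x ! i < x ! Suc i" using c[OF \<open>x \<in> set T\<close>] True by (simp add: sorted_wrt_iff_nth_less)
          ultimately show "x ! i < k" by simp
        qed
        then show ?thesis using True by (simp add: shape_def)
      qed (simp add: shape_def)
    qed
    moreover have "shape d T k = rect d m" if "2 * d \<le> k" for k
    proof
      fix i
      have "x ! i < k" if "x \<in> set T" "i < d" for x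
      proof -
        have "x ! i \<in> set x" using c(1)[OF that(1)] that(2) by simp
        then show ?thesis using c(3)[OF that(1)] \<open>2 * d \<le> k\<close> by auto
      qed
      then have "filter (\<lambda>c. c ! i < k) T = T" if "i < d" using that by (intro filter_True) auto
      then show "shape d T k i = rect d m i" by (auto simp: shape_def rect_def T(2))
    qed
    ultimately show "L \<in> chains d m" unfolding T(4) by (auto simp: chains_def shape_def)
  next
    fix L assume L: "L \<in> chains d m"
    have step: "L (Suc k) (Suc i) \<le> L k i" "L k i \<le> L (Suc k) i" if "i < d" "Suc i < d \<or> k < 2 * d" for k i
      using L that by (cases "k < 2 * d"; auto simp: chains_def interlace_def rect_def)+
    have mono: "L k i \<le> L k' i" if "k \<le> k'" for k k' i
    proof (rule lift_Suc_mono_le[OF _ that])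
      fix k show "L k i \<le> L (Suc k) i"
        using L by (cases "k < 2 * d") (auto simp: chains_def interlace_def)
    qed
    have top: "L (2 * d) = rect d m" "L 0 = (\<lambda>_. 0)" using L by (auto simp: chains_def)
    have le: "L k \<le> rect d m" for k
      using L chain_le[of "2 * d" L k] by (cases "k \<le> 2 * d") (auto simp: chains_def)
    \<comment> \<open>The step at which the cell in row \<open>i\<close> and column \<open>j\<close>
      is filled; for \<open>i < d\<close> and \<open>j < m\<close> it exists because the chain ends
      in the rectangle.\<close>
    define t where "t j i = (LEAST k. j < L (Suc k) i)" for j i
    have t_less: "t j i < k \<longleftrightarrow> j < L k i" if "i < d" "j < m" for i j k
    proof
      assume "t j i < k"
      have "j < L (Suc (2 * d - 1)) i" using that top by (simp add: rect_def)
      then have "j < L (Suc (t j i)) i" unfolding t_def by (rule LeastI)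
      also have "\<dots> \<le> L k i" using \<open>t j i < k\<close> by (intro mono) simp
      finally show "j < L k i" .
    next
      assume *: "j < L k i"
      then obtain k' where k': "k = Suc k'" using top by (cases k) auto
      then have "t j i \<le> k'" unfolding t_def using * by (intro Least_le) simp
      then show "t j i < k" using k' by simp
    qed
    define T where "T = map (\<lambda>j. map (t j) [0..<d]) [0..<m]"
    have "standard d T"
      unfolding standard_def
    proof (intro conjI ballI)
      show "tableau d T" by (auto simp: T_def tableau_def)
      fix c assume "c \<in> set T"
      then obtain j where j: "j < m" "c = map (t j) [0..<d]" by (auto simp: T_def)
      have "t j i < t j (Suc i)" if "Suc i < d" for i
      proof -
        have "j < L (Suc (t j (Suc i))) (Suc i)" using t_less[of "Suc i" j "Suc (t j (Suc i))"] that j by simp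
        also have "\<dots> \<le> L (t j (Suc i)) i" using step(1) that by simp
        finally show ?thesis using t_less[of i j] that j by simp
      qed
      then show "sorted_wrt (<) c"
        by (subst sorted_wrt_iff_nth_Suc_transp) (auto simp: j(2))
    next
      have "t j i \<le> t j' i" if "j < j'" "j' < m" "i < d" for j j' i
      proof -
        have "j' < L (Suc (t j' i)) i" using t_less[of i j' "Suc (t j' i)"] that by simp
        then have "j < L (Suc (t j' i)) i" using that by simp
        then show ?thesis using t_less[of i j "Suc (t j' i)"] that by simp
      qed
      then show "sorted_wrt (list_all2 (\<le>)) T"
        by (auto simp: T_def sorted_wrt_iff_nth_less list_all2_conv_all_nth)
    qed
    moreover have "set (concat T) \<subseteq> {..<2 * d}"
    proof
      fix x assume "x \<in> set (concat T)"
      then obtain j i where "j < m" "i < d" "x = t j i" by (auto simp: T_def)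
      then show "x \<in> {..<2 * d}" using t_less[of i j "2 * d"] top by (simp add: rect_def)
    qed
    ultimately have T: "T \<in> standard_tableaux d m" by (simp add: standard_tableaux_def T_def)
    have "shape d T k i = L k i" for k i
    proof (cases "i < d")
      case True
      have "shape d T k i = length (filter (\<lambda>j. t j i < k) [0..<m])"
        using True by (simp add: shape_def T_def filter_map o_def)
      also have "\<dots> = card {j. j < m \<and> t j i < k}"
        by (subst distinct_card[symmetric]) (auto intro!: arg_cong[of _ _ card])
      also have "{j. j < m \<and> t j i < k} = {..<L k i}"
        using t_less[OF True] le_funD[OF le[of k], of i] True by (auto simp: rect_def)
      finally show ?thesis by simp
    next
      case False
      then show ?thesis using le[of k] by (auto simp: shape_def le_fun_def rect_def dest: spec[of _ i])
    qed
    then show "L \<in> shape d ` standard_tableaux d m" using T by (intro image_eqI[of _ _ T]) (auto simp: fun_eq_iff)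
  qed
qed

section \<open>From middle shapes to highest weights\<close>

lemma low_eq_sum_shape:
  assumes "tableau d T"
  shows "low d T = (\<Sum>i<d. shape d T d i)"
  using assms
proof (induction T)
  case Nil
  then show ?case by (simp add: shape_def)
next
  case (Cons c T)
  have "length (filter (\<lambda>v. v < d) c) = (\<Sum>i<d. of_bool (c ! i < d))"
    using Cons.prems by (simp add: length_filter_eq_sum_nth tableau_def atLeast0LessThan)
  moreover have "shape d (c # T) d i = of_bool (c ! i < d) + shape d T d i" if "i < d" for i
    using that by (simp add: shape_def)
  ultimately show ?case using Cons by (simp add: tableau_def sum.distrib)
qed

text \<open>The entries below \<open>k\<close> occupy the first columns of a row, so cutting after
  \<open>s\<close> columns truncates their number at \<open>s\<close>. This carries the condition on
  the first \<open>s\<close> columns over to the middle shape.\<close>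

lemma shape_take:
  assumes "standard d T" "s \<le> length T" "i < d"
  shows "shape d (take s T) k i = min s (shape d T k i)"
proof -
  have "shape d (take s T) k i = length (filter (\<lambda>j. T ! j ! i < k) [0..<s])"
  proof -
    have "take s T = map (nth T) [0..<s]" using assms(2) by (auto intro: nth_equalityI)
    then show ?thesis using assms(3) by (simp add: shape_def filter_map o_def)
  qed
  also have "\<dots> = card {j. j < s \<and> T ! j ! i < k}"
    by (subst distinct_card[symmetric]) (auto intro!: arg_cong[of _ _ card])
  also have "{j. j < s \<and> T ! j ! i < k} = {..<min s (shape d T k i)}"
    using less_shape_iff[OF assms(1,3)] assms(2) by auto
  finally show ?thesis by simp
qed

definition middle_shapes :: "nat \<Rightarrow> nat \<Rightarrow> nat \<Rightarrow> (nat \<Rightarrow> nat) set" where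
  "middle_shapes d r s = {\<mu>. \<mu> \<le> rect d (r + s) \<and> (\<forall>i. \<mu> (Suc i) \<le> \<mu> i) \<and>
     (\<Sum>i<d. \<mu> i) = r + s * (d - 1) \<and> s * (d - 1) \<le> (\<Sum>i<d. min s (\<mu> i))}"

lemma finite_middle_shapes: "finite (middle_shapes d r s)"
proof (rule finite_subset)
  show "middle_shapes d r s \<subseteq> {\<mu>. \<forall>i. (i \<in> {..<d} \<longrightarrow> \<mu> i \<in> {..r + s}) \<and> (i \<notin> {..<d} \<longrightarrow> \<mu> i = 0)}"
    by (auto simp: middle_shapes_def le_fun_def rect_def split: if_splits)
  show "finite {\<mu>. \<forall>i. (i \<in> {..<d} \<longrightarrow> \<mu> i \<in> {..r + s}) \<and> (i \<notin> {..<d} \<longrightarrow> \<mu> i = 0)}"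
    by (rule finite_set_of_finite_funs) auto
qed

lemma card_good_tableaux_eq_sum:
  assumes "d > 0"
  shows "card (good_tableaux d r s) = (\<Sum>\<mu>\<in>middle_shapes d r s. gt_count d \<mu> * gt_count d (compl d (r + s) \<mu>))"
proof -
  let ?m = "r + s"
  have good: "T \<in> good_tableaux d r s \<longleftrightarrow> T \<in> standard_tableaux d ?m \<and> shape d T d \<in> middle_shapes d r s" for T
  proof (cases "T \<in> standard_tableaux d ?m")
    case True
    then have T: "standard d T" "length T = ?m" "tableau d T" "tableau d (take s T)"
      by (auto simp: standard_tableaux_def standard_def tableau_def dest: in_set_takeD)
    have "shape d T \<in> chains d ?m" using bij_betwE[OF shape_bij] True by blast
    then have "interlace (shape d T d) (shape d T (Suc d))" "shape d T d \<le> rect d ?m"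
      using assms chain_le[of "2 * d" "shape d T" d] by (auto simp: chains_def)
    moreover have "low d (take s T) = (\<Sum>i<d. min s (shape d T d i))"
      unfolding low_eq_sum_shape[OF T(4)] using shape_take[OF T(1), of s _ d] T(2) by (intro sum.cong) auto
    ultimately show ?thesis
      using True interlace_decreasing low_eq_sum_shape[OF T(3)]
      by (auto simp: good_tableaux_def standard_tableaux_def middle_shapes_def)
  qed (auto simp: good_tableaux_def standard_tableaux_def)
  have "card (good_tableaux d r s) = card {L \<in> chains d ?m. L d \<in> middle_shapes d r s}"
  proof (rule bij_betw_same_card)
    have "good_tableaux d r s = {T \<in> standard_tableaux d ?m. shape d T d \<in> middle_shapes d r s}" using good by blast
    moreover have "shape d ` {T \<in> standard_tableaux d ?m. shape d T d \<in> middle_shapes d r s} =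
        {L \<in> chains d ?m. L d \<in> middle_shapes d r s}"
      unfolding bij_betw_imp_surj_on[OF shape_bij, symmetric] by auto
    ultimately show "bij_betw (shape d) (good_tableaux d r s) {L \<in> chains d ?m. L d \<in> middle_shapes d r s}"
      by (intro bij_betw_subset[OF shape_bij[of d ?m]]) simp_all
  qed
  also have "{L \<in> chains d ?m. L d \<in> middle_shapes d r s} = (\<Union>\<mu>\<in>middle_shapes d r s. {L \<in> chains d ?m. L d = \<mu>})"
    by auto
  also have "card \<dots> = (\<Sum>\<mu>\<in>middle_shapes d r s. card {L \<in> chains d ?m. L d = \<mu>})"
  proof (rule card_UN_disjoint)
    have "finite (chains d ?m)" using bij_betw_finite[OF shape_bij] finite_standard_tableaux by blast
    then show "\<forall>\<mu>\<in>middle_shapes d r s. finite {L \<in> chains d ?m. L d = \<mu>}" by simp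
  qed (use finite_middle_shapes in auto)
  also have "\<dots> = (\<Sum>\<mu>\<in>middle_shapes d r s. gt_count d \<mu> * gt_count d (compl d ?m \<mu>))"
    by (intro sum.cong refl card_chains_middle) (simp add: middle_shapes_def)
  finally show ?thesis .
qed

text \<open>The product formula only sees differences of parts, and complementing preserves them
  when \<open>(i, j)\<close> is sent to \<open>(d - 1 - j, d - 1 - i)\<close>. In terms of
  representations this is duality; it turns the product of two counts into a square.\<close>

lemma gt_count_compl:
  assumes "\<mu> \<le> rect d m" "\<And>i. \<mu> (Suc i) \<le> \<mu> i"
  shows "gt_count d (compl d m \<mu>) = gt_count d \<mu>"
proof -
  let ?I = "{(i, j). i < j \<and> j < d}"
  have le: "\<mu> i \<le> m" for i using assms(1) by (auto simp: le_fun_def rect_def dest: spec[of _ i] split: if_splits)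
  have zero: "\<mu> d = 0" using assms(1) by (auto simp: le_fun_def rect_def dest: spec[of _ d])
  have dec: "compl d m \<mu> (Suc i) \<le> compl d m \<mu> i" for i
    using decreasing_le[of \<mu> "d - 1 - Suc i" "d - 1 - i"] assms(2) by (auto simp: compl_def intro!: diff_le_mono2)
  have "real (gt_count d (compl d m \<mu>)) =
      (\<Prod>(i, j) \<in> ?I. (real (compl d m \<mu> i) - real (compl d m \<mu> j) + real j - real i) / (real j - real i))"
    by (rule gt_count_eq_prod[of "compl d m \<mu>" d, OF dec]) (simp add: compl_def)
  also have "\<dots> = (\<Prod>(i, j) \<in> ?I. (real (\<mu> i) - real (\<mu> j) + real j - real i) / (real j - real i))"
    by (rule prod.reindex_bij_witness[of _ "\<lambda>(i, j). (d - 1 - j, d - 1 - i)" "\<lambda>(i, j). (d - 1 - j, d - 1 - i)"])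
       (auto simp: compl_def le of_nat_diff)
  also have "\<dots> = real (gt_count d \<mu>)"
    by (rule gt_count_eq_prod[of \<mu> d, OF assms(2) zero, symmetric])
  finally show ?thesis by simp
qed

lemma sum_list_eq_sum: "sum_list xs = (\<Sum>i<length xs. xs ! i)"
  by (simp add: sum_list_sum_nth atLeast0LessThan)

lemma sum_list_filter_pos: "sum_list (filter (\<lambda>k. k > 0) xs) = (\<Sum>i<length xs. max 0 (xs ! i :: int))"
proof -
  have "sum_list (filter (\<lambda>k. k > 0) xs) = sum_list (map (max 0) xs)" by (induction xs) auto
  then show ?thesis by (simp add: sum_list_eq_sum)
qed

text \<open>A highest weight is a middle shape shifted down by \<^term>\<open>s\<close>.\<close>
lemma middle_shapes_weights_bij:
  assumes "d > 0"
  shows "bij_betw (\<lambda>\<mu>. map (\<lambda>i. int (\<mu> i) - int s) [0..<d]) (middle_shapes d r s) (weights d r s)"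
proof -
  let ?f = "\<lambda>\<mu>. map (\<lambda>i. int (\<mu> i) - int s) [0..<d]"
  let ?g = "\<lambda>xs i. if i < d then nat (xs ! i + int s) else 0"
  have sd: "int s * int d = int (s * (d - 1)) + int s" using assms by (cases d) (auto simp: algebra_simps)
  show ?thesis
  proof (rule bij_betwI[where g = ?g])
    show "?f \<in> middle_shapes d r s \<rightarrow> weights d r s"
    proof
      fix \<mu> assume \<mu>: "\<mu> \<in> middle_shapes d r s"
      have middle: "int (\<Sum>i<d. \<mu> i) = int r + int (s * (d - 1))"
        using \<mu> by (simp add: middle_shapes_def del: of_nat_sum)
      have "(\<Sum>i<d. int (\<mu> i) - int s) = int (\<Sum>i<d. \<mu> i) - int s * int d"
        by (simp add: sum_subtractf)
      then have sum: "(\<Sum>i<d. int (\<mu> i) - int s) = int r - int s"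
        using middle sd by linarith
      \<comment> \<open>\<open>min s (\<mu> i)\<close> and the positive part of
        \<open>\<mu> i - s\<close> add up to \<open>\<mu> i\<close>, which turns the bound on the
        first \<open>s\<close> columns into the one on the positive entries.\<close>
      have "(\<Sum>i<d. max 0 (int (\<mu> i) - int s)) = (\<Sum>i<d. int (\<mu> i) - int (min s (\<mu> i)))"
        by (intro sum.cong) auto
      also have "\<dots> = int (\<Sum>i<d. \<mu> i) - int (\<Sum>i<d. min s (\<mu> i))" by (simp add: sum_subtractf)
      also have "\<dots> \<le> int r"
      proof -
        have "int (s * (d - 1)) \<le> int (\<Sum>i<d. min s (\<mu> i))"
          using \<mu> by (simp only: middle_shapes_def mem_Collect_eq of_nat_le_iff)
        then show ?thesis using middle by linarith
      qed
      finally have pos: "(\<Sum>i<d. max 0 (int (\<mu> i) - int s)) \<le> int r" .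
      have "\<mu> j \<le> \<mu> i" if "i \<le> j" for i j using decreasing_le[of \<mu> i j] \<mu> that by (simp add: middle_shapes_def)
      then have "sorted_wrt (\<ge>) (?f \<mu>)" by (simp add: sorted_wrt_iff_nth_less)
      moreover have "sum_list (?f \<mu>) = int r - int s" using sum by (simp add: sum_list_eq_sum)
      moreover have "sum_list (filter (\<lambda>k. k > 0) (?f \<mu>)) \<le> int r"
        unfolding sum_list_filter_pos using pos by simp
      ultimately show "?f \<mu> \<in> weights d r s" by (simp add: weights_def)
    qed
    have W: "length xs = d" "\<And>i j. i \<le> j \<Longrightarrow> j < d \<Longrightarrow> xs ! j \<le> xs ! i" "(\<Sum>i<d. xs ! i) = int r - int s"
      "(\<Sum>i<d. max 0 (xs ! i)) \<le> int r" "\<And>i. i < d \<Longrightarrow> - int s \<le> xs ! i" "\<And>i. i < d \<Longrightarrow> xs ! i \<le> int r"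
      if xs: "xs \<in> weights d r s" for xs
    proof -
      show len: "length xs = d" using xs by (simp add: weights_def)
      show "xs ! j \<le> xs ! i" if "i \<le> j" "j < d" for i j
        using xs that len by (cases "i = j") (auto simp: weights_def sorted_wrt_iff_nth_less)
      show sum: "(\<Sum>i<d. xs ! i) = int r - int s" and pos: "(\<Sum>i<d. max 0 (xs ! i)) \<le> int r"
        using xs len unfolding weights_def sum_list_filter_pos by (auto simp: sum_list_eq_sum)
      fix i assume i: "i < d"
      have "max 0 (xs ! i) \<le> (\<Sum>i<d. max 0 (xs ! i))" using i by (intro member_le_sum) auto
      then show "xs ! i \<le> int r" using pos by simp
      \<comment> \<open>The other entries sum to at most the positive total, hence to at most
        \<open>r\<close>, and all entries together to \<open>r - s\<close>. So no entry falls below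
        \<open>- s\<close>, and after the shift by \<open>s\<close> the conversion to
        \<open>nat\<close> loses nothing.\<close>
      have "(\<Sum>i<d. xs ! i) = xs ! i + (\<Sum>j\<in>{..<d} - {i}. xs ! j)" using i by (subst sum.remove[of _ i]) auto
      also have "(\<Sum>j\<in>{..<d} - {i}. xs ! j) \<le> (\<Sum>j\<in>{..<d} - {i}. max 0 (xs ! j))" by (intro sum_mono) auto
      also have "\<dots> \<le> (\<Sum>j<d. max 0 (xs ! j))" by (intro sum_mono2) auto
      finally show "- int s \<le> xs ! i" using sum pos by simp
    qed
    show "?g \<in> weights d r s \<rightarrow> middle_shapes d r s"
    proof
      fix xs assume "xs \<in> weights d r s"
      note w = W[OF this]
      have g: "int (?g xs i) = xs ! i + int s" if "i < d" for i using w(5)[OF that] that by simp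
      have "int (\<Sum>i<d. ?g xs i) = (\<Sum>i<d. xs ! i + int s)" unfolding of_nat_sum by (intro sum.cong g) auto
      also have "\<dots> = int (r + s * (d - 1))" using w(3) sd by (simp add: sum.distrib mult.commute)
      finally have sum: "(\<Sum>i<d. ?g xs i) = r + s * (d - 1)" by (simp only: of_nat_eq_iff)
      have "int (\<Sum>i<d. min s (?g xs i)) = (\<Sum>i<d. xs ! i + int s - max 0 (xs ! i))"
        unfolding of_nat_sum
      proof (intro sum.cong refl)
        fix i assume "i \<in> {..<d}"
        then show "int (min s (?g xs i)) = xs ! i + int s - max 0 (xs ! i)" by (subst of_nat_min, subst g) (auto simp: min_def max_def)
      qed
      also have "\<dots> = int r - int s + int s * int d - (\<Sum>i<d. max 0 (xs ! i))"
        using w(3) by (simp add: sum.distrib sum_subtractf mult.commute)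
      also have "\<dots> \<ge> int (s * (d - 1))" using w(4) sd by linarith
      finally have "s * (d - 1) \<le> (\<Sum>i<d. min s (?g xs i))" by (simp only: of_nat_le_iff)
      moreover have "?g xs \<le> rect d (r + s)" using w(6) by (auto simp: le_fun_def rect_def nat_le_iff)
      moreover have "?g xs (Suc i) \<le> ?g xs i" for i using w(2)[of i "Suc i"] by auto
      ultimately show "?g xs \<in> middle_shapes d r s" using sum unfolding middle_shapes_def by blast
    qed
    show "?g (?f \<mu>) = \<mu>" if "\<mu> \<in> middle_shapes d r s" for \<mu>
      using that by (auto simp: middle_shapes_def le_fun_def rect_def fun_eq_iff) (metis le_zero_eq)
    show "?f (?g xs) = xs" if "xs \<in> weights d r s" for xs
    proof (rule nth_equalityI)
      fix i assume "i < length (?f (?g xs))"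
      then show "?f (?g xs) ! i = xs ! i" using W(5)[OF that, of i] by simp
    qed (use W(1)[OF that] in simp)
  qed
qed

text \<open>The shift by \<open>s\<close> cancels in all differences of parts.\<close>

lemma gt_count_eq_d_mu:
  assumes "\<mu> \<in> middle_shapes d r s"
  shows "real (gt_count d \<mu>) = d_mu (map (\<lambda>i. int (\<mu> i) - int s) [0..<d])"
proof -
  have "\<mu> d = 0" using assms by (auto simp: middle_shapes_def le_fun_def rect_def dest: spec[of _ d])
  then show ?thesis
    unfolding d_mu_def using assms
    by (subst gt_count_eq_prod) (auto simp: middle_shapes_def intro!: prod.cong)
qed

lemma card_good_tableaux:
  assumes "d > 0"
  shows "real (card (good_tableaux d r s)) = (\<Sum>\<mu> \<in> weights d r s. (d_mu \<mu>)\<^sup>2)"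
proof -
  have "real (card (good_tableaux d r s)) = (\<Sum>\<mu>\<in>middle_shapes d r s. (real (gt_count d \<mu>))\<^sup>2)"
    unfolding card_good_tableaux_eq_sum[OF assms] of_nat_sum
    by (intro sum.cong refl, subst gt_count_compl) (auto simp: middle_shapes_def power2_eq_square)
  also have "\<dots> = (\<Sum>\<mu>\<in>middle_shapes d r s. (d_mu (map (\<lambda>i. int (\<mu> i) - int s) [0..<d]))\<^sup>2)"
    by (intro sum.cong refl) (simp add: gt_count_eq_d_mu)
  also have "\<dots> = (\<Sum>\<mu> \<in> weights d r s. (d_mu \<mu>)\<^sup>2)"
    by (rule sum.reindex_bij_betw[OF middle_shapes_weights_bij[OF assms]])
  finally show ?thesis .
qed

theorem theorem2p6:
  fixes d r s :: nat
  assumes "d > 0" and "r > 0" and "s > 0"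
  shows "real (fun_vs.dim (Hom_U d r s)) = (\<Sum>\<mu> \<in> weights d r s. (d_mu \<mu>)\<^sup>2)"
  using dim_Hom_U_eq_card[OF assms(1)] card_good_tableaux[OF assms(1)] by simp

end
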